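(* Let $n,p$ be non-negative integers and let $\mathcal{V}$ be a primitive subspace of $\mathrm{M}_{n,p}(\mathbb{F}_2)$ with upper rank $2$. Then $n=p=3$ and exactly one of the following four conditions holds: (i) $\mathcal{V}$ is equivalent to a linear subspace of $\mathcal{J}_3(\mathbb{F}_2)$; (ii) $\mathcal{V}$ is equivalent to $\mathrm{A}_3(\mathbb{F}_2)$; (iii) $\mathcal{V}$ is equivalent to $\mathcal{U}_3(\mathbb{F}_2)$; (iv) $\mathcal{V}$ is equivalent to $\mathcal{V}_3(\mathbb{F}_2)$.
   Context: $\mathrm{M}_{n,p}(\mathbb{K})$ is the space of $n\times p$ matrices over a field $\mathbb{K}$, and $\mathrm{M}_n(\mathbb{K})=\mathrm{M}_{n,n}(\mathbb{K})$. The upper rank $\operatorname{urk}(\mathcal{V})$ of a linear subspace $\mathcal{V}$ of $\mathrm{M}_{n,p}(\mathbb{K})$ is the maximal rank of a matrix in $\mathcal{V}$. Two linear subspaces $\mathcal{V}_1,\mathcal{V}_2$ of $\mathrm{M}_{n,p}(\mathbb{K})$ are equivalent when $\mathcal{V}_2=P\mathcal{V}_1Q$ for some $P\in\mathrm{GL}_n(\mathbb{K})$, $Q\in\mathrm{GL}_p(\mathbb{K})$. A linear subspace $\mathcal{V}$ of $\mathrm{M}_{n,p}(\mathbb{K})$ with upper rank $r$ is called primitive when: (i) no non-zero vector of $\mathbb{K}^p$ belongs to the kernel of every matrix of $\mathcal{V}$; (ii) the span of the ranges of all the matrices of $\mathcal{V}$ is $\mathbb{K}^n$; (iii) $\mathcal{V}$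 is not equivalent to a space $\mathcal{T}$ of matrices of the form $M=\begin{bmatrix} H(M) & [?]_{n\times 1}\end{bmatrix}$ (so $H(M)\in\mathrm{M}_{n,p-1}(\mathbb{K})$) where $\operatorname{urk}H(\mathcal{T})\leq r-1$; (iv) $\mathcal{V}$ is not equivalent to a space $\mathcal{T}$ of matrices of the form $M=\begin{bmatrix} H(M)\\ [?]_{1\times p}\end{bmatrix}$ (so $H(M)\in\mathrm{M}_{n-1,p}(\mathbb{K})$) where $\operatorname{urk}H(\mathcal{T})\leq r-1$. $\mathrm{A}_3(\mathbb{F}_2)$ is the space of all $3\times 3$ alternating matrices over $\mathbb{F}_2$ (skew-symmetric with zero diagonal). Moreover $$\mathcal{J}_3(\mathbb{F}_2)=\left\{\begin{bmatrix}a&c&d\\0&a+b&e\\0&0&b\end{bmatrix}\mid (a,b,c,d,e)\in\mathbb{F}_2^5\right\},$$ $$\mathcal{U}_3(\mathbb{F}_2)=\left\{\begin{bmatrix}0&a&a+c\\ a&0&b\\ a+b&c&0\end{bmatrix} \mid (a,b,c)\in\mathbb{F}_2^3\right\},\qquad \mathcal{V}_3(\mathbb{F}_2)=\left\{\begin{bmatrix}0&a&c+d\\ c&0&b\\ a+b&d&0\end{bmatrix} \mid (a,b,c,d)\in\mathbb{F}_2^4\right\}.$$ *)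

theory Defs
  imports "Jordan_Normal_Form.DL_Rank" "Jordan_Normal_Form.Matrix_Kernel" "HOL-Library.Z2"
begin

text \<open>The field with two elements is the type \<^typ>\<open>bit\<close>; n-by-p matrices are the
  elements of \<open>carrier_mat n p\<close>, where n and p may be zero.\<close>

definition mat_subspace :: "nat \<Rightarrow> nat \<Rightarrow> 'a::field mat set \<Rightarrow> bool" where
  "mat_subspace n p \<V> \<longleftrightarrow> VectorSpace.subspace class_ring \<V> (module_mat TYPE('a) n p)"

text \<open>For a nonempty set of matrices in \<open>carrier_mat n p\<close> the ranks are bounded by p, so the
  maximum below is always attained. The argument n is the number of rows, which
  \<^const>\<open>vec_space.rank\<close> needs.\<close>

definition urk :: "nat \<Rightarrow> 'a::field mat set \<Rightarrow> nat" where
  "urk n \<V> = Max (vec_space.rank n ` \<V>)"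

definition mat_space_equiv :: "nat \<Rightarrow> nat \<Rightarrow> 'a::field mat set \<Rightarrow> 'a mat set \<Rightarrow> bool" where
  "mat_space_equiv n p \<V>\<^sub>1 \<V>\<^sub>2 \<longleftrightarrow>
     (\<exists>P Q. P \<in> carrier_mat n n \<and> invertible_mat P \<and>
            Q \<in> carrier_mat p p \<and> invertible_mat Q \<and>
            \<V>\<^sub>2 = (\<lambda>M. P * M * Q) ` \<V>\<^sub>1)"

definition drop_last_col :: "'a mat \<Rightarrow> 'a mat" where
  "drop_last_col M = mat (dim_row M) (dim_col M - 1) (\<lambda>(i, j). M $$ (i, j))"

definition drop_last_row :: "'a mat \<Rightarrow> 'a mat" where
  "drop_last_row M = mat (dim_row M - 1) (dim_col M) (\<lambda>(i, j). M $$ (i, j))"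

text \<open>In the last two clauses, the block H(M) of M is M without its last column (row). These
  clauses are void when there is no column (row) to delete. The bound r - 1 is taken in the
  integers, to avoid truncated subtraction for r = 0.\<close>

definition primitive :: "nat \<Rightarrow> nat \<Rightarrow> 'a::field mat set \<Rightarrow> bool" where
  "primitive n p \<V> \<longleftrightarrow>
     mat_subspace n p \<V> \<and>
     \<not> (\<exists>x \<in> carrier_vec p. x \<noteq> 0\<^sub>v p \<and> (\<forall>M\<in>\<V>. x \<in> mat_kernel M)) \<and>
     LinearCombinations.module.span class_ring (module_vec TYPE('a) n)
       (\<Union>M\<in>\<V>. (\<lambda>x. M *\<^sub>v x) ` carrier_vec p) = carrier_vec n \<and>
     \<not> (0 < p \<and> (\<exists>\<T>. mat_space_equiv n p \<V> \<T> \<and>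
          int (urk n (drop_last_col ` \<T>)) \<le> int (urk n \<V>) - 1)) \<and>
     \<not> (0 < n \<and> (\<exists>\<T>. mat_space_equiv n p \<V> \<T> \<and>
          int (urk (n - 1) (drop_last_row ` \<T>)) \<le> int (urk n \<V>) - 1))"

definition alternating_mats :: "nat \<Rightarrow> 'a::field mat set" where
  "alternating_mats n = {M \<in> carrier_mat n n. M\<^sup>T = - M \<and> (\<forall>i<n. M $$ (i, i) = 0)}"

definition J3 :: "bit mat set" where
  "J3 = {mat_of_rows_list 3 [[a, c,     d],
                             [0, a + b, e],
                             [0, 0,     b]] | a b c d e. True}"

definition U3 :: "bit mat set" where
  "U3 = {mat_of_rows_list 3 [[0,     a, a + c],
                             [a,     0, b    ],
                             [a + b, c, 0    ]] | a b c. True}"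

definition V3 :: "bit mat set" where
  "V3 = {mat_of_rows_list 3 [[0,     a, c + d],
                             [c,     0, b    ],
                             [a + b, d, 0    ]] | a b c d. True}"

end

theory Submission
  imports Defs "HOL-Library.Function_Algebras"
begin

text \<open>Each matrix \<open>M\<close> of the space is read as the bilinear form \<open>b(y, x) = y\<^sup>T M x\<close>. Rank at most two
  says that all Gram determinants of order three of \<open>b\<close> vanish; the first two clauses of primitivity
  say that the family of forms has no radical on either side, and the last two say that the family
  still contains a form of rank two after restriction to the kernel of any linear form on either
  side. Over a large field one would now compare coefficients of polynomials in the entries of a
  generic matrix. Over the field with two elements this is not available, and its substitute is a
  statement about products of linear forms on the space (the entries \<open>M \<mapsto> b(y, x)\<close>
  are such forms): a vanishing product of two forms has a zero factor, a vanishing product of three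
  forms has a zero factor or its factors sum to zero (\<open>forms_prod3_zero\<close>), and a nonzero product
  of two forms determines its factors (\<open>forms_prod_eq\<close>). The exceptional spaces exist because the
  second statement has one alternative more than over a large field.

  Call the space orthogonal if every form of rank two in it has the property that its left kernel is
  orthogonal to its right kernel with respect to all other forms of the space.

  In an orthogonal space, a form \<open>a\<close> of rank two and dual frames for it put all matrices into block
  form \<open>[A B; C 0]\<close>, and comparing the determinants for \<open>b\<close> and \<open>a + b\<close> gives \<open>C B = 0\<close>. The columns
  of \<open>B\<close> cannot have a common one-dimensional image: otherwise deleting a column would lower the
  rank, or some form of rank two would violate orthogonality (\<open>no_common_image\<close>).
  So \<open>B\<close> has a single column and \<open>C\<close> a single row (\<open>kernel_line\<close>), whence \<open>n = p = 3\<close>; the equation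
  \<open>C B = 0\<close> then identifies the two entries of \<open>C\<close> with those of \<open>B\<close>, and the determinant leaves
  two spaces, the alternating one and one equivalent to \<open>U3\<close> (\<open>orthogonal_classification\<close>).

  A space that is not orthogonal contains, in suitable frames, all diagonal matrices \<open>diag(s, s + t, t)\<close>
  (\<open>diagonal_frame_exists\<close>). Adding them to an arbitrary member and expanding the minors shows that
  nothing exists outside the three-dimensional frames, that the trace vanishes identically, that
  the products \<open>m\<^sub>i\<^sub>j m\<^sub>j\<^sub>i\<close> agree for all pairs of indices and that the two cyclic products of the
  off-diagonal entries are equal (\<open>diagonal_frame_tight\<close>). If the common product \<open>m\<^sub>i\<^sub>j m\<^sub>j\<^sub>i\<close> is zero,
  the vanishing entries form a tournament, which is transitive (a subspace of \<open>J3\<close>) or cyclic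
  (\<open>J3\<close> again, or \<open>V3\<close>); otherwise all off-diagonal entries take two values \<open>f\<close> and \<open>g\<close>, and the space
  is of type \<open>U3\<close> if \<open>f = g\<close> and of type \<open>V3\<close> if not (\<open>tight_frame_classification\<close>).

  The four types exclude each other: some nonzero vector has at most one nonzero image under a
  subspace of \<open>J3\<close>, but not under the other three; \<open>V3\<close> has 16 elements and the other two have 8; and
  an equivalence of the alternating space with \<open>U3\<close> would make all matrices \<open>R N\<close> with \<open>N\<close> in \<open>U3\<close>
  alternating for some invertible \<open>R\<close>, while the corresponding linear equations force \<open>R = 0\<close>.\<close>

section \<open>Arithmetic and linear forms over the field with two elements\<close>

text \<open>The sum and the product of bits are kept as ring operations below, so that the ring normalisation of
  the simplifier applies; by default they are rewritten to exclusive or and conjunction.\<close>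

declare add_bit_eq_xor [simp del] mult_bit_eq_and [simp del]

lemma bit_add_self [simp]: "x + x = (0::bit)"
  by (cases x) auto

lemma bit_add_self_left [simp]: "x + (x + y) = (y::bit)"
  by (cases x) auto

lemma bit_mult_self [simp]: "x * x = (x::bit)"
  by (cases x) auto

lemma bit_mult_eq_1_iff [simp]: "x * y = 1 \<longleftrightarrow> x = 1 \<and> y = (1::bit)"
  by (cases x; cases y) auto

lemma bit_add_eq_0_iff [simp]: "x + y = 0 \<longleftrightarrow> x = (y::bit)"
  by (cases x; cases y) auto

lemma bit_add_of_neq: "a \<noteq> b \<Longrightarrow> a + b = (1::bit)"
  by (cases a; cases b) auto

text \<open>Two independent columns annihilated by the row \<open>(p, q)\<close> force the row to be zero.\<close>

lemma bit_cramer: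
  assumes "p * a = q * c" "p * b = q * d" "a * d + b * c = (1::bit)"
  shows "p = 0 \<and> q = 0"
  using assms by (cases p; cases q; cases a; cases b) auto

text \<open>An additive map to the field with two elements is automatically linear.\<close>

definition linear_form :: "('m::plus \<Rightarrow> bit) \<Rightarrow> bool" where
  "linear_form f \<longleftrightarrow> (\<forall>s t. f (s + t) = f s + f t)"

definition add_closed :: "'m::plus set \<Rightarrow> bool" where
  "add_closed S \<longleftrightarrow> (\<forall>s\<in>S. \<forall>t\<in>S. s + t \<in> S)"

lemma linear_form_add: "linear_form f \<Longrightarrow> linear_form g \<Longrightarrow> linear_form (\<lambda>s. f s + g s)"
  by (simp add: linear_form_def ac_simps)

lemma linear_form_eval: "linear_form (\<lambda>b. b y x)"
  by (simp add: linear_form_def)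

text \<open>If neither form vanishes identically, take a point where the first is one and a point where the
  second is one: one of these two points or their sum is a zero of neither form.\<close>

lemma forms_prod2_zero:
  assumes "add_closed S" "linear_form f" "linear_form g" and fg: "\<And>s. s \<in> S \<Longrightarrow> f s * g s = 0"
  shows "(\<forall>s\<in>S. f s = 0) \<or> (\<forall>s\<in>S. g s = 0)"
proof (rule ccontr)
  assume "\<not> ?thesis"
  then obtain s t where "s \<in> S" "t \<in> S" "f s = 1" "g t = 1" by auto
  moreover have "g s = 0" "f t = 0" using fg[of s] fg[of t] calculation by auto
  moreover have "s + t \<in> S" using assms(1) calculation by (auto simp: add_closed_def)
  ultimately show False
    using fg[of "s + t"] assms(2,3) by (simp add: linear_form_def)
qed

text \<open>The image of \<open>(f, g, h)\<close> is a subspace of the three-dimensional space that avoids \<open>(1, 1, 1)\<close>, so some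
  linear functional vanishes on it but not on \<open>(1, 1, 1)\<close>; these functionals are the three coordinates
  and the sum of all three. The proof produces the point \<open>(1, 1, 1)\<close> directly.\<close>

lemma forms_prod3_zero:
  assumes S: "add_closed S" and lin: "linear_form f" "linear_form g" "linear_form h"
    and fgh: "\<And>s. s \<in> S \<Longrightarrow> f s * g s * h s = 0"
  shows "(\<forall>s\<in>S. f s = 0) \<or> (\<forall>s\<in>S. g s = 0) \<or> (\<forall>s\<in>S. h s = 0) \<or> (\<forall>s\<in>S. f s + g s + h s = 0)"
proof (rule ccontr)
  assume neg: "\<not> ?thesis"
  have pair: "\<exists>s\<in>S. p s = 1 \<and> q s = 1" if "p \<in> {f, g, h}" "q \<in> {f, g, h}" for p q
  proof (rule ccontr)
    assume "\<not> ?thesis"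
    then have "p s * q s = 0" if "s \<in> S" for s using that by auto
    moreover have "linear_form p" "linear_form q" using that lin by auto
    ultimately have "(\<forall>s\<in>S. p s = 0) \<or> (\<forall>s\<in>S. q s = 0)" using forms_prod2_zero[OF S] by blast
    then show False using neg that by blast
  qed
  obtain s where s: "s \<in> S" "f s = 1" "g s = 1" using pair[of f g] by auto
  obtain t where t: "t \<in> S" "f t = 1" "h t = 1" using pair[of f h] by auto
  obtain u where u: "u \<in> S" "g u = 1" "h u = 1" using pair[of g h] by auto
  obtain v where v: "v \<in> S" "f v + g v + h v = 1"
    using neg by (auto simp del: bit_add_eq_0_iff)
  have "h s = 0" "g t = 0" "f u = 0" "f v * g v * h v = 0"
    using fgh[of s] fgh[of t] fgh[of u] fgh[of v] s t u v by auto
  moreover have "s + v \<in> S" "t + v \<in> S" "u + v \<in> S"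
    using S s t u v by (auto simp: add_closed_def)
  ultimately show False
    using fgh[of "s + v"] fgh[of "t + v"] fgh[of "u + v"] s t u v lin
    by (cases "f v"; cases "g v"; cases "h v") (auto simp: linear_form_def)
qed

text \<open>Translation by a point where both products are one shows that at each point the unordered pairs
  of values agree. If the pairing changed from one point to another, their sum would contradict this.\<close>

lemma forms_prod_eq:
  assumes S: "add_closed S" and lin: "linear_form f" "linear_form g" "linear_form f'" "linear_form g'"
    and eq: "\<And>s. s \<in> S \<Longrightarrow> f s * g s = f' s * g' s"
    and nz: "s \<in> S" "f s * g s = 1"
  shows "(\<forall>s\<in>S. f' s = f s \<and> g' s = g s) \<or> (\<forall>s\<in>S. f' s = g s \<and> g' s = f s)"
proof (rule ccontr)
  assume neg: "\<not> ?thesis"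
  have add: "h (t + u) = h t + h u" if "h \<in> {f, g, f', g'}" for h t u
    using lin that by (auto simp: linear_form_def)
  have val: "(f t, g t) = (f' t, g' t) \<or> (f t, g t) = (g' t, f' t)" if t: "t \<in> S" for t
  proof -
    have "s + t \<in> S" using S nz(1) t by (simp add: add_closed_def)
    then show ?thesis
      using eq[OF t] eq[of "s + t"] eq[OF nz(1)] nz(2)
      by (cases "f t"; cases "g t"; cases "f' t"; cases "g' t") (auto simp: add)
  qed
  from neg obtain t u where t: "t \<in> S" "\<not> (f' t = f t \<and> g' t = g t)"
    and u: "u \<in> S" "\<not> (f' u = g u \<and> g' u = f u)" by blast
  have "t + u \<in> S" using S t u by (simp add: add_closed_def)
  then show False
    using val[OF t(1)] val[OF u(1)] val[of "t + u"] t(2) u(2)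
    by (cases "f t"; cases "g t"; cases "f u"; cases "g u") (auto simp: add)
qed

lemma form_multiple:
  assumes S: "add_closed S" and lin: "linear_form f" "linear_form u"
    and van: "\<And>s. s \<in> S \<Longrightarrow> u s = 0 \<Longrightarrow> f s = 0"
  shows "\<exists>c. \<forall>s\<in>S. f s = c * u s"
proof (cases "\<exists>t\<in>S. u t = 1")
  case True
  then obtain t where t: "t \<in> S" "u t = 1" by blast
  have "f s = f t * u s" if s: "s \<in> S" for s
  proof (cases "u s = 0")
    case False
    have "s + t \<in> S" using S s t by (simp add: add_closed_def)
    then show ?thesis using van[of "s + t"] lin False t by (simp add: linear_form_def)
  qed (simp add: van[OF s])
  then show ?thesis by blast
next
  case False
  then show ?thesis using van by (intro exI[of _ 0]) auto
qed

text \<open>Two linear forms that are nonzero and distinct are independent, hence jointly surjective.\<close>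

lemma forms_surj2:
  assumes S: "add_closed S" and lin: "linear_form f" "linear_form g"
    and ne: "\<exists>s\<in>S. f s = 1" "\<exists>s\<in>S. g s = 1" "\<exists>s\<in>S. f s + g s = 1"
  shows "\<exists>s\<in>S. f s = c \<and> g s = d"
proof -
  have add: "s + t \<in> S \<and> f (s + t) = f s + f t \<and> g (s + t) = g s + g t" if "s \<in> S" "t \<in> S" for s t
    using that S lin by (simp add: add_closed_def linear_form_def)
  obtain s t u where s: "s \<in> S" "f s = 1" and t: "t \<in> S" "g t = 1" and u: "u \<in> S" "f u + g u = 1"
    using ne by blast
  obtain p where p: "p \<in> S" "f p = 1" "g p = 0"
    using that[of s] that[of u] that[of "s + u"] add[OF s(1) u(1)] s u by (cases "g s"; cases "f u"; cases "g u") simp_all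
  obtain q where q: "q \<in> S" "f q = 0" "g q = 1"
    using that[of t] that[of u] that[of "t + u"] add[OF t(1) u(1)] t u by (cases "f t"; cases "f u"; cases "g u") simp_all
  have pq: "p + p \<in> S" "f (p + p) = 0" "g (p + p) = 0" "p + q \<in> S" "f (p + q) = 1" "g (p + q) = 1"
    using add[OF p(1) p(1)] add[OF p(1) q(1)] p q by simp_all
  show ?thesis using p q pq by (cases c; cases d) blast+
qed

text \<open>The determinant of the matrix with rows \<open>(a, b, c)\<close>, \<open>(d, e, f)\<close>, \<open>(g, h, i)\<close>; signs do not matter in
  characteristic two.\<close>

definition det3 :: "bit \<Rightarrow> bit \<Rightarrow> bit \<Rightarrow> bit \<Rightarrow> bit \<Rightarrow> bit \<Rightarrow> bit \<Rightarrow> bit \<Rightarrow> bit \<Rightarrow> bit" where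
  "det3 a b c d e f g h i = a * (e * i + f * h) + b * (d * i + f * g) + c * (d * h + e * g)"

text \<open>The four diagonals are all those with the same trace. For trace zero, the diagonal \<open>(0, 0, 0)\<close> isolates
  the constant term of the determinant and the other three compare its linear coefficients in
  pairs; for trace one the four determinants cannot all vanish.\<close>

lemma det3_diagonal_shifts:
  assumes "det3 p a b c q d e f r = 0" "det3 (p + 1) a b c (q + 1) d e f r = 0"
    "det3 (p + 1) a b c q d e f (r + 1) = 0" "det3 p a b c (q + 1) d e f (r + 1) = 0"
  shows "p + q + r = 0 \<and> a * c = b * e \<and> a * c = d * f \<and> a * d * e = b * c * f"
proof -
  have det: "det3 p a b c q d e f r = p * q * r + p * (d * f) + q * (b * e) + r * (a * c) + (a * d * e + b * c * f)"
    for p q r by (simp add: det3_def algebra_simps)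
  show ?thesis
    using assms unfolding det
    by (cases p; cases q; cases r; cases "a * c"; cases "b * e"; cases "d * f") (simp_all del: mult_eq_0_iff)
qed

text \<open>The sum of the four determinants is the coefficient of \<open>p q\<close>, which is \<open>w\<close>.\<close>

lemma det3_last_column_shifts:
  assumes "det3 p a u c q v e f w = 0" "det3 (p + 1) a u c (q + 1) v e f w = 0"
    "det3 (p + 1) a u c q v e f w = 0" "det3 p a u c (q + 1) v e f w = 0"
  shows "w = 0"
  using assms unfolding det3_def by Groebner_Basis.algebra

text \<open>Only the product of \<open>w\<close> with the upper left minor survives, and that minor cannot be zero for all four
  choices of its diagonal.\<close>

lemma det3_zero_column_shifts:
  assumes "det3 p a 0 c q 0 e1 f1 w = 0" "det3 (p + 1) a 0 c (q + 1) 0 e2 f2 w = 0"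
    "det3 (p + 1) a 0 c q 0 e3 f3 w = 0" "det3 p a 0 c (q + 1) 0 e4 f4 w = 0"
  shows "w = 0"
  using assms unfolding det3_def by (cases p; cases q; cases a; cases c) simp_all

section \<open>Spaces of bilinear forms with vanishing minors of order three\<close>

text \<open>Bits act as scalars on an arbitrary abelian group: the action enters the argument only through the
  values that biadditive forms take on its results.\<close>

definition bscale :: "bit \<Rightarrow> 'v::zero \<Rightarrow> 'v" (infixr "\<cdot>" 75) where
  "c \<cdot> x = (if c = 1 then x else 0)"

text \<open>The abstract form of a primitive space of upper rank two. The last two conditions are the
  restrictions of the incompressibility clauses to those hyperplanes that are kernels of \<open>a(y, -)\<close> or
  \<open>a(-, x)\<close> for a form \<open>a\<close> of the space. Vectors are treated modulo the radicals, so that dimension three is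
  expressed by \<open>basis_right\<close> and \<open>basis_left\<close> below.\<close>

locale form_space =
  fixes B :: "('w::ab_group_add \<Rightarrow> 'u::ab_group_add \<Rightarrow> bit) set"
  assumes nonempty: "B \<noteq> {}"
    and closed: "add_closed B"
    and add_left: "b \<in> B \<Longrightarrow> b (y + y') x = b y x + b y' x"
    and add_right: "b \<in> B \<Longrightarrow> b y (x + x') = b y x + b y x'"
    and minors3: "b \<in> B \<Longrightarrow> det3 (b y1 x1) (b y1 x2) (b y1 x3)
                                  (b y2 x1) (b y2 x2) (b y2 x3)
                                  (b y3 x1) (b y3 x2) (b y3 x3) = 0"
    and col_essential: "a \<in> B \<Longrightarrow> \<exists>b\<in>B. \<exists>y1 y2 x1 x2. a y x1 = 0 \<and> a y x2 = 0 \<and>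
                                  b y1 x1 * b y2 x2 + b y1 x2 * b y2 x1 = 1"
    and row_essential: "a \<in> B \<Longrightarrow> \<exists>b\<in>B. \<exists>y1 y2 x1 x2. a y1 x = 0 \<and> a y2 x = 0 \<and>
                                  b y1 x1 * b y2 x2 + b y1 x2 * b y2 x1 = 1"
begin

lemma add_mem: "b \<in> B \<Longrightarrow> c \<in> B \<Longrightarrow> b + c \<in> B"
  using closed by (simp add: add_closed_def)

lemma zero_left [simp]: "b \<in> B \<Longrightarrow> b 0 x = 0"
  using add_left[of b 0 0 x] by simp

lemma zero_right [simp]: "b \<in> B \<Longrightarrow> b y 0 = 0"
  using add_right[of b y 0 0] by simp

lemma scale_left: "b \<in> B \<Longrightarrow> b (c \<cdot> y) x = c * b y x"
  by (cases c) (auto simp: bscale_def)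

lemma scale_right: "b \<in> B \<Longrightarrow> b y (c \<cdot> x) = c * b y x"
  by (cases c) (auto simp: bscale_def)

lemmas expand = add_left add_right scale_left scale_right

lemma entry_prod2_zero:
  assumes "\<And>b. b \<in> B \<Longrightarrow> b y x * b y' x' = 0"
  shows "(\<forall>b\<in>B. b y x = 0) \<or> (\<forall>b\<in>B. b y' x' = 0)"
  using assms by (rule forms_prod2_zero[OF closed linear_form_eval linear_form_eval])

lemma entry_prod2_one:
  assumes "\<exists>b\<in>B. b y x = 1" "\<exists>b\<in>B. b y' x' = 1"
  shows "\<exists>b\<in>B. b y x = 1 \<and> b y' x' = 1"
proof (rule ccontr)
  assume "\<not> ?thesis"
  then have "b y x * b y' x' = 0" if "b \<in> B" for b using that by auto
  from entry_prod2_zero[of y x y' x', OF this] assms show False by auto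
qed

lemma entry_prod_eq:
  assumes "\<And>b. b \<in> B \<Longrightarrow> b y1 x1 * b y2 x2 = b y3 x3 * b y4 x4" "a \<in> B" "a y1 x1 * a y2 x2 = 1"
  shows "(\<forall>b\<in>B. b y3 x3 = b y1 x1 \<and> b y4 x4 = b y2 x2) \<or> (\<forall>b\<in>B. b y3 x3 = b y2 x2 \<and> b y4 x4 = b y1 x1)"
  using assms by (rule forms_prod_eq[OF closed linear_form_eval linear_form_eval linear_form_eval linear_form_eval])

text \<open>A form of rank at most two with a nonzero minor on \<open>y1, y2\<close> has its right kernel determined by these
  two rows.\<close>

lemma kernel_right:
  assumes "b \<in> B" "b y1 x1 * b y2 x2 + b y1 x2 * b y2 x1 = 1" "b y1 x = 0" "b y2 x = 0"
  shows "b y x = 0"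
  using minors3[OF assms(1), of y1 x1 x2 x y2 y] assms(2-4) unfolding det3_def by Groebner_Basis.algebra

lemma kernel_left:
  assumes "b \<in> B" "b y1 x1 * b y2 x2 + b y1 x2 * b y2 x1 = 1" "b y x1 = 0" "b y x2 = 0"
  shows "b y x = 0"
  using minors3[OF assms(1), of y1 x1 x2 x y2 y] assms(2-4) unfolding det3_def by Groebner_Basis.algebra

definition dual_frame where
  "dual_frame b y1 y2 x1 x2 \<longleftrightarrow> b \<in> B \<and> b y1 x1 = 1 \<and> b y1 x2 = 0 \<and> b y2 x1 = 0 \<and> b y2 x2 = 1"

text \<open>The new vectors are the columns of the adjugate of the Gram matrix, which has determinant one.\<close>

lemma dual_frame_exists:
  assumes "b \<in> B" "b y1 x1 * b y2 x2 + b y1 x2 * b y2 x1 = 1"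
  shows "dual_frame b y1 y2 (b y2 x2 \<cdot> x1 + b y2 x1 \<cdot> x2) (b y1 x2 \<cdot> x1 + b y1 x1 \<cdot> x2)"
  using assms by (auto simp: dual_frame_def expand ac_simps)

lemma frame_mem: "dual_frame a y1 y2 x1 x2 \<Longrightarrow> a \<in> B"
  by (simp add: dual_frame_def)

lemma frame_minor: "dual_frame a y1 y2 x1 x2 \<Longrightarrow> a y1 x1 * a y2 x2 + a y1 x2 * a y2 x1 = 1"
  by (simp add: dual_frame_def)

definition frame_kernel where "frame_kernel a y1 y2 x \<longleftrightarrow> a y1 x = 0 \<and> a y2 x = 0"

definition frame_cokernel where "frame_cokernel a x1 x2 y \<longleftrightarrow> a y x1 = 0 \<and> a y x2 = 0"

definition radical_right where "radical_right x \<longleftrightarrow> (\<forall>b\<in>B. \<forall>y. b y x = 0)"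

definition radical_left where "radical_left y \<longleftrightarrow> (\<forall>b\<in>B. \<forall>x. b y x = 0)"

lemma not_radical_of_eval: "b \<in> B \<Longrightarrow> b y x = 1 \<Longrightarrow> \<not> radical_right x" "b \<in> B \<Longrightarrow> b y x = 1 \<Longrightarrow> \<not> radical_left y"
  by (auto simp: radical_right_def radical_left_def)

text \<open>The three vectors form a basis of the right-hand space modulo the right radical.\<close>

definition basis_right where
  "basis_right x1 x2 x3 \<longleftrightarrow>
     (\<forall>x. \<exists>c1 c2 c3. \<forall>b\<in>B. \<forall>y. b y x = c1 * b y x1 + c2 * b y x2 + c3 * b y x3) \<and>
     (\<forall>c1 c2 c3. (\<forall>b\<in>B. \<forall>y. c1 * b y x1 + c2 * b y x2 + c3 * b y x3 = 0) \<longrightarrow> c1 = 0 \<and> c2 = 0 \<and> c3 = 0)"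

definition basis_left where
  "basis_left y1 y2 y3 \<longleftrightarrow>
     (\<forall>y. \<exists>c1 c2 c3. \<forall>b\<in>B. \<forall>x. b y x = c1 * b y1 x + c2 * b y2 x + c3 * b y3 x) \<and>
     (\<forall>c1 c2 c3. (\<forall>b\<in>B. \<forall>x. c1 * b y1 x + c2 * b y2 x + c3 * b y3 x = 0) \<longrightarrow> c1 = 0 \<and> c2 = 0 \<and> c3 = 0)"

definition orthogonal where
  "orthogonal \<longleftrightarrow> (\<forall>a\<in>B. \<forall>b\<in>B. \<forall>y1 y2 x1 x2 y x. a y1 x1 * a y2 x2 + a y1 x2 * a y2 x1 = 1 \<longrightarrow>
     a y x1 = 0 \<longrightarrow> a y x2 = 0 \<longrightarrow> a y1 x = 0 \<longrightarrow> a y2 x = 0 \<longrightarrow> b y x = 0)"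

lemma orthogonalD:
  assumes orthogonal "a \<in> B" "b \<in> B" "a y1 x1 * a y2 x2 + a y1 x2 * a y2 x1 = 1"
     "a y x1 = 0" "a y x2 = 0" "a y1 x = 0" "a y2 x = 0"
   shows "b y x = 0"
  using assms unfolding orthogonal_def by blast

end

definition flip :: "('w \<Rightarrow> 'u \<Rightarrow> bit) \<Rightarrow> 'u \<Rightarrow> 'w \<Rightarrow> bit" where "flip b = (\<lambda>x y. b y x)"

lemma flip_apply [simp]: "flip b x y = b y x"
  by (simp add: flip_def)

text \<open>The axioms are symmetric under exchange of the two arguments, which provides the dual of every
  statement below.\<close>

lemma form_space_flip:
  assumes "form_space B" shows "form_space (flip ` B)"
proof -
  interpret form_space B by fact
  have plus: "flip b + flip c = flip (b + c)" for b c :: "'a \<Rightarrow> 'b \<Rightarrow> bit"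
    by (simp add: plus_fun_def flip_def)
  show ?thesis
  proof
    show "flip ` B \<noteq> {}" using nonempty by simp
    show "add_closed (flip ` B)"
      using add_mem unfolding add_closed_def by (auto simp only: plus ball_simps intro!: imageI)
  next
    fix b y1 x1 x2 x3 y2 y3 assume "b \<in> flip ` B"
    then obtain c where c: "c \<in> B" "b = flip c" by auto
    show "det3 (b y1 x1) (b y1 x2) (b y1 x3) (b y2 x1) (b y2 x2) (b y2 x3) (b y3 x1) (b y3 x2) (b y3 x3) = 0"
      using minors3[OF c(1), of x1 y1 y2 y3 x2 x3] unfolding c det3_def flip_apply by Groebner_Basis.algebra
  next
    fix a assume "a \<in> flip ` B"
    then obtain c where c: "c \<in> B" "a = flip c" by auto
    show "\<exists>b\<in>flip ` B. \<exists>y1 y2 x1 x2. a y x1 = 0 \<and> a y x2 = 0 \<and> b y1 x1 * b y2 x2 + b y1 x2 * b y2 x1 = 1"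
      for y using row_essential[OF c(1), of y] unfolding c(2) by (simp add: ac_simps) blast
    show "\<exists>b\<in>flip ` B. \<exists>y1 y2 x1 x2. a y1 x = 0 \<and> a y2 x = 0 \<and> b y1 x1 * b y2 x2 + b y1 x2 * b y2 x1 = 1"
      for x using col_essential[OF c(1), of x] unfolding c(2) by (simp add: ac_simps) blast
  qed (auto simp: add_left add_right)
qed

context form_space
begin

lemma form_space_flip': "form_space (flip ` B)"
  by (rule form_space_flip) (rule form_space_axioms)

interpretation op: form_space "flip ` B" by (rule form_space_flip')

lemma flip_orthogonal: "orthogonal \<Longrightarrow> op.orthogonal"
  unfolding op.orthogonal_def ball_simps flip_apply
  by (intro ballI allI impI, rule orthogonalD) (assumption | simp add: ac_simps)+

lemma flip_dual_frame: "dual_frame a y1 y2 x1 x2 \<Longrightarrow> op.dual_frame (flip a) x1 x2 y1 y2"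
  unfolding dual_frame_def op.dual_frame_def by auto

lemma flip_basis_right: "op.basis_right y1 y2 y3 \<longleftrightarrow> basis_left y1 y2 y3"
  unfolding op.basis_right_def basis_left_def by simp

lemma flip_frame_kernel: "op.frame_kernel (flip a) x1 x2 y \<longleftrightarrow> frame_cokernel a x1 x2 y"
  by (simp add: op.frame_kernel_def frame_cokernel_def)

lemma flip_radical_right: "op.radical_right y \<longleftrightarrow> radical_left y"
  by (simp add: op.radical_right_def radical_left_def)

lemmas flip_simps = flip_frame_kernel flip_radical_right flip_basis_right

text \<open>The radical makes this a statement about the values of the forms: the vectors \<open>x3 + x3\<close> need not be
  zero in the abelian group.\<close>

lemma basis_right_shear:
  assumes "basis_right x1 x2 x3"
  shows "basis_right (x1 + s \<cdot> x3) (x2 + t \<cdot> x3) x3"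
  unfolding basis_right_def
proof (intro conjI allI impI)
  fix x
  obtain c1 c2 c3 where "\<forall>b\<in>B. \<forall>y. b y x = c1 * b y x1 + c2 * b y x2 + c3 * b y x3"
    using assms unfolding basis_right_def by blast
  then have "\<forall>b\<in>B. \<forall>y. b y x = c1 * b y (x1 + s \<cdot> x3) + c2 * b y (x2 + t \<cdot> x3) + (c3 + c1 * s + c2 * t) * b y x3"
    by (auto simp: expand algebra_simps)
  then show "\<exists>c1 c2 c3. \<forall>b\<in>B. \<forall>y. b y x = c1 * b y (x1 + s \<cdot> x3) + c2 * b y (x2 + t \<cdot> x3) + c3 * b y x3"
    by blast
next
  fix c1 c2 c3
  assume "\<forall>b\<in>B. \<forall>y. c1 * b y (x1 + s \<cdot> x3) + c2 * b y (x2 + t \<cdot> x3) + c3 * b y x3 = 0"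
  then have "c1 * b y x1 + c2 * b y x2 + (c3 + c1 * s + c2 * t) * b y x3 = 0" if "b \<in> B" for b y
    using that by (simp add: expand algebra_simps)
  then have "c1 = 0 \<and> c2 = 0 \<and> c3 + c1 * s + c2 * t = 0"
    using assms unfolding basis_right_def by blast
  then show "c1 = 0" "c2 = 0" "c3 = 0" by auto
qed

lemma basis_right_swap12:
  assumes "basis_right x1 x2 x3"
  shows "basis_right x2 x1 x3"
  unfolding basis_right_def
proof (intro conjI allI)
  fix x
  show "\<exists>c1 c2 c3. \<forall>b\<in>B. \<forall>y. b y x = c1 * b y x2 + c2 * b y x1 + c3 * b y x3"
    using assms unfolding basis_right_def by (subst ex_comm) (simp add: ac_simps)
next
  show "(\<forall>b\<in>B. \<forall>y. c1 * b y x2 + c2 * b y x1 + c3 * b y x3 = 0) \<longrightarrow> c1 = 0 \<and> c2 = 0 \<and> c3 = 0" for c1 c2 c3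
    using assms[unfolded basis_right_def, THEN conjunct2, rule_format, of c2 c1 c3] by (simp add: ac_simps)
qed

lemma basis_right_swap23:
  assumes "basis_right x1 x2 x3"
  shows "basis_right x1 x3 x2"
  unfolding basis_right_def
proof (intro conjI allI)
  fix x
  show "\<exists>c1 c2 c3. \<forall>b\<in>B. \<forall>y. b y x = c1 * b y x1 + c2 * b y x3 + c3 * b y x2"
    using assms unfolding basis_right_def by (subst (2) ex_comm) (simp add: ac_simps)
next
  show "(\<forall>b\<in>B. \<forall>y. c1 * b y x1 + c2 * b y x3 + c3 * b y x2 = 0) \<longrightarrow> c1 = 0 \<and> c2 = 0 \<and> c3 = 0" for c1 c2 c3
    using assms[unfolded basis_right_def, THEN conjunct2, rule_format, of c1 c3 c2] by (simp add: ac_simps)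
qed

text \<open>If the common kernel \<open>{x. a(y1, x) = a(y2, x) = 0}\<close> were radical, then on the hyperplane \<open>a(y1, -) = 0\<close>
  every form would be determined by its values at \<open>x2\<close> and have rank one.\<close>

lemma kernel_not_radical:
  assumes f: "dual_frame a y1 y2 x1 x2"
  shows "\<exists>x. frame_kernel a y1 y2 x \<and> \<not> radical_right x"
proof (rule ccontr)
  assume neg: "\<not> ?thesis"
  have a: "a \<in> B" using f by (simp add: dual_frame_def)
  obtain b y y' x x' where b: "b \<in> B" "a y1 x = 0" "a y1 x' = 0"
    "b y x * b y' x' + b y x' * b y' x = 1" using col_essential[OF a, of y1] by blast
  have "b z (u + a y2 u \<cdot> x2) = 0" if "a y1 u = 0" for z u
  proof -
    have "frame_kernel a y1 y2 (u + a y2 u \<cdot> x2)"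
      using that a f by (simp add: frame_kernel_def dual_frame_def expand)
    then show ?thesis using neg b(1) unfolding radical_right_def by blast
  qed
  then have "b z u = a y2 u * b z x2" if "a y1 u = 0" for z u
    using that b(1) by (simp add: expand)
  then show False using b by (simp add: ac_simps)
qed

lemma corner_zero:
  assumes "orthogonal" "dual_frame a y1 y2 x1 x2" "frame_kernel a y1 y2 x" "frame_cokernel a x1 x2 y" "b \<in> B"
  shows "b y x = 0"
  using orthogonalD[OF assms(1) frame_mem[OF assms(2)] assms(5) frame_minor[OF assms(2)]] assms(3,4)
  by (auto simp: frame_kernel_def frame_cokernel_def)

text \<open>This is the equation \<open>C B = 0\<close>: it is the difference of the determinants of \<open>b\<close> and \<open>a + b\<close>.\<close>

lemma corner_product:
  assumes o: orthogonal and f: "dual_frame a y1 y2 x1 x2" and k: "frame_kernel a y1 y2 x"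
    and c: "frame_cokernel a x1 x2 y" and b: "b \<in> B"
  shows "b y x1 * b y1 x = b y x2 * b y2 x"
proof -
  have a: "a \<in> B" using f by (rule frame_mem)
  have "b y x = 0" using corner_zero[OF o f k c b] .
  moreover have "a y1 x1 = 1" "a y1 x2 = 0" "a y2 x1 = 0" "a y2 x2 = 1" "a y1 x = 0" "a y2 x = 0"
    "a y x1 = 0" "a y x2 = 0" "a y x = 0"
    using f k c corner_zero[OF o f k c a] by (auto simp: dual_frame_def frame_kernel_def frame_cokernel_def)
  moreover note minors3[OF b, of y1 x1 x2 x y2 y] minors3[OF add_mem[OF a b], of y1 x1 x2 x y2 y]
  ultimately have "b y x1 * b y1 x + b y x2 * b y2 x = 0"
    unfolding det3_def plus_fun_def by Groebner_Basis.algebra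
  then show ?thesis by simp
qed

text \<open>The vector \<open>y\<close> differs from \<open>a(y, x1) y1 + a(y, x2) y2\<close> by an element of the cokernel, which is
  orthogonal to the kernel.\<close>

lemma kernel_expand:
  assumes o: orthogonal and f: "dual_frame a y1 y2 x1 x2" and k: "frame_kernel a y1 y2 x" and b: "b \<in> B"
  shows "b y x = a y x1 * b y1 x + a y x2 * b y2 x"
proof -
  have a: "a \<in> B" using f by (rule frame_mem)
  have "frame_cokernel a x1 x2 (y + a y x1 \<cdot> y1 + a y x2 \<cdot> y2)"
    using f a by (simp add: frame_cokernel_def dual_frame_def expand)
  from corner_zero[OF o f k this b] show ?thesis
    using b by (simp add: expand add.assoc)
qed

lemma radical_kernelI:
  assumes o: orthogonal and f: "dual_frame a y1 y2 x1 x2" and k: "frame_kernel a y1 y2 x"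
    and z: "\<And>b. b \<in> B \<Longrightarrow> b y1 x = 0" "\<And>b. b \<in> B \<Longrightarrow> b y2 x = 0"
  shows "radical_right x"
  unfolding radical_right_def
proof (intro ballI allI)
  fix b y assume "b \<in> B"
  then show "b y x = 0" using kernel_expand[OF o f k, of b y] z[of b] by simp
qed

lemma basis_from_kernel:
  assumes f: "dual_frame a y1 y2 x1 x2" and z: "frame_kernel a y1 y2 z"
    and line: "\<And>x. frame_kernel a y1 y2 x \<Longrightarrow> radical_right x \<or> radical_right (x + z)"
    and nr: "\<not> radical_right z"
  shows "basis_right x1 x2 z"
  unfolding basis_right_def
proof (intro conjI allI impI)
  have a: "a \<in> B" using f by (rule frame_mem)
  fix x
  let ?x = "x + a y1 x \<cdot> x1 + a y2 x \<cdot> x2"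
  have "frame_kernel a y1 y2 ?x" using f a by (simp add: frame_kernel_def dual_frame_def expand)
  then obtain c where "radical_right (?x + c \<cdot> z)"
    using line[of ?x] by (metis add.right_neutral bscale_def zero_neq_one)
  then have "\<forall>b\<in>B. \<forall>y. b y x = a y1 x * b y x1 + a y2 x * b y x2 + c * b y z"
    by (simp add: radical_right_def expand add.assoc)
  then show "\<exists>c1 c2 c3. \<forall>b\<in>B. \<forall>y. b y x = c1 * b y x1 + c2 * b y x2 + c3 * b y z" by blast
next
  fix c1 c2 c3
  assume e: "\<forall>b\<in>B. \<forall>y. c1 * b y x1 + c2 * b y x2 + c3 * b y z = 0"
  have 12: "c1 = 0 \<and> c2 = 0"
    using e[rule_format, of a y1] e[rule_format, of a y2] f z
    by (simp add: dual_frame_def frame_kernel_def)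
  moreover have "c3 = 0" using e nr 12 unfolding radical_right_def by auto
  ultimately show "c1 = 0" "c2 = 0" "c3 = 0" by auto
qed

end

context form_space
begin

interpretation op: form_space "flip ` B" by (rule form_space_flip')

lemma basis_left_swap12: "basis_left y1 y2 y3 \<Longrightarrow> basis_left y2 y1 y3"
  using op.basis_right_swap12 unfolding flip_basis_right .

lemma basis_left_swap23: "basis_left y1 y2 y3 \<Longrightarrow> basis_left y1 y3 y2"
  using op.basis_right_swap23 unfolding flip_basis_right .

lemma cokernel_not_radical:
  assumes f: "dual_frame a y1 y2 x1 x2"
  shows "\<exists>y. frame_cokernel a x1 x2 y \<and> \<not> radical_left y"
  using op.kernel_not_radical[OF flip_dual_frame[OF f]] by (simp only: flip_simps)

lemma cokernel_expand:
  assumes o: orthogonal and f: "dual_frame a y1 y2 x1 x2" and c: "frame_cokernel a x1 x2 y" and b: "b \<in> B"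
  shows "b y x = a y1 x * b y x1 + a y2 x * b y x2"
  using op.kernel_expand[OF flip_orthogonal[OF o] flip_dual_frame[OF f], of y "flip b" x] c b
  by (simp add: flip_frame_kernel)

lemma cobasis_from_cokernel:
  assumes f: "dual_frame a y1 y2 x1 x2" and z: "frame_cokernel a x1 x2 z"
    and line: "\<And>y. frame_cokernel a x1 x2 y \<Longrightarrow> radical_left y \<or> radical_left (y + z)"
    and nr: "\<not> radical_left z"
  shows "basis_left y1 y2 z"
  using op.basis_from_kernel[OF flip_dual_frame[OF f], of z] assms(2-)
  by (simp add: flip_simps)

end

section \<open>Orthogonal spaces\<close>

context form_space
begin

text \<open>The hypothesis says that all blocks \<open>B\<close> have their image in the line of the first coordinate. By
  \<open>corner_product\<close> the first column of every \<open>C\<close> vanishes, so the matrices have the shape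
  \<open>[p q \<beta>; r s 0; 0 \<gamma> 0]\<close> with \<open>\<beta> r \<gamma> = 0\<close>. If \<open>r = 0\<close> identically, deleting the second column leaves
  rank one. Otherwise \<open>r = \<beta> + \<gamma>\<close>, and a form with \<open>\<beta> = 1\<close>, \<open>\<gamma> = 0\<close> has rank two with cokernel vector
  \<open>y\<close> and a kernel vector on which \<open>y\<close> pairs to \<open>\<gamma>\<close>; orthogonality makes \<open>\<gamma>\<close> zero.\<close>

lemma no_common_image:
  assumes o: orthogonal and f: "dual_frame a y1 y2 x1 x2"
    and z: "\<And>b x. b \<in> B \<Longrightarrow> frame_kernel a y1 y2 x \<Longrightarrow> b y2 x = 0"
  shows False
proof -
  let ?K = "frame_kernel a y1 y2" and ?L = "frame_cokernel a x1 x2"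
  have a: "a \<in> B" using f by (rule frame_mem)
  obtain x m where x: "?K x" "m \<in> B" "m y1 x = 1"
  proof -
    obtain x m v where "?K x" "m \<in> B" "m v x = 1"
      using kernel_not_radical[OF f] unfolding radical_right_def by auto
    then show ?thesis using that[of x m] kernel_expand[OF o f, of x m v] z[of m x] by simp
  qed
  have c1: "b y x1 = 0" if b: "b \<in> B" and y: "?L y" for b y
  proof -
    have "b y x1 * b y1 x = 0" if "b \<in> B" for b
      using corner_product[OF o f x(1) y that] z[OF that x(1)] by simp
    then show ?thesis
      using entry_prod2_zero[of y x1 y1 x] x(2,3) b by auto
  qed
  obtain y k where y: "?L y" "k \<in> B" "k y x2 = 1"
  proof -
    obtain y k v where "?L y" "k \<in> B" "k y v = 1"
      using cokernel_not_radical[OF f] unfolding radical_left_def by auto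
    then show ?thesis using that[of y k] cokernel_expand[OF o f, of y k v] c1[of k y] by simp
  qed
  have prod: "b y1 x * b y2 x1 * b y x2 = 0" if b: "b \<in> B" for b
    using minors3[OF b, of y1 x1 x2 x y2 y] c1[OF b y(1)] z[OF b x(1)] corner_zero[OF o f x(1) y(1) b]
    unfolding det3_def by (simp add: ac_simps)
  have "\<exists>b\<in>B. b y2 x1 = 1"
  proof (rule ccontr)
    assume neg: "\<not> ?thesis"
    obtain b v v' u u' where b: "b \<in> B" "a y2 u = 0" "a y2 u' = 0"
      "b v u * b v' u' + b v u' * b v' u = 1" using col_essential[OF a, of y2] by blast
    have "b v u = a v x1 * b y1 u" if "a y2 u = 0" for v u
    proof -
      have k: "?K (u + a y1 u \<cdot> x1)"
        using that f a by (simp add: dual_frame_def frame_kernel_def expand)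
      have u2: "b y2 u = 0" using z[OF b(1) k] neg b(1) by (auto simp: expand)
      have l: "?L (v + a v x1 \<cdot> y1 + a v x2 \<cdot> y2)"
        using f a by (simp add: frame_cokernel_def dual_frame_def expand)
      show ?thesis
        using cokernel_expand[OF o f l b(1), of u] c1[OF b(1) l] that u2 b(1) by (simp add: expand)
    qed
    from this[OF b(2), of v] this[OF b(2), of v'] this[OF b(3), of v] this[OF b(3), of v']
    have "b v u * b v' u' + b v u' * b v' u = 0" by (simp add: ac_simps)
    with b(4) show False by simp
  qed
  then have sum: "b y1 x + b y2 x1 + b y x2 = 0" if "b \<in> B" for b
    using forms_prod3_zero[OF closed linear_form_eval linear_form_eval linear_form_eval, of y1 x y2 x1 y x2, OF prod]
      x(2,3) y(2,3) that by auto
  obtain c where c: "c \<in> B" "c y1 x = 1" "c y x2 = 0"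
  proof -
    obtain b where "b \<in> B" "b y2 x1 = 1" using \<open>\<exists>b\<in>B. b y2 x1 = 1\<close> by blast
    then show ?thesis
      using sum[of b] sum[OF x(2)] x(2,3) that[of b] that[of m] that[of "b + m"] add_mem[of b m]
      by (cases "b y1 x"; cases "b y x2"; cases "m y x2") auto
  qed
  \<comment> \<open>The kernel vector of \<open>c\<close>, whose Gram matrix on \<open>y1, y2\<close> and \<open>x1, x2, x\<close> is \<open>[p q 1; 1 s 0]\<close>.\<close>
  let ?x = "c y2 x2 \<cdot> x1 + x2 + (c y1 x1 * c y2 x2 + c y1 x2) \<cdot> x"
  have c': "c y2 x1 = 1" "c y2 x = 0" using sum[OF c(1)] c z[OF c(1) x(1)] by auto
  have "k y ?x = 0"
  proof (rule orthogonalD[OF o c(1) y(2)])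
    show "c y1 x1 * c y2 x + c y1 x * c y2 x1 = 1" using c c' by simp
    show "c y x1 = 0" "c y x = 0" using c1[OF c(1) y(1)] corner_zero[OF o f x(1) y(1) c(1)] by auto
    show "c y1 ?x = 0" "c y2 ?x = 0" using c c' by (simp_all add: expand ac_simps)
  qed
  then show False
    using y c1[OF y(2,1)] corner_zero[OF o f x(1) y(1,2)] by (simp add: expand)
qed

text \<open>The other two possible linear relations between the rows of \<open>B\<close> reduce to \<open>no_common_image\<close> by a
  change of the dual frame.\<close>

lemma kernel_independent:
  assumes o: orthogonal and f: "dual_frame a y1 y2 x1 x2" and r: "(r1, r2) \<noteq> (0, 0)"
  shows "\<exists>b\<in>B. \<exists>x. frame_kernel a y1 y2 x \<and> r1 * b y1 x + r2 * b y2 x = 1"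
proof (rule ccontr)
  assume neg: "\<not> ?thesis"
  have a: "a \<in> B" using f by (rule frame_mem)
  have n: "r1 * b y1 x + r2 * b y2 x = 0" if "b \<in> B" "frame_kernel a y1 y2 x" for b x
    using neg that by (metis bit_not_one_iff)
  consider "r1 = 0" "r2 = 1" | "r1 = 1" "r2 = 0" | "r1 = 1" "r2 = 1" using r by (cases r1; cases r2) auto
  then show False
  proof cases
    case 1
    then show False using no_common_image[OF o f] n by simp
  next
    case 2
    have "dual_frame a y2 y1 x2 x1" using f by (simp add: dual_frame_def)
    moreover have "b y1 x = 0" if "b \<in> B" "frame_kernel a y2 y1 x" for b x
      using n[OF that(1), of x] 2 that by (simp add: frame_kernel_def)
    ultimately show False by (rule no_common_image[OF o])
  next
    case 3
    have "dual_frame a y1 (y1 + y2) (x1 + x2) x2" using f a by (simp add: dual_frame_def expand)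
    moreover have "b (y1 + y2) x = 0" if "b \<in> B" "frame_kernel a y1 (y1 + y2) x" for b x
      using n[OF that(1), of x] 3 that a by (auto simp: frame_kernel_def expand)
    ultimately show False by (rule no_common_image[OF o])
  qed
qed

text \<open>Where a block \<open>B\<close> has rank two, \<open>C B = 0\<close> forces \<open>C = 0\<close>; applied also to the sum with an
  arbitrary form this makes \<open>C\<close> zero everywhere, against \<open>cokernel_not_radical\<close>.\<close>

lemma kernel_rank_one:
  assumes o: orthogonal and f: "dual_frame a y1 y2 x1 x2"
    and k: "frame_kernel a y1 y2 x" "frame_kernel a y1 y2 x'" and b: "b \<in> B"
  shows "b y1 x * b y2 x' = b y1 x' * b y2 x"
proof (rule ccontr)
  assume "\<not> ?thesis"
  then have d: "b y1 x * b y2 x' + b y1 x' * b y2 x = 1"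
    by (cases "b y1 x * b y2 x'"; cases "b y1 x' * b y2 x") auto
  have "c y x1 = 0 \<and> c y x2 = 0" if c: "c \<in> B" and y: "frame_cokernel a x1 x2 y" for c y
  proof -
    note p = corner_product[OF o f _ y]
    have 0: "b y x1 = 0" "b y x2 = 0" using bit_cramer[OF p[OF k(1) b] p[OF k(2) b] d] by auto
    have "c y x1 * b y1 z = c y x2 * b y2 z" if "frame_kernel a y1 y2 z" for z
      using p[OF that c] p[OF that add_mem[OF b c]] by (simp add: 0 distrib_left)
    from bit_cramer[OF this[OF k(1)] this[OF k(2)] d] show ?thesis .
  qed
  note van = this
  have "c y z = 0" if "c \<in> B" "frame_cokernel a x1 x2 y" for c y z
    using cokernel_expand[OF o f that(2,1), of z] van[OF that] by simp
  then show False
    using cokernel_not_radical[OF f] unfolding radical_left_def by blast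
qed

text \<open>The entries of \<open>B\<close> form two rows of linear forms with vanishing minors. By \<open>forms_prod_eq\<close>, two
  columns of \<open>B\<close> that are independent satisfy a common linear relation between the rows. A nonzero
  column satisfies at most one such relation, so with two independent columns present one relation
  would hold for all of \<open>B\<close>, which \<open>kernel_independent\<close> excludes.\<close>

lemma kernel_line:
  assumes o: orthogonal and f: "dual_frame a y1 y2 x1 x2"
  shows "\<exists>z. frame_kernel a y1 y2 z \<and>
     (\<forall>x. frame_kernel a y1 y2 x \<longrightarrow> radical_right x \<or> radical_right (x + z)) \<and>
     (\<forall>r1 r2. (r1, r2) \<noteq> (0, 0) \<longrightarrow> (\<exists>b\<in>B. r1 * b y1 z + r2 * b y2 z = 1))"
proof -
  let ?K = "frame_kernel a y1 y2"
  \<comment> \<open>The linear relation \<open>r\<close> between the two rows holds in the column \<open>x\<close>.\<close>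
  define rel where "rel r x \<longleftrightarrow> (\<forall>b\<in>B. fst r * b y1 x + snd r * b y2 x = 0)" for r x
  have a: "a \<in> B" using f by (rule frame_mem)
  have pair: "\<exists>r. r \<noteq> (0, 0) \<and> rel r x \<and> rel r x'"
    if k: "?K x" "?K x'" and nr: "\<not> radical_right x" "\<not> radical_right x'" "\<not> radical_right (x + x')" for x x'
  proof (cases "\<exists>b\<in>B. b y1 x * b y2 x' = 1")
    case True
    then obtain b where b: "b \<in> B" "b y1 x * b y2 x' = 1" by blast
    have "(\<forall>b\<in>B. b y1 x' = b y1 x \<and> b y2 x = b y2 x') \<or> (\<forall>b\<in>B. b y1 x' = b y2 x' \<and> b y2 x = b y1 x)"
      using kernel_rank_one[OF o f k] b by (rule entry_prod_eq)
    then show ?thesis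
    proof
      assume e: "\<forall>b\<in>B. b y1 x' = b y1 x \<and> b y2 x = b y2 x'"
      have "?K (x + x')" using k a by (simp add: frame_kernel_def expand)
      then have "radical_right (x + x')" by (rule radical_kernelI[OF o f]) (simp_all add: expand e)
      then show ?thesis using nr by simp
    next
      assume "\<forall>b\<in>B. b y1 x' = b y2 x' \<and> b y2 x = b y1 x"
      then show ?thesis by (intro exI[of _ "(1, 1)"]) (auto simp: rel_def)
    qed
  next
    case False
    then have z: "b y1 x * b y2 x' = 0" if "b \<in> B" for b using that by auto
    then have z': "b y1 x' * b y2 x = 0" if "b \<in> B" for b using kernel_rank_one[OF o f k that] z[OF that] by simp
    from entry_prod2_zero[of y1 x y2 x', OF z] entry_prod2_zero[of y1 x' y2 x, OF z']
    have "(\<forall>b\<in>B. b y1 x = 0 \<and> b y1 x' = 0) \<or> (\<forall>b\<in>B. b y2 x = 0 \<and> b y2 x' = 0)"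
      using radical_kernelI[OF o f k(1)] radical_kernelI[OF o f k(2)] nr by blast
    then have "rel (1, 0) x \<and> rel (1, 0) x' \<or> rel (0, 1) x \<and> rel (0, 1) x'" by (auto simp: rel_def)
    then show ?thesis by (metis Pair_inject zero_neq_one)
  qed
  have uniq: "r = r'"
    if k: "?K x" "\<not> radical_right x" and r: "rel r x" "rel r' x" "r \<noteq> (0, 0)" "r' \<noteq> (0, 0)" for r r' x
  proof (rule ccontr)
    assume "r \<noteq> r'"
    then have "b y1 x = 0 \<and> b y2 x = 0" if "b \<in> B" for b
      using r(1)[unfolded rel_def, rule_format, OF that] r(2)[unfolded rel_def, rule_format, OF that] r(3,4) \<open>r \<noteq> r'\<close>
      by (cases "fst r"; cases "snd r"; cases "fst r'"; cases "snd r'") (auto simp: prod_eq_iff)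
    then show False using radical_kernelI[OF o f k(1)] k(2) by blast
  qed
  obtain z where z: "?K z" "\<not> radical_right z"
    using kernel_not_radical[OF f] by blast
  have line: "radical_right x \<or> radical_right (x + z)" if x: "?K x" for x
  proof (rule ccontr)
    assume nr: "\<not> ?thesis"
    then obtain r where r: "r \<noteq> (0, 0)" "rel r x" "rel r z" using pair[OF x z(1)] z(2) by auto
    have "rel r w" if w: "?K w" for w
    proof -
      consider "radical_right w" | "radical_right (w + z)" | "\<not> radical_right w" "\<not> radical_right (w + z)" by blast
      then show ?thesis
      proof cases
        case 1
        then show ?thesis by (auto simp: rel_def radical_right_def)
      next
        case 2
        then have "\<forall>b\<in>B. \<forall>y. b y w = b y z" by (auto simp: radical_right_def expand)
        then show ?thesis using r(3) by (auto simp: rel_def)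
      next
        case 3
        then obtain r' where "r' \<noteq> (0, 0)" "rel r' w" "rel r' z" using pair[OF w z(1)] z(2) by auto
        then show ?thesis using uniq[OF z] r by blast
      qed
    qed
    moreover obtain b w where "b \<in> B" "?K w" "fst r * b y1 w + snd r * b y2 w = 1"
      using kernel_independent[OF o f, of "fst r" "snd r"] r(1) by auto
    ultimately show False by (auto simp: rel_def)
  qed
  have "\<exists>b\<in>B. r1 * b y1 z + r2 * b y2 z = 1" if r: "(r1, r2) \<noteq> (0, 0)" for r1 r2
  proof -
    obtain b x where b: "b \<in> B" "?K x" "r1 * b y1 x + r2 * b y2 x = 1"
      using kernel_independent[OF o f r] by auto
    have "\<not> radical_right x"
    proof
      assume "radical_right x"
      then have "b y1 x = 0" "b y2 x = 0" using b(1) by (simp_all add: radical_right_def)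
      then show False using b(3) by simp
    qed
    then have "radical_right (x + z)" using line[OF b(2)] by blast
    then have "b y x = b y z" for y using b(1) by (simp add: radical_right_def expand)
    then show ?thesis using b by auto
  qed
  then show ?thesis using z(1) line by blast
qed

end

context form_space
begin

interpretation op: form_space "flip ` B" by (rule form_space_flip')

lemma cokernel_line:
  assumes o: orthogonal and f: "dual_frame a y1 y2 x1 x2"
  shows "\<exists>z. frame_cokernel a x1 x2 z \<and>
     (\<forall>y. frame_cokernel a x1 x2 y \<longrightarrow> radical_left y \<or> radical_left (y + z)) \<and>
     (\<forall>r1 r2. (r1, r2) \<noteq> (0, 0) \<longrightarrow> (\<exists>b\<in>B. r1 * b z x1 + r2 * b z x2 = 1))"
  using op.kernel_line[OF flip_orthogonal[OF o] flip_dual_frame[OF f]]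
  by (simp add: flip_simps)

end

context form_space
begin

text \<open>With a one-dimensional kernel and cokernel modulo the radicals, \<open>n = p = 3\<close> and \<open>corner_product\<close> with
  \<open>forms_prod_eq\<close> gives \<open>C = (v, u)\<close> for \<open>B = (u, v)\<close>. After exchange of the two rows of the frame the
  matrices are \<open>[F G u; H k v; u v 0]\<close> with determinant \<open>k u + F v + (G + H) u v\<close>. Hence \<open>F\<close> is a multiple
  of \<open>u\<close> and \<open>k\<close> a multiple of \<open>v\<close>; both are cleared by adding multiples of the last column, and then
  \<open>(G + H) u v = 0\<close> leaves the two cases \<open>H = G\<close> and \<open>H = G + u + v\<close>.\<close>

lemma orthogonal_classification:
  assumes o: orthogonal
  obtains y1 y2 y3 x1 x2 x3 where "basis_left y1 y2 y3" "basis_right x1 x2 x3"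
    "\<And>b. b \<in> B \<Longrightarrow> b y1 x1 = 0 \<and> b y2 x2 = 0 \<and> b y3 x3 = 0 \<and> b y3 x1 = b y1 x3 \<and> b y3 x2 = b y2 x3"
    "(\<forall>b\<in>B. b y2 x1 = b y1 x2) \<or> (\<forall>b\<in>B. b y2 x1 = b y1 x2 + b y1 x3 + b y2 x3)"
    "\<And>g u v. \<exists>b\<in>B. b y1 x2 = g \<and> b y1 x3 = u \<and> b y2 x3 = v"
proof -
  obtain a y1 y2 x1 x2 where f: "dual_frame a y1 y2 x1 x2"
  proof -
    obtain b where "b \<in> B" using nonempty by blast
    from col_essential[OF this] show ?thesis using that dual_frame_exists by blast
  qed
  have a: "a \<in> B" using f by (rule frame_mem)
  let ?K = "frame_kernel a y1 y2" and ?L = "frame_cokernel a x1 x2"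
  obtain x3 where x3: "?K x3" "\<And>x. ?K x \<Longrightarrow> radical_right x \<or> radical_right (x + x3)"
    "\<And>r1 r2. (r1, r2) \<noteq> (0, 0) \<Longrightarrow> (\<exists>b\<in>B. r1 * b y1 x3 + r2 * b y2 x3 = 1)"
    using kernel_line[OF o f] by blast
  obtain y3 where y3: "?L y3" "\<And>y. ?L y \<Longrightarrow> radical_left y \<or> radical_left (y + y3)"
    "\<And>r1 r2. (r1, r2) \<noteq> (0, 0) \<Longrightarrow> (\<exists>b\<in>B. r1 * b y3 x1 + r2 * b y3 x2 = 1)"
    using cokernel_line[OF o f] by blast
  have indx: "\<exists>b\<in>B. b y1 x3 = 1" "\<exists>b\<in>B. b y2 x3 = 1" "\<exists>b\<in>B. b y1 x3 + b y2 x3 = 1"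
    using x3(3)[of 1 0] x3(3)[of 0 1] x3(3)[of 1 1] by auto
  have indy: "\<exists>b\<in>B. b y3 x1 = 1" "\<exists>b\<in>B. b y3 x2 = 1" "\<exists>b\<in>B. b y3 x1 + b y3 x2 = 1"
    using y3(3)[of 1 0] y3(3)[of 0 1] y3(3)[of 1 1] by auto
  have bx: "basis_right x1 x2 x3"
    using basis_from_kernel[OF f x3(1,2)] indx(1) not_radical_of_eval by blast
  have "basis_left y1 y2 y3"
    using cobasis_from_cokernel[OF f y3(1,2)] indy(1) not_radical_of_eval by blast
  \<comment> \<open>From here on the rows are taken in the order \<open>y2, y1, y3\<close>, which makes the third row and column equal.\<close>
  then have by': "basis_left y2 y1 y3"
    by (rule basis_left_swap12)
  have m33: "b y3 x3 = 0" if "b \<in> B" for b using corner_zero[OF o f x3(1) y3(1) that] .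
  have prod: "b y3 x1 * b y1 x3 = b y3 x2 * b y2 x3" if "b \<in> B" for b
    using corner_product[OF o f x3(1) y3(1) that] .
  obtain b where b: "b \<in> B" "b y3 x1 * b y1 x3 = 1"
    using entry_prod2_one[OF indy(1) indx(1)] by auto
  have "(\<forall>b\<in>B. b y3 x2 = b y3 x1 \<and> b y2 x3 = b y1 x3) \<or> (\<forall>b\<in>B. b y3 x2 = b y1 x3 \<and> b y2 x3 = b y3 x1)"
    using prod b by (rule entry_prod_eq)
  then have sym: "b y3 x2 = b y1 x3" "b y3 x1 = b y2 x3" if "b \<in> B" for b
    using indy(3) that by auto
  have det: "b y1 x2 * b y2 x3 + b y2 x1 * b y1 x3 + (b y2 x2 + b y1 x1) * b y1 x3 * b y2 x3 = 0"
    if b: "b \<in> B" for b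
    using minors3[OF b, of y1 x1 x2 x3 y2 y3] m33[OF b] sym[OF b]
    by (cases "b y1 x3"; cases "b y2 x3") (auto simp: det3_def ac_simps)
  have multiple: "\<exists>c. \<forall>b\<in>B. b y x = c * b y' x'"
    if p: "\<And>b. b \<in> B \<Longrightarrow> b y' x' = 0 \<Longrightarrow> b y x * b v z = 0"
      and i: "\<exists>b\<in>B. b v z = 1" "\<exists>b\<in>B. b v z + b y' x' = 1" for y x y' x' v z
  proof (rule form_multiple[OF closed linear_form_eval linear_form_eval])
    fix b assume b: "b \<in> B" "b y' x' = 0"
    let ?S = "{b \<in> B. b y' x' = 0}"
    have S: "add_closed ?S" using closed by (simp add: add_closed_def)
    have "\<not> (\<forall>b\<in>?S. b v z = 0)"
    proof
      assume "\<forall>b\<in>?S. b v z = 0"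
      then obtain c where "\<forall>b\<in>B. b v z = c * b y' x'"
        using form_multiple[of B "\<lambda>b. b v z" "\<lambda>b. b y' x'", OF closed linear_form_eval linear_form_eval] by blast
      then show False using i by (cases c) auto
    qed
    then show "b y x = 0"
      using forms_prod2_zero[of ?S "\<lambda>b. b y x" "\<lambda>b. b v z", OF S linear_form_eval linear_form_eval] p b by blast
  qed
  obtain s where s: "b y2 x1 = s * b y2 x3" if "b \<in> B" for b
  proof -
    have "b y2 x1 * b y1 x3 = 0" if "b \<in> B" "b y2 x3 = 0" for b using det[OF that(1)] that(2) by simp
    from multiple[of y2 x3 y2 x1 y1 x3, OF this indx(1,3)] that show ?thesis by auto
  qed
  obtain t where t: "b y1 x2 = t * b y1 x3" if "b \<in> B" for b
  proof -
    have "b y1 x2 * b y2 x3 = 0" if "b \<in> B" "b y1 x3 = 0" for b using det[OF that(1)] that(2) by simp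
    from multiple[of y1 x3 y1 x2 y2 x3, OF this indx(2)] indx(3) that show ?thesis by (auto simp: add.commute)
  qed
  let ?x1 = "x1 + s \<cdot> x3" and ?x2 = "x2 + t \<cdot> x3"
  have ev: "b y2 ?x1 = 0" "b y1 ?x2 = 0" "b y3 ?x1 = b y2 x3" "b y3 ?x2 = b y1 x3"
    if "b \<in> B" for b
    using s[OF that] t[OF that] m33[OF that] sym[OF that] that by (simp_all add: expand)
  have prod3: "b y1 x3 * b y2 x3 * (b y2 ?x2 + b y1 ?x1) = 0" if b: "b \<in> B" for b
    using minors3[OF b, of y1 ?x1 ?x2 x3 y2 y3] m33[OF b] ev[OF b]
    by (cases "b y1 x3"; cases "b y2 x3") (auto simp: det3_def ac_simps)
  have "linear_form (\<lambda>b. b y2 ?x2 + b y1 ?x1)" by (intro linear_form_add linear_form_eval)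
  then have w: "(\<forall>b\<in>B. b y1 ?x1 = b y2 ?x2) \<or> (\<forall>b\<in>B. b y1 ?x1 = b y2 ?x2 + b y2 x3 + b y1 x3)"
    using forms_prod3_zero[of B "\<lambda>b. b y1 x3" "\<lambda>b. b y2 x3" "\<lambda>b. b y2 ?x2 + b y1 ?x1",
        OF closed linear_form_eval linear_form_eval _ prod3] indx
    by (auto simp: ac_simps)
  \<comment> \<open>Adding \<open>a\<close> changes the entry at \<open>y2, ?x2\<close> and leaves the third column unchanged.\<close>
  have surj: "\<exists>b\<in>B. b y2 ?x2 = g \<and> b y2 x3 = u \<and> b y1 x3 = v" for g u v
  proof -
    obtain b where b: "b \<in> B" "b y2 x3 = u" "b y1 x3 = v"
      using forms_surj2[of B "\<lambda>b. b y2 x3" "\<lambda>b. b y1 x3" u v, OF closed linear_form_eval linear_form_eval] indx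
      by (auto simp: ac_simps)
    have "a y2 ?x2 = 1" "a y2 x3 = 0" "a y1 x3 = 0"
      using f x3(1) a by (auto simp: dual_frame_def frame_kernel_def expand)
    then have "(a + b) y2 ?x2 = g \<and> (a + b) y2 x3 = u \<and> (a + b) y1 x3 = v" if "b y2 ?x2 \<noteq> g"
      using b that by (cases g; cases "b y2 ?x2") auto
    then show ?thesis using b add_mem[OF a b(1)] by blast
  qed
  show thesis
  proof (rule that)
    show "basis_left y2 y1 y3" by fact
    show "basis_right ?x1 ?x2 x3" by (rule basis_right_shear[OF bx])
    show "b y2 ?x1 = 0 \<and> b y1 ?x2 = 0 \<and> b y3 x3 = 0 \<and> b y3 ?x1 = b y2 x3 \<and> b y3 ?x2 = b y1 x3"
      if "b \<in> B" for b using ev[OF that] m33[OF that] by blast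
    show "(\<forall>b\<in>B. b y1 ?x1 = b y2 ?x2) \<or> (\<forall>b\<in>B. b y1 ?x1 = b y2 ?x2 + b y2 x3 + b y1 x3)" by fact
    show "\<exists>b\<in>B. b y2 ?x2 = g \<and> b y2 x3 = u \<and> b y1 x3 = v" for g u v by (rule surj)
  qed
qed

end

section \<open>Spaces that contain the diagonal matrices of trace zero\<close>

context form_space
begin

text \<open>In these frames, \<open>a\<close> and \<open>b\<close> have the Gram matrices \<open>diag(1, 1, 0)\<close> and \<open>diag(1, 0, 1)\<close>.\<close>

definition diagonal_frame where
  "diagonal_frame a b y1 y2 y3 x1 x2 x3 \<longleftrightarrow> a \<in> B \<and> b \<in> B \<and>
     a y1 x1 = 1 \<and> a y1 x2 = 0 \<and> a y1 x3 = 0 \<and>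
     a y2 x1 = 0 \<and> a y2 x2 = 1 \<and> a y2 x3 = 0 \<and>
     a y3 x1 = 0 \<and> a y3 x2 = 0 \<and> a y3 x3 = 0 \<and>
     b y1 x1 = 1 \<and> b y1 x2 = 0 \<and> b y1 x3 = 0 \<and>
     b y2 x1 = 0 \<and> b y2 x2 = 0 \<and> b y2 x3 = 0 \<and>
     b y3 x1 = 0 \<and> b y3 x2 = 0 \<and> b y3 x3 = 1"

text \<open>Let \<open>a\<close> have rank two and let \<open>b\<close> pair a cokernel vector \<open>y3\<close> with a kernel vector \<open>x3\<close> of \<open>a\<close> to one.
  Clearing the third row and column of \<open>b\<close> does not affect \<open>a\<close>. The remaining block \<open>A\<close> of order two
  satisfies \<open>det A = det (A + 1) = 0\<close>, so it is an idempotent of rank one and can be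
  diagonalised by a change of the dual frame.\<close>

lemma diagonal_frame_exists:
  assumes "\<not> orthogonal"
  shows "\<exists>a b y1 y2 y3 x1 x2 x3. diagonal_frame a b y1 y2 y3 x1 x2 x3"
proof -
  obtain a b z1 z2 w1 w2 y3 x3 where a: "a \<in> B" "a z1 w1 * a z2 w2 + a z1 w2 * a z2 w1 = 1"
    and k: "a y3 w1 = 0" "a y3 w2 = 0" "a z1 x3 = 0" "a z2 x3 = 0" and b: "b \<in> B" "b y3 x3 = 1"
    using assms unfolding orthogonal_def by auto
  have a3: "a y3 x = 0" "a y x3 = 0" for x y
    using kernel_left[OF a k(1,2)] kernel_right[OF a k(3,4)] by auto
  from dual_frame_exists[OF a] obtain x1 x2 where f: "dual_frame a z1 z2 x1 x2" by blast
  \<comment> \<open>Clear the third row and the third column of \<open>b\<close>.\<close>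
  let ?y = "\<lambda>y. y + b y x3 \<cdot> y3" and ?x = "\<lambda>x. x + b y3 x \<cdot> x3"
  have f': "dual_frame a (?y z1) (?y z2) (?x x1) (?x x2)"
    using f a by (simp add: dual_frame_def expand a3)
  have b3: "b (?y z1) x3 = 0" "b (?y z2) x3 = 0" "b y3 (?x x1) = 0" "b y3 (?x x2) = 0"
    using b by (simp_all add: expand)
  have idem: "b y2 x2 = b y1 x1 + 1 \<and> b y1 x2 * b y2 x1 = 0"
    if f: "dual_frame a y1 y2 x1 x2" and "b y1 x3 = 0" "b y2 x3 = 0" "b y3 x1 = 0" "b y3 x2 = 0" for y1 y2 x1 x2
    using minors3[OF b(1), of y1 x1 x2 x3 y2 y3] minors3[OF add_mem[OF a(1) b(1)], of y1 x1 x2 x3 y2 y3]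
      that a3 b f unfolding det3_def dual_frame_def
    by (cases "b y1 x1"; cases "b y2 x2"; cases "b y1 x2"; cases "b y2 x1") simp_all
  obtain y1 y2 x1 x2 where f: "dual_frame a y1 y2 x1 x2"
    and z: "b y1 x3 = 0" "b y2 x3 = 0" "b y3 x1 = 0" "b y3 x2 = 0" and p: "b y1 x1 = 1"
  proof (cases "b (?y z1) (?x x1) = 1")
    case True
    then show ?thesis using that[OF f' b3] by blast
  next
    case False
    then have "b (?y z2) (?x x2) = 1" using idem[OF f' b3] by simp
    moreover have "dual_frame a (?y z2) (?y z1) (?x x2) (?x x1)" using f' by (simp add: dual_frame_def)
    ultimately show ?thesis using that b3 by blast
  qed
  have q: "b y2 x2 = 0" "b y1 x2 * b y2 x1 = 0" using idem[OF f z] p by auto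
  \<comment> \<open>Mutually inverse changes of the two frames that diagonalise \<open>[1 q; r 0]\<close> when \<open>q r = 0\<close>.\<close>
  have "diagonal_frame a b (y1 + b y1 x2 \<cdot> y2) (y2 + b y2 x1 \<cdot> y1) y3
      (x1 + b y2 x1 \<cdot> x2) (x2 + b y1 x2 \<cdot> x1) x3"
    using f z p q a b a3 unfolding diagonal_frame_def dual_frame_def
    by (cases "b y1 x2"; cases "b y2 x1") (simp_all add: expand)
  then show ?thesis by blast
qed

text \<open>Subtracting from \<open>x\<close> its components along the frame gives a vector \<open>z\<close> on which \<open>a\<close> and \<open>b\<close> vanish
  against the frame. Bordering the minors of an arbitrary member by \<open>z\<close> and shifting its diagonal by
  \<open>a\<close>, \<open>b\<close> and \<open>a + b\<close> shows that \<open>z\<close> is radical.\<close>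

lemma diagonal_frame_basis:
  assumes f: "diagonal_frame a b y1 y2 y3 x1 x2 x3"
  shows "basis_right x1 x2 x3"
  unfolding basis_right_def
proof (intro conjI allI impI)
  have a: "a \<in> B" and b: "b \<in> B" using f by (auto simp: diagonal_frame_def)
  fix x
  note F = f[unfolded diagonal_frame_def]
  have mina: "a y1 x1 * a y2 x2 + a y1 x2 * a y2 x1 = 1" using f by (simp add: diagonal_frame_def)
  have minb: "b y1 x1 * b y3 x3 + b y1 x3 * b y3 x1 = 1" using f by (simp add: diagonal_frame_def)
  define z where "z = x + a y1 x \<cdot> x1 + a y2 x \<cdot> x2 + b y3 x \<cdot> x3"
  have az: "a y1 z = 0" "a y2 z = 0" "a y3 z = 0" "b y3 z = 0"
  proof -
    show "a y1 z = 0" "a y2 z = 0" "b y3 z = 0"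
      unfolding z_def using f a b by (simp_all add: diagonal_frame_def expand)
    show "a y3 z = 0" using kernel_left[OF a mina, of y3 z] F by simp
  qed
  have bz: "b y1 z = 0" "b y2 z = 0"
  proof -
    show "b y2 z = 0" using minors3[OF b, of y1 x1 x3 z y2 y3] F az by (simp add: det3_def)
    show "b y1 z = 0" using minors3[OF add_mem[OF a b], of y1 x2 x3 z y2 y3] F az by (simp add: det3_def)
  qed
  have m3: "m y3 z = 0" if "m \<in> B" for m
    using minors3[OF that, of y1 x1 x2 z y2 y3]
      minors3[OF add_mem[OF that a], of y1 x1 x2 z y2 y3]
      minors3[OF add_mem[OF that b], of y1 x1 x2 z y2 y3]
      minors3[OF add_mem[OF that add_mem[OF a b]], of y1 x1 x2 z y2 y3] F az bz
    by - (rule det3_last_column_shifts[of "m y1 x1" "m y1 x2" "m y1 z" "m y2 x1" "m y2 x2" "m y2 z" "m y3 x1" "m y3 x2"], simp_all add: ac_simps)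
  have m2: "m y2 z = 0" if "m \<in> B" for m
    using minors3[OF that, of y1 x1 x3 z y3 y2]
      minors3[OF add_mem[OF that a], of y1 x1 x3 z y3 y2]
      minors3[OF add_mem[OF that b], of y1 x1 x3 z y3 y2]
      minors3[OF add_mem[OF that add_mem[OF a b]], of y1 x1 x3 z y3 y2] F az bz
    by - (rule det3_last_column_shifts[of "m y1 x1" "m y1 x3" "m y1 z" "m y3 x1" "m y3 x3" "m y3 z" "m y2 x1" "m y2 x3"], simp_all add: ac_simps)
  have m1: "m y1 z = 0" if "m \<in> B" for m
    using minors3[OF that, of y2 x2 x3 z y3 y1]
      minors3[OF add_mem[OF that a], of y2 x2 x3 z y3 y1]
      minors3[OF add_mem[OF that b], of y2 x2 x3 z y3 y1]
      minors3[OF add_mem[OF that add_mem[OF a b]], of y2 x2 x3 z y3 y1] F az bz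
    by - (rule det3_last_column_shifts[of "m y2 x2" "m y2 x3" "m y2 z" "m y3 x2" "m y3 x3" "m y3 z" "m y1 x2" "m y1 x3"], simp_all add: ac_simps)
  have "m y z = 0" if "m \<in> B" for m y
    using minors3[OF that, of y1 x1 x2 z y2 y]
      minors3[OF add_mem[OF that a], of y1 x1 x2 z y2 y]
      minors3[OF add_mem[OF that b], of y1 x1 x2 z y2 y]
      minors3[OF add_mem[OF that add_mem[OF a b]], of y1 x1 x2 z y2 y] F az bz m1[OF that] m2[OF that]
      kernel_right[OF a mina az(1,2), of y] kernel_right[OF b minb bz(1) az(4), of y]
    by - (rule det3_zero_column_shifts[of "m y1 x1" "m y1 x2" "m y2 x1" "m y2 x2" "m y x1" "m y x2" "m y z"], simp_all)
  then have "\<forall>m\<in>B. \<forall>y. m y x = a y1 x * m y x1 + a y2 x * m y x2 + b y3 x * m y x3"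
    by (simp add: z_def expand add.assoc)
  then show "\<exists>c1 c2 c3. \<forall>m\<in>B. \<forall>y. m y x = c1 * m y x1 + c2 * m y x2 + c3 * m y x3" by blast
next
  fix c1 c2 c3 assume e: "\<forall>b\<in>B. \<forall>y. c1 * b y x1 + c2 * b y x2 + c3 * b y x3 = 0"
  show "c1 = 0" "c2 = 0" "c3 = 0"
    using e[rule_format, of a y1] e[rule_format, of a y2] e[rule_format, of b y3] f
    by (simp_all add: diagonal_frame_def)
qed

end

context form_space
begin

interpretation op: form_space "flip ` B" by (rule form_space_flip')

lemma diagonal_frame_cobasis:
  assumes f: "diagonal_frame a b y1 y2 y3 x1 x2 x3"
  shows "basis_left y1 y2 y3"
proof -
  have "op.diagonal_frame (flip a) (flip b) x1 x2 x3 y1 y2 y3"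
    using f unfolding diagonal_frame_def op.diagonal_frame_def by auto
  from op.diagonal_frame_basis[OF this] show ?thesis by (simp only: flip_basis_right)
qed

end

context form_space
begin

text \<open>What remains of a diagonal frame, in a form that is invariant under simultaneous permutations of the
  two bases. The last clause says that the first two diagonal entries are independent of the
  off-diagonal ones; the third is determined by the trace.\<close>

definition tight_frame where
  "tight_frame y1 y2 y3 x1 x2 x3 \<longleftrightarrow> basis_left y1 y2 y3 \<and> basis_right x1 x2 x3 \<and>
    (\<forall>m\<in>B. m y1 x1 + m y2 x2 + m y3 x3 = 0 \<and> m y1 x2 * m y2 x1 = m y1 x3 * m y3 x1 \<and>
       m y1 x2 * m y2 x1 = m y2 x3 * m y3 x2 \<and> m y1 x2 * m y2 x3 * m y3 x1 = m y1 x3 * m y2 x1 * m y3 x2) \<and>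
    (\<forall>m\<in>B. \<forall>p q. \<exists>m'\<in>B. m' y1 x1 = p \<and> m' y2 x2 = q \<and> m' y1 x2 = m y1 x2 \<and> m' y1 x3 = m y1 x3 \<and>
       m' y2 x1 = m y2 x1 \<and> m' y2 x3 = m y2 x3 \<and> m' y3 x1 = m y3 x1 \<and> m' y3 x2 = m y3 x2)"

lemma diagonal_frame_tight:
  assumes f: "diagonal_frame a b y1 y2 y3 x1 x2 x3"
  shows "tight_frame y1 y2 y3 x1 x2 x3"
  unfolding tight_frame_def
proof (intro conjI diagonal_frame_basis[OF f] diagonal_frame_cobasis[OF f] ballI allI)
  have a: "a \<in> B" and b: "b \<in> B" using f by (auto simp: diagonal_frame_def)
  fix m assume m: "m \<in> B"
  have *: "m y1 x1 + m y2 x2 + m y3 x3 = 0 \<and> m y1 x2 * m y2 x1 = m y1 x3 * m y3 x1 \<and>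
       m y1 x2 * m y2 x1 = m y2 x3 * m y3 x2 \<and> m y1 x2 * m y2 x3 * m y3 x1 = m y1 x3 * m y2 x1 * m y3 x2"
    using minors3[OF m, of y1 x1 x2 x3 y2 y3]
      minors3[OF add_mem[OF m a], of y1 x1 x2 x3 y2 y3]
      minors3[OF add_mem[OF m b], of y1 x1 x2 x3 y2 y3]
      minors3[OF add_mem[OF m add_mem[OF a b]], of y1 x1 x2 x3 y2 y3] f
    by (intro det3_diagonal_shifts) (simp_all add: diagonal_frame_def)
  show "m y1 x1 + m y2 x2 + m y3 x3 = 0" "m y1 x2 * m y2 x1 = m y1 x3 * m y3 x1"
       "m y1 x2 * m y2 x1 = m y2 x3 * m y3 x2" "m y1 x2 * m y2 x3 * m y3 x1 = m y1 x3 * m y2 x1 * m y3 x2"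
    using * by auto
  fix p q
  let ?P = "\<lambda>m'. m' y1 x1 = p \<and> m' y2 x2 = q \<and> m' y1 x2 = m y1 x2 \<and> m' y1 x3 = m y1 x3 \<and>
       m' y2 x1 = m y2 x1 \<and> m' y2 x3 = m y2 x3 \<and> m' y3 x1 = m y3 x1 \<and> m' y3 x2 = m y3 x2"
  have "?P m \<or> ?P (m + a) \<or> ?P (m + b) \<or> ?P (m + (a + b))"
    using f unfolding diagonal_frame_def by (cases p; cases q; cases "m y1 x1"; cases "m y2 x2") simp_all
  then show "\<exists>m'\<in>B. ?P m'" using m a b add_mem by blast
qed

lemma tight_frame_entries:
  assumes "tight_frame y1 y2 y3 x1 x2 x3" "m \<in> B"
  shows "m y1 x1 + m y2 x2 + m y3 x3 = 0" "m y1 x2 * m y2 x1 = m y1 x3 * m y3 x1"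
    "m y1 x2 * m y2 x1 = m y2 x3 * m y3 x2" "m y1 x2 * m y2 x3 * m y3 x1 = m y1 x3 * m y2 x1 * m y3 x2"
  using assms unfolding tight_frame_def by blast+

lemma tight_frame_trace:
  assumes t: "tight_frame y1 y2 y3 x1 x2 x3" and m: "m \<in> B"
  shows "m y3 x3 = m y1 x1 + m y2 x2"
  using tight_frame_entries(1)[OF assms] by simp

lemma tight_frame_adjust:
  assumes "tight_frame y1 y2 y3 x1 x2 x3" "m \<in> B"
  obtains m' where "m' \<in> B" "m' y1 x1 = p" "m' y2 x2 = q" "m' y1 x2 = m y1 x2" "m' y1 x3 = m y1 x3"
    "m' y2 x1 = m y2 x1" "m' y2 x3 = m y2 x3" "m' y3 x1 = m y3 x1" "m' y3 x2 = m y3 x2"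
  using assms unfolding tight_frame_def by meson

lemma tight_frame_swap12:
  assumes t: "tight_frame y1 y2 y3 x1 x2 x3" shows "tight_frame y2 y1 y3 x2 x1 x3"
  unfolding tight_frame_def
proof (intro conjI ballI allI)
  show "basis_left y2 y1 y3" "basis_right x2 x1 x3"
    using t basis_left_swap12 basis_right_swap12 unfolding tight_frame_def by blast+
next
  fix m assume m: "m \<in> B"
  note E = tight_frame_entries[OF t m]
  show "m y2 x2 + m y1 x1 + m y3 x3 = 0" using E(1) by (simp add: ac_simps)
  show "m y2 x1 * m y1 x2 = m y2 x3 * m y3 x2" "m y2 x1 * m y1 x2 = m y1 x3 * m y3 x1"
    "m y2 x1 * m y1 x3 * m y3 x2 = m y2 x3 * m y1 x2 * m y3 x1" using E by Groebner_Basis.algebra+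
  fix p q
  from tight_frame_adjust[OF t m, of q p]
  show "\<exists>m'\<in>B. m' y2 x2 = p \<and> m' y1 x1 = q \<and> m' y2 x1 = m y2 x1 \<and> m' y2 x3 = m y2 x3 \<and>
       m' y1 x2 = m y1 x2 \<and> m' y1 x3 = m y1 x3 \<and> m' y3 x2 = m y3 x2 \<and> m' y3 x1 = m y3 x1" by metis
qed

lemma tight_frame_swap23:
  assumes t: "tight_frame y1 y2 y3 x1 x2 x3" shows "tight_frame y1 y3 y2 x1 x3 x2"
  unfolding tight_frame_def
proof (intro conjI ballI allI)
  show "basis_left y1 y3 y2" "basis_right x1 x3 x2"
    using t basis_left_swap23 basis_right_swap23 unfolding tight_frame_def by blast+
next
  fix m assume m: "m \<in> B"
  note E = tight_frame_entries[OF t m]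
  show "m y1 x1 + m y3 x3 + m y2 x2 = 0" using E(1) by (simp add: ac_simps)
  show "m y1 x3 * m y3 x1 = m y1 x2 * m y2 x1" "m y1 x3 * m y3 x1 = m y3 x2 * m y2 x3"
    "m y1 x3 * m y3 x2 * m y2 x1 = m y1 x2 * m y3 x1 * m y2 x3" using E by Groebner_Basis.algebra+
  fix p q
  \<comment> \<open>The second diagonal entry \<open>p + q\<close> makes the third one equal to \<open>q\<close>, by the trace.\<close>
  obtain m' where m': "m' \<in> B" "m' y1 x1 = p" "m' y2 x2 = p + q" "m' y1 x2 = m y1 x2" "m' y1 x3 = m y1 x3"
    "m' y2 x1 = m y2 x1" "m' y2 x3 = m y2 x3" "m' y3 x1 = m y3 x1" "m' y3 x2 = m y3 x2"
    using tight_frame_adjust[OF t m] by blast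
  moreover have "m' y3 x3 = q" using tight_frame_entries(1)[OF t m'(1)] m'(2,3) by simp
  ultimately show "\<exists>m'\<in>B. m' y1 x1 = p \<and> m' y3 x3 = q \<and> m' y1 x3 = m y1 x3 \<and> m' y1 x2 = m y1 x2 \<and>
       m' y3 x1 = m y3 x1 \<and> m' y3 x2 = m y3 x2 \<and> m' y2 x1 = m y2 x1 \<and> m' y2 x3 = m y2 x3" by blast
qed

end

section \<open>The list of Gram matrices\<close>

text \<open>The normal forms that come out of the classification, as lists of rows. In the end \<open>twisted_rows\<close> and
  \<open>constant_rows\<close> turn out to be of type \<open>U3\<close>, and \<open>cyclic_rows\<close> and \<open>two_valued_rows\<close> of type \<open>V3\<close>.\<close>

definition triangular_rows :: "bit list list set" where
  "triangular_rows = {[[a, c, d], [0, a + b, e], [0, 0, b]] | a b c d e. True}"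

definition alternating_rows :: "bit list list set" where
  "alternating_rows = {[[0, f, g], [f, 0, h], [g, h, 0]] | f g h. True}"

definition twisted_rows :: "bit list list set" where
  "twisted_rows = {[[0, f, g], [f + g + h, 0, h], [g, h, 0]] | f g h. True}"

definition constant_rows :: "bit list list set" where
  "constant_rows = {[[p, f, f], [f, q, f], [f, f, p + q]] | p q f. True}"

definition cyclic_rows :: "bit list list set" where
  "cyclic_rows = {[[p, f, 0], [0, q, g], [f + g, 0, p + q]] | p q f g. True}"

definition two_valued_rows :: "bit list list set" where
  "two_valued_rows = {[[p, f, f], [g, q, f], [g, g, p + q]] | p q f g. True}"

definition gram :: "('w \<Rightarrow> 'u \<Rightarrow> bit) \<Rightarrow> 'w \<Rightarrow> 'w \<Rightarrow> 'w \<Rightarrow> 'u \<Rightarrow> 'u \<Rightarrow> 'u \<Rightarrow> bit list list" where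
  "gram b y1 y2 y3 x1 x2 x3 =
     [[b y1 x1, b y1 x2, b y1 x3], [b y2 x1, b y2 x2, b y2 x3], [b y3 x1, b y3 x2, b y3 x3]]"

context form_space
begin

definition presented_by where
  "presented_by T \<longleftrightarrow> (\<exists>y1 y2 y3 x1 x2 x3. basis_left y1 y2 y3 \<and> basis_right x1 x2 x3 \<and>
     (\<lambda>b. gram b y1 y2 y3 x1 x2 x3) ` B = T)"

lemma presented_byI:
  assumes "basis_left y1 y2 y3" "basis_right x1 x2 x3"
    and "\<And>b. b \<in> B \<Longrightarrow> gram b y1 y2 y3 x1 x2 x3 \<in> T"
    and "\<And>t. t \<in> T \<Longrightarrow> \<exists>b\<in>B. gram b y1 y2 y3 x1 x2 x3 = t"
  shows "presented_by T"
proof -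
  have "(\<lambda>b. gram b y1 y2 y3 x1 x2 x3) ` B = T"
    using assms(3,4) by (auto simp: image_iff)
  then show ?thesis using assms(1,2) unfolding presented_by_def by blast
qed

lemma tight_frame_triangular:
  assumes t: "tight_frame y1 y2 y3 x1 x2 x3"
    and z: "\<And>m. m \<in> B \<Longrightarrow> m y2 x1 = 0 \<and> m y3 x1 = 0 \<and> m y3 x2 = 0"
  shows "\<exists>T\<subseteq>triangular_rows. presented_by T"
proof -
  have "gram m y1 y2 y3 x1 x2 x3 \<in> triangular_rows" if m: "m \<in> B" for m
  proof -
    have "m y2 x2 = m y1 x1 + m y3 x3"
      using tight_frame_entries(1)[OF t m] by (cases "m y1 x1"; cases "m y2 x2") auto
    then show ?thesis using z[OF m] by (auto simp: gram_def triangular_rows_def)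
  qed
  then have sub: "(\<lambda>b. gram b y1 y2 y3 x1 x2 x3) ` B \<subseteq> triangular_rows" by auto
  have "basis_left y1 y2 y3" "basis_right x1 x2 x3" using t by (auto simp: tight_frame_def)
  then have "presented_by ((\<lambda>b. gram b y1 y2 y3 x1 x2 x3) ` B)" by (rule presented_byI) auto
  with sub show ?thesis by blast
qed

lemma tight_frame_constant:
  assumes t: "tight_frame y1 y2 y3 x1 x2 x3"
    and e: "\<And>m. m \<in> B \<Longrightarrow> m y1 x3 = m y1 x2 \<and> m y2 x1 = m y1 x2 \<and> m y2 x3 = m y1 x2 \<and>
       m y3 x1 = m y1 x2 \<and> m y3 x2 = m y1 x2"
    and n: "\<exists>m\<in>B. m y1 x2 = 1"
  shows "presented_by constant_rows"
proof (rule presented_byI)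
  show "basis_left y1 y2 y3" "basis_right x1 x2 x3" using t by (auto simp: tight_frame_def)
next
  fix m assume m: "m \<in> B"
  then show "gram m y1 y2 y3 x1 x2 x3 \<in> constant_rows"
    using tight_frame_trace[OF t m] e[OF m] by (auto simp: gram_def constant_rows_def)
next
  fix r assume "r \<in> constant_rows"
  then obtain p q f where r: "r = [[p, f, f], [f, q, f], [f, f, p + q]]" by (auto simp: constant_rows_def)
  obtain m where m: "m \<in> B" "m y1 x2 = f"
  proof -
    obtain k where k: "k \<in> B" "k y1 x2 = 1" using n by blast
    then show ?thesis using that[of k] that[of "k + k"] add_mem[of k k] by (cases f) auto
  qed
  obtain m' where m': "m' \<in> B" "m' y1 x1 = p" "m' y2 x2 = q" "m' y1 x2 = m y1 x2"
    using tight_frame_adjust[OF t m(1)] by blast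
  then have "gram m' y1 y2 y3 x1 x2 x3 = r"
    using tight_frame_trace[OF t m'(1)] e[OF m'(1)] m by (simp add: gram_def r)
  then show "\<exists>b\<in>B. gram b y1 y2 y3 x1 x2 x3 = r" using m'(1) by blast
qed

lemma tight_frame_two_valued:
  assumes t: "tight_frame y1 y2 y3 x1 x2 x3"
    and e: "\<And>m. m \<in> B \<Longrightarrow> m y1 x3 = m y1 x2 \<and> m y2 x3 = m y1 x2 \<and> m y3 x1 = m y2 x1 \<and> m y3 x2 = m y2 x1"
    and n: "\<exists>m\<in>B. m y1 x2 = 1" "\<exists>m\<in>B. m y2 x1 = 1"
  shows "presented_by constant_rows \<or> presented_by two_valued_rows"
proof (cases "\<forall>m\<in>B. m y1 x2 = m y2 x1")
  case True
  then have "m y1 x3 = m y1 x2 \<and> m y2 x1 = m y1 x2 \<and> m y2 x3 = m y1 x2 \<and>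
       m y3 x1 = m y1 x2 \<and> m y3 x2 = m y1 x2" if "m \<in> B" for m
    using e[OF that] that by auto
  from tight_frame_constant[OF t this n(1)] show ?thesis by simp
next
  case False
  have "presented_by two_valued_rows"
  proof (rule presented_byI)
    show "basis_left y1 y2 y3" "basis_right x1 x2 x3" using t by (auto simp: tight_frame_def)
  next
    fix m assume m: "m \<in> B"
    then show "gram m y1 y2 y3 x1 x2 x3 \<in> two_valued_rows"
      using tight_frame_trace[OF t m] e[OF m] by (auto simp: gram_def two_valued_rows_def)
  next
    fix r assume "r \<in> two_valued_rows"
    then obtain p q f g where r: "r = [[p, f, f], [g, q, f], [g, g, p + q]]" by (auto simp: two_valued_rows_def)
    obtain k where k: "k \<in> B" "k y1 x2 \<noteq> k y2 x1" using False by blast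
    then have "k y1 x2 + k y2 x1 = 1" by (cases "k y1 x2"; cases "k y2 x1") auto
    then obtain m where m: "m \<in> B" "m y1 x2 = f" "m y2 x1 = g"
      using forms_surj2[of B "\<lambda>b. b y1 x2" "\<lambda>b. b y2 x1" f g, OF closed linear_form_eval linear_form_eval n] k(1)
      by blast
    obtain m' where m': "m' \<in> B" "m' y1 x1 = p" "m' y2 x2 = q" "m' y1 x2 = m y1 x2" "m' y2 x1 = m y2 x1"
      using tight_frame_adjust[OF t m(1)] by blast
    then have "gram m' y1 y2 y3 x1 x2 x3 = r"
      using tight_frame_trace[OF t m'(1)] e[OF m'(1)] m by (simp add: gram_def r)
    then show "\<exists>b\<in>B. gram b y1 y2 y3 x1 x2 x3 = r" using m'(1) by blast
  qed
  then show ?thesis by simp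
qed

text \<open>The product of the three remaining off-diagonal entries vanishes. If one of them is zero, the others
  are above the diagonal in a suitable order of the indices; otherwise their sum is zero.\<close>

lemma tight_frame_cyclic:
  assumes t: "tight_frame y1 y2 y3 x1 x2 x3"
    and z: "\<And>m. m \<in> B \<Longrightarrow> m y1 x3 = 0 \<and> m y2 x1 = 0 \<and> m y3 x2 = 0"
  shows "(\<exists>T\<subseteq>triangular_rows. presented_by T) \<or> presented_by cyclic_rows"
proof -
  note t132 = tight_frame_swap23[OF t] and t213 = tight_frame_swap12[OF t]
  note t231 = tight_frame_swap23[OF t213] and t312 = tight_frame_swap12[OF t132]
  have "m y1 x2 * m y2 x3 * m y3 x1 = 0" if m: "m \<in> B" for m
    using tight_frame_entries(4)[OF t m] z[OF m] by simp
  then have "(\<forall>m\<in>B. m y1 x2 = 0) \<or> (\<forall>m\<in>B. m y2 x3 = 0) \<or> (\<forall>m\<in>B. m y3 x1 = 0) \<or>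
      (\<forall>m\<in>B. m y1 x2 + m y2 x3 + m y3 x1 = 0)"
    by (rule forms_prod3_zero[OF closed linear_form_eval linear_form_eval linear_form_eval])
  then consider (f) "\<forall>m\<in>B. m y1 x2 = 0" | (g) "\<forall>m\<in>B. m y2 x3 = 0" | (h) "\<forall>m\<in>B. m y3 x1 = 0"
    | (s) "\<exists>m\<in>B. m y1 x2 = 1" "\<exists>m\<in>B. m y2 x3 = 1" "\<exists>m\<in>B. m y3 x1 = 1"
      "\<forall>m\<in>B. m y3 x1 = m y1 x2 + m y2 x3"
    unfolding bit_add_eq_0_iff by (metis (full_types) bit_not_one_iff)
  then show ?thesis
  proof cases
    case f
    then show ?thesis using tight_frame_triangular[OF t231] z by auto
  next
    case g
    then show ?thesis using tight_frame_triangular[OF t312] z by auto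
  next
    case h
    then show ?thesis using tight_frame_triangular[OF t] z by auto
  next
    case s
    have "presented_by cyclic_rows"
    proof (rule presented_byI)
      show "basis_left y1 y2 y3" "basis_right x1 x2 x3" using t by (auto simp: tight_frame_def)
    next
      fix m assume m: "m \<in> B"
      then show "gram m y1 y2 y3 x1 x2 x3 \<in> cyclic_rows"
        using tight_frame_trace[OF t m] z[OF m] s(4)[rule_format, OF m] by (simp add: gram_def cyclic_rows_def)
    next
      fix r assume "r \<in> cyclic_rows"
      then obtain p q f g where r: "r = [[p, f, 0], [0, q, g], [f + g, 0, p + q]]" by (auto simp: cyclic_rows_def)
      obtain m where m: "m \<in> B" "m y1 x2 = f" "m y2 x3 = g"
        using forms_surj2[of B "\<lambda>b. b y1 x2" "\<lambda>b. b y2 x3" f g, OF closed linear_form_eval linear_form_eval s(1,2)]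
          s(3,4) by auto
      obtain m' where m': "m' \<in> B" "m' y1 x1 = p" "m' y2 x2 = q" "m' y1 x2 = m y1 x2" "m' y2 x3 = m y2 x3"
        using tight_frame_adjust[OF t m(1)] by blast
      then have "gram m' y1 y2 y3 x1 x2 x3 = r"
        using tight_frame_trace[OF t m'(1)] z[OF m'(1)] m s(4)[rule_format, OF m'(1)] by (simp add: gram_def r)
      then show "\<exists>b\<in>B. gram b y1 y2 y3 x1 x2 x3 = r" using m'(1) by blast
    qed
    then show ?thesis by simp
  qed
qed

text \<open>If all products \<open>m\<^sub>i\<^sub>j m\<^sub>j\<^sub>i\<close> vanish, then for each pair of indices one of the two entries vanishes
  identically, and the eight resulting tournaments on three points are six transitive and two cyclic
  ones. Otherwise \<open>forms_prod_eq\<close> identifies each pair \<open>{m\<^sub>i\<^sub>j, m\<^sub>j\<^sub>i}\<close> with the pair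
  \<open>{m\<^sub>1\<^sub>2, m\<^sub>2\<^sub>1}\<close>, so that the places of \<open>m\<^sub>1\<^sub>2\<close> form a tournament; in the one cyclic case that
  arises, equality of the two cyclic products makes all entries equal.\<close>

lemma tight_frame_classification:
  assumes t: "tight_frame y1 y2 y3 x1 x2 x3"
  shows "(\<exists>T\<subseteq>triangular_rows. presented_by T) \<or> presented_by constant_rows \<or> presented_by cyclic_rows \<or>
    presented_by two_valued_rows"
proof -
  note t132 = tight_frame_swap23[OF t] and t213 = tight_frame_swap12[OF t]
  note t231 = tight_frame_swap23[OF t213] and t312 = tight_frame_swap12[OF t132]
  note t321 = tight_frame_swap12[OF t231]
  note E = tight_frame_entries[OF t]
  show ?thesis
  proof (cases "\<exists>m\<in>B. m y1 x2 * m y2 x1 = 1")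
    case False
    then have P1: "m y1 x2 * m y2 x1 = 0" if "m \<in> B" for m
      using that bit_not_one_iff by blast
    have P2: "m y1 x3 * m y3 x1 = 0" and P3: "m y2 x3 * m y3 x2 = 0" if "m \<in> B" for m
      using P1[OF that] E(2)[OF that] E(3)[OF that] by simp_all
    define Z where "Z y x \<longleftrightarrow> (\<forall>m\<in>B. m y x = 0)" for y x
    have "Z y1 x2 \<or> Z y2 x1" "Z y1 x3 \<or> Z y3 x1" "Z y2 x3 \<or> Z y3 x2"
      unfolding Z_def using entry_prod2_zero[of y1 x2 y2 x1, OF P1] entry_prod2_zero[of y1 x3 y3 x1, OF P2]
        entry_prod2_zero[of y2 x3 y3 x2, OF P3] by blast+
    then consider
      (z123) "Z y2 x1" "Z y3 x1" "Z y3 x2"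
    | (z132) "Z y3 x1" "Z y2 x1" "Z y2 x3"
    | (z213) "Z y1 x2" "Z y3 x2" "Z y3 x1"
    | (z231) "Z y3 x2" "Z y1 x2" "Z y1 x3"
    | (z312) "Z y1 x3" "Z y2 x3" "Z y2 x1"
    | (z321) "Z y2 x3" "Z y1 x3" "Z y1 x2"
    | (cycle) "Z y1 x3" "Z y2 x1" "Z y3 x2"
    | (rev_cycle) "Z y1 x2" "Z y2 x3" "Z y3 x1"
      by blast
    then show ?thesis
    proof cases
      case z123
      then show ?thesis using tight_frame_triangular[OF t] unfolding Z_def by blast
    next
      case z132
      then show ?thesis using tight_frame_triangular[OF t132] unfolding Z_def by blast
    next
      case z213
      then show ?thesis using tight_frame_triangular[OF t213] unfolding Z_def by blast
    next
      case z231
      then show ?thesis using tight_frame_triangular[OF t231] unfolding Z_def by blast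
    next
      case z312
      then show ?thesis using tight_frame_triangular[OF t312] unfolding Z_def by blast
    next
      case z321
      then show ?thesis using tight_frame_triangular[OF t321] unfolding Z_def by blast
    next
      case cycle
      then show ?thesis using tight_frame_cyclic[OF t] unfolding Z_def by blast
    next
      case rev_cycle
      then show ?thesis using tight_frame_cyclic[OF t213] unfolding Z_def by blast
    qed
  next
    case True
    then obtain k where k: "k \<in> B" "k y1 x2 * k y2 x1 = 1" by blast
    then have n: "\<exists>m\<in>B. m y1 x2 = 1" "\<exists>m\<in>B. m y2 x1 = 1" by auto
    have "(\<forall>m\<in>B. m y1 x3 = m y1 x2 \<and> m y3 x1 = m y2 x1) \<or> (\<forall>m\<in>B. m y1 x3 = m y2 x1 \<and> m y3 x1 = m y1 x2)"
      by (rule entry_prod_eq[of y1 x2 y2 x1 y1 x3 y3 x1, OF E(2) k])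
    moreover have "(\<forall>m\<in>B. m y2 x3 = m y1 x2 \<and> m y3 x2 = m y2 x1) \<or> (\<forall>m\<in>B. m y2 x3 = m y2 x1 \<and> m y3 x2 = m y1 x2)"
      by (rule entry_prod_eq[of y1 x2 y2 x1 y2 x3 y3 x2, OF E(3) k])
    ultimately consider
      (a) "\<forall>m\<in>B. m y1 x3 = m y1 x2 \<and> m y3 x1 = m y2 x1 \<and> m y2 x3 = m y1 x2 \<and> m y3 x2 = m y2 x1"
    | (b) "\<forall>m\<in>B. m y1 x3 = m y1 x2 \<and> m y3 x1 = m y2 x1 \<and> m y2 x3 = m y2 x1 \<and> m y3 x2 = m y1 x2"
    | (c) "\<forall>m\<in>B. m y1 x3 = m y2 x1 \<and> m y3 x1 = m y1 x2 \<and> m y2 x3 = m y1 x2 \<and> m y3 x2 = m y2 x1"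
    | (d) "\<forall>m\<in>B. m y1 x3 = m y2 x1 \<and> m y3 x1 = m y1 x2 \<and> m y2 x3 = m y2 x1 \<and> m y3 x2 = m y1 x2"
      by blast
    then show ?thesis
    proof cases
      case a
      have "m y1 x3 = m y1 x2 \<and> m y2 x3 = m y1 x2 \<and> m y3 x1 = m y2 x1 \<and> m y3 x2 = m y2 x1" if "m \<in> B" for m
        using a[rule_format, OF that] by simp
      from tight_frame_two_valued[OF t this n] show ?thesis by blast
    next
      case b
      have "m y1 x2 = m y1 x3 \<and> m y3 x2 = m y1 x3 \<and> m y2 x1 = m y3 x1 \<and> m y2 x3 = m y3 x1" if "m \<in> B" for m
        using b[rule_format, OF that] by simp
      moreover have "\<exists>m\<in>B. m y1 x3 = 1" "\<exists>m\<in>B. m y3 x1 = 1"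
        using k b[rule_format, OF k(1)] by (auto intro!: bexI[of _ k])
      ultimately have "presented_by constant_rows \<or> presented_by two_valued_rows"
        by (rule tight_frame_two_valued[OF t132])
      then show ?thesis by blast
    next
      case c
      have e: "m y1 x2 = m y2 x1" if "m \<in> B" for m
        using E(4)[OF that] c[rule_format, OF that] by simp
      have "m y1 x3 = m y1 x2 \<and> m y2 x1 = m y1 x2 \<and> m y2 x3 = m y1 x2 \<and>
          m y3 x1 = m y1 x2 \<and> m y3 x2 = m y1 x2" if "m \<in> B" for m
        using c[rule_format, OF that] e[OF that] by simp
      from tight_frame_constant[OF t this n(1)] show ?thesis by blast
    next
      case d
      have "m y3 x2 = m y3 x1 \<and> m y1 x2 = m y3 x1 \<and> m y2 x3 = m y1 x3 \<and> m y2 x1 = m y1 x3" if "m \<in> B" for m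
        using d[rule_format, OF that] by simp
      moreover have "\<exists>m\<in>B. m y3 x1 = 1" "\<exists>m\<in>B. m y1 x3 = 1"
        using k d[rule_format, OF k(1)] by (auto intro!: bexI[of _ k])
      ultimately have "presented_by constant_rows \<or> presented_by two_valued_rows"
        by (rule tight_frame_two_valued[OF t312])
      then show ?thesis by blast
    qed
  qed
qed

text \<open>The six possibilities are not yet the four types of the final statement, because the normal forms
  within one type still have to be matched.\<close>

theorem form_space_classification:
  "(\<exists>T\<subseteq>triangular_rows. presented_by T) \<or> presented_by alternating_rows \<or> presented_by twisted_rows \<or>
    presented_by constant_rows \<or> presented_by cyclic_rows \<or> presented_by two_valued_rows"
proof (cases orthogonal)
  case False
  from diagonal_frame_exists[OF this] obtain a b y1 y2 y3 x1 x2 x3 where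
    "diagonal_frame a b y1 y2 y3 x1 x2 x3" by (elim exE)
  from tight_frame_classification[OF diagonal_frame_tight[OF this]] show ?thesis by blast
next
  case True
  show ?thesis
  proof (rule orthogonal_classification[OF True])
    fix y1 y2 y3 x1 x2 x3
    assume basis: "basis_left y1 y2 y3" "basis_right x1 x2 x3"
      and e: "\<And>b. b \<in> B \<Longrightarrow> b y1 x1 = 0 \<and> b y2 x2 = 0 \<and> b y3 x3 = 0 \<and> b y3 x1 = b y1 x3 \<and> b y3 x2 = b y2 x3"
      and c: "(\<forall>b\<in>B. b y2 x1 = b y1 x2) \<or> (\<forall>b\<in>B. b y2 x1 = b y1 x2 + b y1 x3 + b y2 x3)"
      and s: "\<And>g u v. \<exists>b\<in>B. b y1 x2 = g \<and> b y1 x3 = u \<and> b y2 x3 = v"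
    from c show ?thesis
    proof
      assume c: "\<forall>b\<in>B. b y2 x1 = b y1 x2"
      have "presented_by alternating_rows"
      proof (rule presented_byI[OF basis])
        show "gram b y1 y2 y3 x1 x2 x3 \<in> alternating_rows" if "b \<in> B" for b
          using e[OF that] c[rule_format, OF that] by (simp add: gram_def alternating_rows_def)
        fix t assume "t \<in> alternating_rows"
        then obtain f g h where t: "t = [[0, f, g], [f, 0, h], [g, h, 0]]" by (auto simp: alternating_rows_def)
        obtain b where b: "b \<in> B" "b y1 x2 = f" "b y1 x3 = g" "b y2 x3 = h" using s by blast
        then have "gram b y1 y2 y3 x1 x2 x3 = t"
          using e[OF b(1)] c[rule_format, OF b(1)] by (simp add: gram_def t)
        then show "\<exists>b\<in>B. gram b y1 y2 y3 x1 x2 x3 = t" using b(1) by blast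
      qed
      then show ?thesis by blast
    next
      assume c: "\<forall>b\<in>B. b y2 x1 = b y1 x2 + b y1 x3 + b y2 x3"
      have "presented_by twisted_rows"
      proof (rule presented_byI[OF basis])
        show "gram b y1 y2 y3 x1 x2 x3 \<in> twisted_rows" if "b \<in> B" for b
          using e[OF that] c[rule_format, OF that] by (simp add: gram_def twisted_rows_def)
        fix t assume "t \<in> twisted_rows"
        then obtain f g h where t: "t = [[0, f, g], [f + g + h, 0, h], [g, h, 0]]" by (auto simp: twisted_rows_def)
        obtain b where b: "b \<in> B" "b y1 x2 = f" "b y1 x3 = g" "b y2 x3 = h" using s by blast
        then have "gram b y1 y2 y3 x1 x2 x3 = t"
          using e[OF b(1)] c[rule_format, OF b(1)] by (simp add: gram_def t)
        then show "\<exists>b\<in>B. gram b y1 y2 y3 x1 x2 x3 = t" using b(1) by blast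
      qed
      then show ?thesis by blast
    qed
  qed
qed

end

section \<open>From primitive matrix spaces to bilinear forms\<close>

text \<open>A maximal independent set of columns has at most two elements and spans all columns.\<close>

lemma rank_le_two_factorization:
  fixes M :: "'a::field mat"
  assumes M: "M \<in> carrier_mat n p" and r: "vec_space.rank n M \<le> 2"
  shows "\<exists>f g f' g'. \<forall>i<n. \<forall>j<p. M $$ (i, j) = f i * g j + f' i * g' j"
proof -
  interpret vec_space "TYPE('a)" n .
  let ?C = "set (cols M)"
  have C: "?C \<subseteq> carrier_vec n" using M cols_dim by blast
  have "lin_indpt {}" by (meson empty_iff empty_subsetI finite.emptyI finite_lin_indpt2)
  then obtain U where U: "finite U" "maximal U (\<lambda>T. T \<subseteq> ?C \<and> lin_indpt T)"
    using maximal_exists_superset[of ?C "\<lambda>T. T \<subseteq> ?C \<and> lin_indpt T" "{}"] by auto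
  have UC: "U \<subseteq> ?C" "lin_indpt U" using U(2) by (auto simp: maximal_def)
  have UV: "U \<subseteq> carrier_vec n" using UC(1) C by blast
  have card: "card U \<le> 2" using rank_card_indpt[OF M U(2)] r by simp
  have span: "col M j \<in> span U" if j: "j < p" for j
  proof (rule ccontr)
    assume n: "col M j \<notin> span U"
    have c: "col M j \<in> ?C" using j M by (metis cols_length cols_nth carrier_matD(2) nth_mem)
    have "col M j \<in> carrier_vec n" using C c by blast
    have nU: "col M j \<notin> U" using n UV span_mem[of U "col M j"] by auto
    have "lin_indpt (U \<union> {col M j})"
      using lin_dep_iff_in_span[of U "col M j"] n UC(2) UV nU \<open>col M j \<in> carrier_vec n\<close> by simp
    moreover have "U \<subseteq> U \<union> {col M j}" "U \<union> {col M j} \<subseteq> ?C" using UC(1) c by auto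
    ultimately have "U \<union> {col M j} = U" using U(2) unfolding maximal_def by blast
    then show False using nU by blast
  qed
  have "\<exists>a. \<forall>i<n. M $$ (i, j) = (\<Sum>u\<in>U. a u * u $ i)" if j: "j < p" for j
  proof -
    obtain a A where a: "col M j = lincomb a A" "finite A" "A \<subseteq> U" using in_spanE[OF span[OF j]] by (elim exE conjE)
    have "M $$ (i, j) = (\<Sum>u\<in>U. (if u \<in> A then a u else 0) * u $ i)" if i: "i < n" for i
    proof -
      have "M $$ (i, j) = col M j $ i" using M i j by simp
      also have "\<dots> = (\<Sum>u\<in>A. a u * u $ i)"
        unfolding a(1) by (rule lincomb_index[OF i]) (use a(3) UV in blast)
      also have "\<dots> = (\<Sum>u\<in>U. (if u \<in> A then a u else 0) * u $ i)"
        by (rule sum.mono_neutral_cong_left) (use a U in auto)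
      finally show ?thesis .
    qed
    then show ?thesis by (intro exI[of _ "\<lambda>u. if u \<in> A then a u else 0"] allI impI)
  qed
  then obtain a where a: "\<And>i j. i < n \<Longrightarrow> j < p \<Longrightarrow> M $$ (i, j) = (\<Sum>u\<in>U. a j u * u $ i)" by metis
  consider "U = {}" | u where "U = {u}" | u v where "u \<noteq> v" "U = {u, v}"
  proof -
    have "card U = 0 \<or> card U = 1 \<or> card U = 2" using card by linarith
    then show ?thesis using that U(1) card_1_singletonE[of U] card_2_iff[of U] by auto
  qed
  then show ?thesis
  proof cases
    case 1
    then have "\<forall>i<n. \<forall>j<p. M $$ (i, j) = 0 * 0 + 0 * 0" using a by simp
    then show ?thesis by (intro exI)
  next
    case (2 u)
    then have "\<forall>i<n. \<forall>j<p. M $$ (i, j) = u $ i * a j u + 0 * 0" using a by simp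
    then show ?thesis by (intro exI)
  next
    case (3 u v)
    then have "\<forall>i<n. \<forall>j<p. M $$ (i, j) = u $ i * a j u + v $ i * a j v" using a by simp
    then show ?thesis by (intro exI)
  qed
qed

lemma rank_le_one_of_minors:
  fixes M :: "bit mat"
  assumes M: "M \<in> carrier_mat n p"
    and m: "\<And>i i' j j'. i < n \<Longrightarrow> i' < n \<Longrightarrow> j < p \<Longrightarrow> j' < p \<Longrightarrow>
      M $$ (i, j) * M $$ (i', j') = M $$ (i, j') * M $$ (i', j)"
  shows "vec_space.rank n M \<le> 1"
proof (cases "\<exists>k l. k < n \<and> l < p \<and> M $$ (k, l) = 1")
  case True
  then obtain k l where kl: "k < n" "l < p" "M $$ (k, l) = 1" by blast
  show ?thesis
  proof (rule vec_space.rank_le_1_product_entries[OF M])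
    fix i j assume "i < dim_row M" "j < dim_col M"
    then show "M $$ (i, j) = M $$ (i, l) * M $$ (k, j)" using m[of i k j l] kl M by simp
  qed
next
  case False
  then show ?thesis
    using M by (intro vec_space.rank_le_1_product_entries[OF M, where f = "\<lambda>_. 0" and g = "\<lambda>_. 0"]) auto
qed

lemma rank_le_one_without_rows:
  fixes M :: "'a::field mat"
  assumes "M \<in> carrier_mat 0 p"
  shows "vec_space.rank 0 M \<le> 1"
  using vec_space.rank_le_1_product_entries[OF assms, of undefined undefined] assms by auto

text \<open>Vectors are functions on all natural numbers, of which only the first \<open>n\<close> or \<open>p\<close> values matter; such
  functions form an abelian group without reference to a carrier.\<close>

definition bform :: "nat \<Rightarrow> nat \<Rightarrow> bit mat \<Rightarrow> (nat \<Rightarrow> bit) \<Rightarrow> (nat \<Rightarrow> bit) \<Rightarrow> bit" where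
  "bform n p M y x = (\<Sum>i<n. \<Sum>j<p. y i * M $$ (i, j) * x j)"

lemma bform_add_left: "bform n p M (y + y') x = bform n p M y x + bform n p M y' x"
  by (simp add: bform_def algebra_simps sum.distrib)

lemma bform_add_right: "bform n p M y (x + x') = bform n p M y x + bform n p M y x'"
  by (simp add: bform_def algebra_simps sum.distrib)

lemma bform_add_mat:
  "M \<in> carrier_mat n p \<Longrightarrow> N \<in> carrier_mat n p \<Longrightarrow> bform n p (M + N) = bform n p M + bform n p N"
  by (intro ext) (simp add: bform_def algebra_simps sum.distrib)

lemma bform_cong:
  assumes "\<And>i. i < n \<Longrightarrow> y i = y' i" "\<And>j. j < p \<Longrightarrow> x j = x' j"
  shows "bform n p M y x = bform n p M y' x'"
  unfolding bform_def using assms by (intro sum.cong) auto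

lemma bform_product:
  assumes "\<forall>i<n. \<forall>j<p. M $$ (i, j) = f i * g j + f' i * g' j"
  shows "bform n p M y x = (\<Sum>i<n. y i * f i) * (\<Sum>j<p. g j * x j) + (\<Sum>i<n. y i * f' i) * (\<Sum>j<p. g' j * x j)"
  by (simp add: bform_def assms sum_product algebra_simps sum.distrib)

text \<open>By the factorization, the Gram matrix is a product of a matrix with two columns and one with two rows.\<close>

lemma bform_det3:
  assumes "M \<in> carrier_mat n p" "vec_space.rank n M \<le> 2"
  shows "det3 (bform n p M y1 x1) (bform n p M y1 x2) (bform n p M y1 x3)
    (bform n p M y2 x1) (bform n p M y2 x2) (bform n p M y2 x3)
    (bform n p M y3 x1) (bform n p M y3 x2) (bform n p M y3 x3) = 0"
proof -
  obtain f g f' g' where "\<forall>i<n. \<forall>j<p. M $$ (i, j) = f i * g j + f' i * g' j"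
    using rank_le_two_factorization[OF assms] by blast
  note b = bform_product[OF this]
  have "det3 (a1 * c1 + b1 * d1) (a1 * c2 + b1 * d2) (a1 * c3 + b1 * d3)
      (a2 * c1 + b2 * d1) (a2 * c2 + b2 * d2) (a2 * c3 + b2 * d3)
      (a3 * c1 + b3 * d1) (a3 * c2 + b3 * d2) (a3 * c3 + b3 * d3) = 0"
    for a1 a2 a3 b1 b2 b3 c1 c2 c3 d1 d2 d3
    by (simp add: det3_def algebra_simps)
  then show ?thesis unfolding b by blast
qed

lemma triple_product_entry:
  assumes P: "P \<in> carrier_mat n' n" and M: "M \<in> carrier_mat n p" and Q: "Q \<in> carrier_mat p p'"
    and ij: "i < n'" "j < p'"
  shows "(P * M * Q) $$ (i, j) = bform n p M (\<lambda>k. P $$ (i, k)) (\<lambda>l. Q $$ (l, j))"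
proof -
  have "(P * M * Q) $$ (i, j) = (\<Sum>k<n. P $$ (i, k) * (\<Sum>l<p. M $$ (k, l) * Q $$ (l, j)))"
    using assms by (simp add: scalar_prod_def atLeast0LessThan)
  then show ?thesis by (simp add: bform_def sum_distrib_left mult.assoc)
qed

lemma invertible_matI:
  fixes A :: "'a::field mat"
  assumes "A \<in> carrier_mat n n" "B \<in> carrier_mat n n" "A * B = 1\<^sub>m n"
  shows "invertible_mat A"
  using mat_mult_left_right_inverse[OF assms] assms
  by (auto simp: invertible_mat_def inverts_mat_def)

lemma invertible_matE:
  fixes A :: "'a::field mat"
  assumes "A \<in> carrier_mat n n" "invertible_mat A"
  obtains B where "B \<in> carrier_mat n n" "A * B = 1\<^sub>m n" "B * A = 1\<^sub>m n" "invertible_mat B"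
proof -
  obtain B where B: "A * B = 1\<^sub>m n" "B * A = 1\<^sub>m (dim_row B)"
    using assms by (auto simp: invertible_mat_def inverts_mat_def)
  have "dim_col (A * B) = n" "dim_col (B * A) = dim_row B" using B by simp_all
  then have c: "B \<in> carrier_mat n n" using assms(1) by auto
  then show ?thesis using that[OF c B(1)] B(2) invertible_matI[OF c assms(1)] by simp
qed

lemma invertible_mat_transpose:
  fixes A :: "'a::field mat"
  assumes A: "A \<in> carrier_mat n n" "invertible_mat A"
  shows "invertible_mat A\<^sup>T"
proof -
  obtain B where B: "B \<in> carrier_mat n n" "B * A = 1\<^sub>m n" using invertible_matE[OF A] by metis
  have "A\<^sup>T * B\<^sup>T = (B * A)\<^sup>T" using A(1) B(1) by (simp add: transpose_mult)
  then show ?thesis using A(1) B by (intro invertible_matI[of _ n "B\<^sup>T"]) auto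
qed

lemma invertible_mat_mult:
  fixes A :: "'a::field mat"
  assumes A: "A \<in> carrier_mat n n" "invertible_mat A" and B: "B \<in> carrier_mat n n" "invertible_mat B"
  shows "invertible_mat (A * B)"
proof -
  obtain A' where A': "A' \<in> carrier_mat n n" "A * A' = 1\<^sub>m n" using invertible_matE[OF A] by metis
  obtain B' where B': "B' \<in> carrier_mat n n" "B * B' = 1\<^sub>m n" using invertible_matE[OF B] by metis
  have "(A * B) * (B' * A') = A * (B * B') * A'"
    using A(1) B(1) A'(1) B'(1) by (simp add: assoc_mult_mat[of _ n n _ n _ n])
  then have "(A * B) * (B' * A') = 1\<^sub>m n" using A(1) A' B' by simp
  then show ?thesis using A(1) B(1) A'(1) B'(1) by (intro invertible_matI[of _ n "B' * A'"]) auto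
qed

text \<open>The first \<open>p - 1\<close> columns of \<open>Q\<close> lie in the hyperplane \<open>\<xi> = 0\<close>. If \<open>\<xi> k = 1\<close>, they are the
  vectors \<open>e\<^sub>j + \<xi>\<^sub>j e\<^sub>k\<close> for \<open>j \<noteq> k\<close>, and the last column is \<open>e\<^sub>k\<close>.\<close>

lemma hyperplane_matrix:
  fixes \<xi> :: "nat \<Rightarrow> bit"
  assumes p: "0 < p"
  obtains Q where "Q \<in> carrier_mat p p" "invertible_mat Q" "\<And>j. j < p - 1 \<Longrightarrow> (\<Sum>i<p. \<xi> i * Q $$ (i, j)) = 0"
proof (cases "\<exists>k<p. \<xi> k = 1")
  case False
  show ?thesis
  proof (rule that[of "1\<^sub>m p"])
    show "(\<Sum>i<p. \<xi> i * (1\<^sub>m p :: bit mat) $$ (i, j)) = 0" for j using False by (simp add: sum.neutral)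
    show "invertible_mat (1\<^sub>m p :: bit mat)" by (rule invertible_matI[of _ p "1\<^sub>m p"]) auto
  qed simp
next
  case True
  then obtain k where k: "k < p" "\<xi> k = 1" by blast
  \<comment> \<open>Column \<open>j\<close> contains the unit vector with index \<open>\<sigma> j\<close>, and \<open>\<tau>\<close> is the inverse renumbering.\<close>
  define \<sigma> where "\<sigma> j = (if j = k then p - 1 else j)" for j
  define \<tau> where "\<tau> i = (if i = p - 1 then k else i)" for i
  let ?d = "\<lambda>i j. if i = j then 1 else (0::bit)"
  define Q where "Q = mat p p (\<lambda>(i, j). if j = p - 1 then ?d i k else ?d i (\<sigma> j) + ?d i k * \<xi> (\<sigma> j))"
  define R where "R = mat p p (\<lambda>(j, i). if i = k then ?d j (p - 1) else ?d j (\<tau> i) + ?d j (p - 1) * \<xi> i)"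
  have Q: "Q \<in> carrier_mat p p" and R: "R \<in> carrier_mat p p" by (auto simp: Q_def R_def)
  have "Q * R = 1\<^sub>m p"
  proof (rule eq_matI)
    fix i i' assume "i < dim_row (1\<^sub>m p :: bit mat)" "i' < dim_col (1\<^sub>m p :: bit mat)"
    then have i: "i < p" "i' < p" by auto
    have "(Q * R) $$ (i, i') = (\<Sum>l<p. Q $$ (i, l) * R $$ (l, i'))"
      using i Q R by (simp add: scalar_prod_def atLeast0LessThan)
    also have "\<dots> = (\<Sum>l<p. Q $$ (i, l) * (if i' = k then ?d l (p - 1) else ?d l (\<tau> i') + ?d l (p - 1) * \<xi> i'))"
      using i by (intro sum.cong) (auto simp: R_def)
    also have "\<dots> = (if i' = k then Q $$ (i, p - 1) else Q $$ (i, \<tau> i') + Q $$ (i, p - 1) * \<xi> i')"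
    proof -
      have "(\<Sum>l<p. Q $$ (i, l) * (?d l t * c)) = Q $$ (i, t) * c" if "t < p" for t c
        using that by (subst sum.remove[of _ t]) auto
      from this[of "p - 1" 1] this[of "\<tau> i'" 1] this[of "p - 1" "\<xi> i'"] show ?thesis
        using p k i by (auto simp: distrib_left sum.distrib \<tau>_def)
    qed
    also have "\<dots> = 1\<^sub>m p $$ (i, i')"
      using i k p by (auto simp: Q_def \<sigma>_def \<tau>_def)
    finally show "(Q * R) $$ (i, i') = 1\<^sub>m p $$ (i, i')" .
  qed (use Q R in auto)
  moreover have "(\<Sum>i<p. \<xi> i * Q $$ (i, j)) = 0" if j: "j < p - 1" for j
  proof -
    have s: "\<sigma> j < p" "\<sigma> j \<noteq> k" using j k by (auto simp: \<sigma>_def)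
    have "(\<Sum>i<p. \<xi> i * Q $$ (i, j)) = (\<Sum>i<p. \<xi> i * ?d i (\<sigma> j)) + (\<Sum>i<p. \<xi> i * (?d i k * \<xi> (\<sigma> j)))"
      using j unfolding sum.distrib[symmetric] by (intro sum.cong) (auto simp: Q_def distrib_left)
    also have "(\<Sum>i<p. \<xi> i * ?d i (\<sigma> j)) = \<xi> (\<sigma> j)"
      using s by (subst sum.remove[of _ "\<sigma> j"]) auto
    also have "(\<Sum>i<p. \<xi> i * (?d i k * \<xi> (\<sigma> j))) = \<xi> (\<sigma> j)"
      using k by (subst sum.remove[of _ k]) auto
    finally show ?thesis by simp
  qed
  ultimately show ?thesis using that[OF Q] invertible_matI[OF Q R] by blast
qed

lemma mat_subspaceD:
  fixes \<V> :: "'a::field mat set"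
  assumes "mat_subspace n p \<V>"
  shows "\<V> \<subseteq> carrier_mat n p" "0\<^sub>m n p \<in> \<V>" "M \<in> \<V> \<Longrightarrow> N \<in> \<V> \<Longrightarrow> M + N \<in> \<V>"
  using assms unfolding mat_subspace_def subspace_def submodule_def
  by (auto simp: module_mat_simps)

text \<open>Scalar multiples are automatic, since the only scalars are zero and one.\<close>

lemma mat_subspace_bitI:
  fixes \<V> :: "bit mat set"
  assumes c: "\<V> \<subseteq> carrier_mat n p" and z: "0\<^sub>m n p \<in> \<V>" and a: "\<And>M N. M \<in> \<V> \<Longrightarrow> N \<in> \<V> \<Longrightarrow> M + N \<in> \<V>"
  shows "mat_subspace n p \<V>"
proof -
  have s: "r \<cdot>\<^sub>m M \<in> \<V>" if "M \<in> \<V>" for r :: bit and M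
  proof (cases "r = 0")
    case True
    then have "r \<cdot>\<^sub>m M = 0\<^sub>m n p" using c that by (intro eq_matI) auto
    then show ?thesis using z by simp
  next
    case False
    then have "r \<cdot>\<^sub>m M = M" by (intro eq_matI) auto
    then show ?thesis using that by simp
  qed
  show ?thesis
    unfolding mat_subspace_def subspace_def submodule_def
    using matrix_vs[of n p, where 'a = bit] c z a s
    by (auto simp: module_mat_simps vectorspace_def)
qed

lemma mat_space_equiv_image:
  "P \<in> carrier_mat n n \<Longrightarrow> invertible_mat P \<Longrightarrow> Q \<in> carrier_mat p p \<Longrightarrow> invertible_mat Q \<Longrightarrow>
    mat_space_equiv n p \<V> ((\<lambda>M. P * M * Q) ` \<V>)"
  unfolding mat_space_equiv_def by blast

lemma mat_space_equiv_subspace: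
  fixes \<V> :: "bit mat set"
  assumes s: "mat_subspace n p \<V>" and e: "mat_space_equiv n p \<V> \<W>"
  shows "mat_subspace n p \<W>"
proof -
  obtain P Q where P: "P \<in> carrier_mat n n" and Q: "Q \<in> carrier_mat p p" and W: "\<W> = (\<lambda>M. P * M * Q) ` \<V>"
    using e unfolding mat_space_equiv_def by blast
  note c = mat_subspaceD(1)[OF s]
  show ?thesis
  proof (rule mat_subspace_bitI)
    show "\<W> \<subseteq> carrier_mat n p" using c P Q W by auto
    have "0\<^sub>m n p = P * 0\<^sub>m n p * Q" using P Q by simp
    then show "0\<^sub>m n p \<in> \<W>" unfolding W by (rule image_eqI) (rule mat_subspaceD(2)[OF s])
    fix M N assume "M \<in> \<W>" "N \<in> \<W>"
    then obtain M' N' where M: "M' \<in> \<V>" "M = P * M' * Q" and N: "N' \<in> \<V>" "N = P * N' * Q" using W by blast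
    have "M' \<in> carrier_mat n p" "N' \<in> carrier_mat n p" using M N c by auto
    then have "M + N = P * (M' + N') * Q"
      using P Q by (simp add: M N mult_add_distrib_mat[of _ n n _ p] add_mult_distrib_mat[of _ n p _ _ p])
    then show "M + N \<in> \<W>" unfolding W by (rule image_eqI) (rule mat_subspaceD(3)[OF s M(1) N(1)])
  qed
qed

lemma mat_space_equiv_sym:
  fixes \<V> :: "'a::field mat set"
  assumes c: "\<V> \<subseteq> carrier_mat n p" and e: "mat_space_equiv n p \<V> \<W>"
  shows "mat_space_equiv n p \<W> \<V>"
proof -
  obtain P Q where P: "P \<in> carrier_mat n n" "invertible_mat P" and Q: "Q \<in> carrier_mat p p" "invertible_mat Q"
    and W: "\<W> = (\<lambda>M. P * M * Q) ` \<V>" using e unfolding mat_space_equiv_def by blast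
  obtain P' where P': "P' \<in> carrier_mat n n" "P' * P = 1\<^sub>m n" "invertible_mat P'" using invertible_matE[OF P] by metis
  obtain Q' where Q': "Q' \<in> carrier_mat p p" "Q * Q' = 1\<^sub>m p" "invertible_mat Q'" using invertible_matE[OF Q] by metis
  have "P' * (P * M * Q) * Q' = M" if M: "M \<in> \<V>" for M
  proof -
    have Mc: "M \<in> carrier_mat n p" using M c by blast
    have "P' * (P * M * Q) * Q' = (P' * P) * M * (Q * Q')"
      using P(1) Q(1) P'(1) Q'(1) Mc by (simp add: assoc_mult_mat[of _ n n _ n _ p] assoc_mult_mat[of _ n n _ p _ p] assoc_mult_mat[of _ n p _ p _ p])
    then show ?thesis using P'(2) Q'(2) Mc by simp
  qed
  then have "(\<lambda>N. P' * N * Q') ` \<W> = \<V>" unfolding W by (force simp: image_image)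
  then show ?thesis unfolding mat_space_equiv_def using P' Q' by metis
qed

lemma mat_space_equiv_trans:
  fixes \<V> :: "'a::field mat set"
  assumes c: "\<V> \<subseteq> carrier_mat n p" and e: "mat_space_equiv n p \<V> \<W>" and e': "mat_space_equiv n p \<W> \<X>"
  shows "mat_space_equiv n p \<V> \<X>"
proof -
  obtain P Q where P: "P \<in> carrier_mat n n" "invertible_mat P" and Q: "Q \<in> carrier_mat p p" "invertible_mat Q"
    and W: "\<W> = (\<lambda>M. P * M * Q) ` \<V>" using e unfolding mat_space_equiv_def by blast
  obtain R S where R: "R \<in> carrier_mat n n" "invertible_mat R" and S: "S \<in> carrier_mat p p" "invertible_mat S"
    and X: "\<X> = (\<lambda>M. R * M * S) ` \<W>" using e' unfolding mat_space_equiv_def by blast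
  have "R * (P * M * Q) * S = (R * P) * M * (Q * S)" if "M \<in> \<V>" for M
    using that c P(1) Q(1) R(1) S(1)
    by (auto simp: assoc_mult_mat[of _ n n _ n _ p] assoc_mult_mat[of _ n n _ p _ p] assoc_mult_mat[of _ n p _ p _ p] dest!: subsetD)
  then have "\<X> = (\<lambda>M. (R * P) * M * (Q * S)) ` \<V>" unfolding X W image_image by (rule image_cong[OF refl])
  moreover have "R * P \<in> carrier_mat n n" "Q * S \<in> carrier_mat p p" using P Q R S by auto
  moreover have "invertible_mat (R * P)" "invertible_mat (Q * S)"
    using invertible_mat_mult[OF R P] invertible_mat_mult[OF Q S] by auto
  ultimately show ?thesis unfolding mat_space_equiv_def by blast
qed

lemma urk_bounds:
  fixes \<V> :: "'a::field mat set"
  assumes "\<V> \<subseteq> carrier_mat n p" "\<V> \<noteq> {}"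
  shows "M \<in> \<V> \<Longrightarrow> vec_space.rank n M \<le> urk n \<V>" "\<exists>M\<in>\<V>. vec_space.rank n M = urk n \<V>"
proof -
  have "vec_space.rank n M \<le> p" if "M \<in> \<V>" for M
    using vec_space.rank_le_nc[of M n p] assms(1) that by blast
  then have "vec_space.rank n ` \<V> \<subseteq> {..p}" by auto
  then have fin: "finite (vec_space.rank n ` \<V>)" using finite_subset by blast
  show "M \<in> \<V> \<Longrightarrow> vec_space.rank n M \<le> urk n \<V>"
    unfolding urk_def by (intro Max_ge fin) simp
  show "\<exists>M\<in>\<V>. vec_space.rank n M = urk n \<V>"
    using Max_in[OF fin] assms(2) unfolding urk_def by (metis imageE image_is_empty)
qed

lemma urk_le_one_of_minors:
  fixes \<V> :: "bit mat set"
  assumes "\<V> \<subseteq> carrier_mat n p" "\<V> \<noteq> {}"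
    and m: "\<And>M i i' j j'. M \<in> \<V> \<Longrightarrow> i < n \<Longrightarrow> i' < n \<Longrightarrow> j < p \<Longrightarrow> j' < p \<Longrightarrow>
      M $$ (i, j) * M $$ (i', j') = M $$ (i, j') * M $$ (i', j)"
  shows "urk n \<V> \<le> 1"
proof -
  obtain M where M: "M \<in> \<V>" "vec_space.rank n M = urk n \<V>" using urk_bounds(2)[OF assms(1,2)] by blast
  have "vec_space.rank n M \<le> 1" using M(1) assms(1) m by (intro rank_le_one_of_minors) auto
  then show ?thesis using M(2) by simp
qed

locale primitive_space =
  fixes n p :: nat and \<V> :: "bit mat set"
  assumes primitive: "primitive n p \<V>" and urk: "urk n \<V> = 2"
begin

lemma subspace: "mat_subspace n p \<V>" using primitive by (simp add: primitive_def)

lemmas carrier = mat_subspaceD(1)[OF subspace] and zero_mem = mat_subspaceD(2)[OF subspace]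
  and sum_mem = mat_subspaceD(3)[OF subspace]

lemma space_nonempty: "\<V> \<noteq> {}" using zero_mem by blast

lemma rank_le_two: "M \<in> \<V> \<Longrightarrow> vec_space.rank n M \<le> 2"
  using urk_bounds(1)[OF carrier space_nonempty] urk by simp

lemma positive: "0 < n" "0 < p"
proof -
  obtain M where M: "M \<in> \<V>" "vec_space.rank n M = 2" using urk_bounds(2)[OF carrier space_nonempty] urk by auto
  have c: "M \<in> carrier_mat n p" using M(1) carrier by blast
  have "vec_space.rank n M \<le> p" using vec_space.rank_le_nc[OF c] .
  then show "0 < p" using M(2) by simp
  show "0 < n" using rank_le_one_without_rows[of M p] c M(2) by (cases n) auto
qed

lemma no_thin_columns:
  assumes "P \<in> carrier_mat n n" "invertible_mat P" "Q \<in> carrier_mat p p" "invertible_mat Q"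
  shows "\<not> urk n (drop_last_col ` (\<lambda>M. P * M * Q) ` \<V>) \<le> 1"
  using primitive positive(2) mat_space_equiv_image[OF assms, of \<V>] urk unfolding primitive_def by auto

lemma no_thin_rows:
  assumes "P \<in> carrier_mat n n" "invertible_mat P" "Q \<in> carrier_mat p p" "invertible_mat Q"
  shows "\<not> urk (n - 1) (drop_last_row ` (\<lambda>M. P * M * Q) ` \<V>) \<le> 1"
  using primitive positive(1) mat_space_equiv_image[OF assms, of \<V>] urk unfolding primitive_def by auto

lemma one_invertible: "invertible_mat (1\<^sub>m k :: bit mat)"
  by (rule invertible_matI[of _ k "1\<^sub>m k"]) auto

text \<open>If all minors of order two vanished on the hyperplane \<open>\<xi> = 0\<close>, then after multiplication by the matrix of
  \<open>hyperplane_matrix\<close> the deletion of the last column would leave rank at most one.\<close>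

lemma column_minor:
  fixes \<xi> :: "nat \<Rightarrow> bit"
  shows "\<exists>M\<in>\<V>. \<exists>y y' x x'. (\<Sum>j<p. \<xi> j * x j) = 0 \<and> (\<Sum>j<p. \<xi> j * x' j) = 0 \<and>
    bform n p M y x * bform n p M y' x' + bform n p M y x' * bform n p M y' x = 1"
proof (rule ccontr)
  assume neg: "\<not> ?thesis"
  have van: "bform n p M y x * bform n p M y' x' = bform n p M y x' * bform n p M y' x"
    if "M \<in> \<V>" "(\<Sum>j<p. \<xi> j * x j) = 0" "(\<Sum>j<p. \<xi> j * x' j) = 0" for M y y' x x'
  proof (rule ccontr)
    assume "\<not> ?thesis"
    then have "bform n p M y x * bform n p M y' x' + bform n p M y x' * bform n p M y' x = 1"
      by (rule bit_add_of_neq)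
    then show False using neg that by blast
  qed
  obtain Q where Q: "Q \<in> carrier_mat p p" "invertible_mat Q" "\<And>j. j < p - 1 \<Longrightarrow> (\<Sum>i<p. \<xi> i * Q $$ (i, j)) = 0"
    using hyperplane_matrix[OF positive(2)] by blast
  have "urk n (drop_last_col ` (\<lambda>M. 1\<^sub>m n * M * Q) ` \<V>) \<le> 1"
  proof (rule urk_le_one_of_minors)
    show "drop_last_col ` (\<lambda>M. 1\<^sub>m n * M * Q) ` \<V> \<subseteq> carrier_mat n (p - 1)"
      using carrier Q(1) by (auto simp: drop_last_col_def)
    show "drop_last_col ` (\<lambda>M. 1\<^sub>m n * M * Q) ` \<V> \<noteq> {}" using space_nonempty by simp
    fix N i i' j j' assume N: "N \<in> drop_last_col ` (\<lambda>M. 1\<^sub>m n * M * Q) ` \<V>"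
      and ij: "i < n" "i' < n" "j < p - 1" "j' < p - 1"
    then obtain M where M: "M \<in> \<V>" "N = drop_last_col (1\<^sub>m n * M * Q)" by auto
    have Mc: "M \<in> carrier_mat n p" using M(1) carrier by blast
    have e: "N $$ (k, l) = bform n p M (\<lambda>i. 1\<^sub>m n $$ (k, i)) (\<lambda>i. Q $$ (i, l))" if "k < n" "l < p - 1" for k l
      using triple_product_entry[OF one_carrier_mat Mc Q(1), of k l] that Mc Q(1)
      unfolding M(2) drop_last_col_def by auto
    show "N $$ (i, j) * N $$ (i', j') = N $$ (i, j') * N $$ (i', j)"
      using van[OF M(1) Q(3)[OF ij(3)] Q(3)[OF ij(4)]] ij by (simp add: e)
  qed
  then show False using no_thin_columns[OF one_carrier_mat one_invertible Q(1,2)] by simp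
qed

lemma row_minor:
  fixes \<xi> :: "nat \<Rightarrow> bit"
  shows "\<exists>M\<in>\<V>. \<exists>y y' x x'. (\<Sum>i<n. \<xi> i * y i) = 0 \<and> (\<Sum>i<n. \<xi> i * y' i) = 0 \<and>
    bform n p M y x * bform n p M y' x' + bform n p M y x' * bform n p M y' x = 1"
proof (rule ccontr)
  assume neg: "\<not> ?thesis"
  have van: "bform n p M y x * bform n p M y' x' = bform n p M y x' * bform n p M y' x"
    if "M \<in> \<V>" "(\<Sum>i<n. \<xi> i * y i) = 0" "(\<Sum>i<n. \<xi> i * y' i) = 0" for M y y' x x'
  proof (rule ccontr)
    assume "\<not> ?thesis"
    then have "bform n p M y x * bform n p M y' x' + bform n p M y x' * bform n p M y' x = 1"
      by (rule bit_add_of_neq)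
    then show False using neg that by blast
  qed
  obtain Q where Q: "Q \<in> carrier_mat n n" "invertible_mat Q" "\<And>j. j < n - 1 \<Longrightarrow> (\<Sum>i<n. \<xi> i * Q $$ (i, j)) = 0"
    using hyperplane_matrix[OF positive(1)] by blast
  define P where "P = Q\<^sup>T"
  have P: "P \<in> carrier_mat n n" using Q(1) by (simp add: P_def)
  have invP: "invertible_mat P" unfolding P_def by (rule invertible_mat_transpose[OF Q(1,2)])
  have "urk (n - 1) (drop_last_row ` (\<lambda>M. P * M * 1\<^sub>m p) ` \<V>) \<le> 1"
  proof (rule urk_le_one_of_minors)
    show "drop_last_row ` (\<lambda>M. P * M * 1\<^sub>m p) ` \<V> \<subseteq> carrier_mat (n - 1) p"
      using carrier P by (auto simp: drop_last_row_def)
    show "drop_last_row ` (\<lambda>M. P * M * 1\<^sub>m p) ` \<V> \<noteq> {}" using space_nonempty by simp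
    fix N i i' j j' assume N: "N \<in> drop_last_row ` (\<lambda>M. P * M * 1\<^sub>m p) ` \<V>"
      and ij: "i < n - 1" "i' < n - 1" "j < p" "j' < p"
    then obtain M where M: "M \<in> \<V>" "N = drop_last_row (P * M * 1\<^sub>m p)" by auto
    have Mc: "M \<in> carrier_mat n p" using M(1) carrier by blast
    have e: "N $$ (k, l) = bform n p M (\<lambda>i. P $$ (k, i)) (\<lambda>i. 1\<^sub>m p $$ (i, l))" if "k < n - 1" "l < p" for k l
      using triple_product_entry[OF P Mc one_carrier_mat, of k l] that Mc P
      unfolding M(2) drop_last_row_def by auto
    have z: "(\<Sum>i<n. \<xi> i * P $$ (k, i)) = 0" if "k < n - 1" for k
      using Q(3)[OF that] Q(1) that by (simp add: P_def)
    show "N $$ (i, j) * N $$ (i', j') = N $$ (i, j') * N $$ (i', j)"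
      using van[OF M(1) z[OF ij(1)] z[OF ij(2)]] ij by (simp add: e)
  qed
  then show False using no_thin_rows[OF P invP one_carrier_mat one_invertible] by simp
qed

definition forms where "forms = bform n p ` \<V>"

lemma form_space: "form_space forms"
proof
  show "forms \<noteq> {}" using space_nonempty by (simp add: forms_def)
  show "add_closed forms"
    unfolding add_closed_def forms_def ball_simps
  proof (intro ballI)
    fix M N assume "M \<in> \<V>" "N \<in> \<V>"
    then have "M \<in> carrier_mat n p" "N \<in> carrier_mat n p" "M + N \<in> \<V>" using carrier sum_mem by auto
    then have "bform n p M + bform n p N = bform n p (M + N)" "M + N \<in> \<V>"
      using bform_add_mat[of M n p N] by auto
    then show "bform n p M + bform n p N \<in> bform n p ` \<V>" by simp
  qed
next
  fix a y assume "a \<in> forms"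
  then obtain N where N: "N \<in> \<V>" "a = bform n p N" by (auto simp: forms_def)
  have "a y x = (\<Sum>j<p. (\<Sum>i<n. y i * N $$ (i, j)) * x j)" for x
    unfolding N(2) bform_def by (subst sum.swap) (simp add: sum_distrib_right)
  then show "\<exists>b\<in>forms. \<exists>y1 y2 x1 x2. a y x1 = 0 \<and> a y x2 = 0 \<and> b y1 x1 * b y2 x2 + b y1 x2 * b y2 x1 = 1"
    using column_minor[of "\<lambda>j. \<Sum>i<n. y i * N $$ (i, j)"] unfolding forms_def by auto
next
  fix a x assume "a \<in> forms"
  then obtain N where N: "N \<in> \<V>" "a = bform n p N" by (auto simp: forms_def)
  have "a y x = (\<Sum>i<n. (\<Sum>j<p. N $$ (i, j) * x j) * y i)" for y
    unfolding N(2) bform_def by (simp add: sum_distrib_left sum_distrib_right ac_simps)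
  then show "\<exists>b\<in>forms. \<exists>y1 y2 x1 x2. a y1 x = 0 \<and> a y2 x = 0 \<and> b y1 x1 * b y2 x2 + b y1 x2 * b y2 x1 = 1"
    using row_minor[of "\<lambda>i. \<Sum>j<p. N $$ (i, j) * x j"] unfolding forms_def by auto
next
  fix b y1 x1 x2 x3 y2 y3 assume "b \<in> forms"
  then obtain M where "M \<in> \<V>" "b = bform n p M" by (auto simp: forms_def)
  then show "det3 (b y1 x1) (b y1 x2) (b y1 x3) (b y2 x1) (b y2 x2) (b y2 x3) (b y3 x1) (b y3 x2) (b y3 x3) = 0"
    using bform_det3 carrier rank_le_two by blast
qed (auto simp: forms_def bform_add_left bform_add_right)

sublocale form_space forms by (rule form_space)

lemma form_mem: "M \<in> \<V> \<Longrightarrow> bform n p M \<in> forms"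
  by (simp add: forms_def)

lemma radical_right_zero:
  assumes "radical_right x" "j < p"
  shows "x j = 0"
proof -
  have "M *\<^sub>v vec p x = 0\<^sub>v n" if M: "M \<in> \<V>" for M
  proof (rule eq_vecI)
    have Mc: "M \<in> carrier_mat n p" using M carrier by blast
    then show "dim_vec (M *\<^sub>v vec p x) = dim_vec (0\<^sub>v n)" by simp
    fix i assume "i < dim_vec (0\<^sub>v n :: bit vec)"
    then have i: "i < n" by simp
    have "bform n p M (\<lambda>k. if k = i then 1 else 0) x = 0"
      using assms(1) form_mem[OF M] unfolding radical_right_def by blast
    also have "bform n p M (\<lambda>k. if k = i then 1 else 0) x = (\<Sum>j<p. M $$ (i, j) * x j)"
      unfolding bform_def using i by (subst sum.remove[of _ i]) (auto intro: sum.neutral)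
    also have "\<dots> = (M *\<^sub>v vec p x) $ i"
      using Mc i by (simp add: scalar_prod_def atLeast0LessThan)
    finally show "(M *\<^sub>v vec p x) $ i = 0\<^sub>v n $ i" using i by simp
  qed
  then have "\<forall>M\<in>\<V>. vec p x \<in> mat_kernel M"
    using carrier by (auto intro!: mat_kernelI)
  then have "vec p x = 0\<^sub>v p"
    using primitive unfolding primitive_def by auto
  then show ?thesis using assms(2) by (metis index_vec index_zero_vec(1))
qed

text \<open>A vector orthogonal to the ranges of all matrices is orthogonal to their span, which is everything.\<close>

lemma radical_left_zero:
  assumes "radical_left y" "k < n"
  shows "y k = 0"
proof -
  interpret vs: vec_space "TYPE(bit)" n .
  let ?S = "\<Union>M\<in>\<V>. (\<lambda>x. M *\<^sub>v x) ` carrier_vec p"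
  have S: "?S \<subseteq> carrier_vec n" using carrier by auto
  have z: "(\<Sum>i<n. y i * v $ i) = 0" if v: "v \<in> ?S" for v
  proof -
    obtain M x where M: "M \<in> \<V>" "x \<in> carrier_vec p" "v = M *\<^sub>v x" using v by auto
    have Mc: "M \<in> carrier_mat n p" using M carrier by blast
    have "(\<Sum>i<n. y i * v $ i) = bform n p M y (\<lambda>j. x $ j)"
      using Mc M(2) unfolding bform_def M(3)
      by (intro sum.cong) (auto simp: scalar_prod_def atLeast0LessThan sum_distrib_left mult.assoc)
    then show ?thesis using assms(1) form_mem[OF M(1)] unfolding radical_left_def by simp
  qed
  have "unit_vec n k \<in> vs.span ?S"
    using primitive unfolding primitive_def by (metis unit_vec_carrier)
  then obtain a A where a: "unit_vec n k = vs.lincomb a A" "finite A" "A \<subseteq> ?S"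
    using vs.in_spanE by blast
  have "y k = (\<Sum>i<n. y i * unit_vec n k $ i)"
    using assms(2) by (subst sum.remove[of _ k]) (auto intro: sum.neutral)
  also have "\<dots> = (\<Sum>i<n. y i * (\<Sum>v\<in>A. a v * v $ i))"
    unfolding a(1) using a(3) S by (intro sum.cong) (auto simp: vs.lincomb_index)
  also have "\<dots> = (\<Sum>v\<in>A. a v * (\<Sum>i<n. y i * v $ i))"
    unfolding sum_distrib_left by (subst sum.swap) (simp add: ac_simps)
  also have "\<dots> = 0"
  proof (intro sum.neutral ballI)
    fix v assume "v \<in> A"
    then have "v \<in> ?S" using a(3) by blast
    from z[OF this] show "a v * (\<Sum>i<n. y i * v $ i) = 0" by simp
  qed
  finally show ?thesis .
qed

end

section \<open>Matrices of order three\<close>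

definition mat33 :: "'a \<Rightarrow> 'a \<Rightarrow> 'a \<Rightarrow> 'a \<Rightarrow> 'a \<Rightarrow> 'a \<Rightarrow> 'a \<Rightarrow> 'a \<Rightarrow> 'a \<Rightarrow> 'a mat" where
  "mat33 a b c d e f g h i = mat_of_rows_list 3 [[a, b, c], [d, e, f], [g, h, i]]"

lemma mat33_carrier [simp]: "mat33 a b c d e f g h i \<in> carrier_mat 3 3"
  by (intro carrier_matI) (simp_all add: mat33_def mat_of_rows_list_def)

lemma mat33_dim [simp]: "dim_row (mat33 a b c d e f g h i) = 3" "dim_col (mat33 a b c d e f g h i) = 3"
  by (simp_all add: mat33_def mat_of_rows_list_def)

lemma mat33_index [simp]:
  "mat33 a b c d e f g h i $$ (0, 0) = a" "mat33 a b c d e f g h i $$ (0, Suc 0) = b" "mat33 a b c d e f g h i $$ (0, 2) = c"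
  "mat33 a b c d e f g h i $$ (Suc 0, 0) = d" "mat33 a b c d e f g h i $$ (Suc 0, Suc 0) = e" "mat33 a b c d e f g h i $$ (Suc 0, 2) = f"
  "mat33 a b c d e f g h i $$ (2, 0) = g" "mat33 a b c d e f g h i $$ (2, Suc 0) = h" "mat33 a b c d e f g h i $$ (2, 2) = i"
  by (simp_all add: mat33_def mat_of_rows_list_def numeral_2_eq_2)

lemma all_less_3: "(\<forall>i<3. P i) \<longleftrightarrow> P 0 \<and> P (Suc 0) \<and> P (2::nat)"
  by (auto simp: numeral_3_eq_3 numeral_2_eq_2 less_Suc_eq)

lemma sum_lessThan_3: "(\<Sum>i<3. f i) = f 0 + f (Suc 0) + f (2::nat)"
  by (simp add: numeral_3_eq_3 numeral_2_eq_2)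

lemma mat33_eqI:
  assumes "M \<in> carrier_mat 3 3" "N \<in> carrier_mat 3 3" "\<forall>i<3. \<forall>j<3. M $$ (i, j) = N $$ (i, j)"
  shows "M = N"
  using assms by (intro eq_matI) auto

lemma mat33_collapse:
  assumes "M \<in> carrier_mat 3 3"
  shows "M = mat33 (M $$ (0, 0)) (M $$ (0, Suc 0)) (M $$ (0, 2)) (M $$ (Suc 0, 0)) (M $$ (Suc 0, Suc 0)) (M $$ (Suc 0, 2))
     (M $$ (2, 0)) (M $$ (2, Suc 0)) (M $$ (2, 2))"
  using assms by (intro mat33_eqI) (auto simp: all_less_3)

lemma mat33_mult:
  fixes a :: "'a::comm_semiring_0"
  shows "mat33 a b c d e f g h i * mat33 a' b' c' d' e' f' g' h' i' =
    mat33 (a * a' + b * d' + c * g') (a * b' + b * e' + c * h') (a * c' + b * f' + c * i')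
          (d * a' + e * d' + f * g') (d * b' + e * e' + f * h') (d * c' + e * f' + f * i')
          (g * a' + h * d' + i * g') (g * b' + h * e' + i * h') (g * c' + h * f' + i * i')"
  by (intro mat33_eqI mult_carrier_mat[of _ 3 3] mat33_carrier)
    (simp_all add: all_less_3 scalar_prod_def atLeast0LessThan sum_lessThan_3)

lemma mat33_one: "1\<^sub>m 3 = mat33 1 0 0 0 1 0 0 0 1"
  by (intro mat33_eqI) (auto simp: all_less_3)

lemma mat33_transpose: "(mat33 a b c d e f g h i)\<^sup>T = mat33 a d g b e h c f i"
  by (intro mat33_eqI) (auto simp: all_less_3)

lemma mat33_eq_iff:
  "mat33 a b c d e f g h i = mat33 a' b' c' d' e' f' g' h' i' \<longleftrightarrow>
    a = a' \<and> b = b' \<and> c = c' \<and> d = d' \<and> e = e' \<and> f = f' \<and> g = g' \<and> h = h' \<and> i = i'"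
  by (metis mat33_index)

lemma J3_mat33: "J3 = {mat33 a c d 0 (a + b) e 0 0 b | a b c d e. True}"
  by (simp add: J3_def mat33_def)

lemma U3_mat33: "U3 = {mat33 0 a (a + c) a 0 b (a + b) c 0 | a b c. True}"
  by (simp add: U3_def mat33_def)

lemma V3_mat33: "V3 = {mat33 0 a (c + d) c 0 b (a + b) d 0 | a b c d. True}"
  by (simp add: V3_def mat33_def)

lemma alternating_mat33: "(alternating_mats 3 :: bit mat set) = {mat33 0 f g f 0 h g h 0 | f g h. True}" (is "_ = ?A")
proof
  show "alternating_mats 3 \<subseteq> ?A"
  proof
    fix M :: "bit mat" assume "M \<in> alternating_mats 3"
    then have M: "M \<in> carrier_mat 3 3" "M\<^sup>T = - M" "\<forall>i<3. M $$ (i, i) = 0" by (auto simp: alternating_mats_def)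
    have s: "M $$ (j, i) = M $$ (i, j)" if "i < 3" "j < 3" for i j
    proof -
      have "M $$ (j, i) = M\<^sup>T $$ (i, j)" using M(1) that by simp
      also have "\<dots> = M $$ (i, j)" unfolding M(2) using M(1) that by simp
      finally show ?thesis .
    qed
    have "M = mat33 0 (M $$ (0, Suc 0)) (M $$ (0, 2)) (M $$ (0, Suc 0)) 0 (M $$ (Suc 0, 2)) (M $$ (0, 2)) (M $$ (Suc 0, 2)) 0"
      using mat33_collapse[OF M(1)] M(3) s[of 0 "Suc 0"] s[of 0 2] s[of "Suc 0" 2] by (simp add: all_less_3)
    then show "M \<in> ?A" by blast
  qed
  have "- mat33 0 f g f 0 h g h 0 = mat33 0 f g f 0 h g h 0" for f g h :: bit
    by (rule mat33_eqI) (simp_all add: all_less_3)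
  then have "mat33 0 f g f 0 h g h 0 \<in> alternating_mats 3" for f g h :: bit
    unfolding alternating_mats_def mat33_transpose mem_Collect_eq by (simp add: all_less_3)
  then show "?A \<subseteq> alternating_mats 3" by auto
qed

lemma carrier_alternating: "alternating_mats 3 \<subseteq> carrier_mat 3 3" by (auto simp: alternating_mats_def)

lemma carrier_U3: "U3 \<subseteq> carrier_mat 3 3" by (auto simp: U3_mat33)

lemma carrier_V3: "V3 \<subseteq> carrier_mat 3 3" by (auto simp: V3_mat33)

lemma equivI:
  fixes P :: "bit mat"
  assumes "P \<in> carrier_mat 3 3" "P' \<in> carrier_mat 3 3" "P * P' = 1\<^sub>m 3"
    and "Q \<in> carrier_mat 3 3" "Q' \<in> carrier_mat 3 3" "Q * Q' = 1\<^sub>m 3"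
    and "\<And>M. M \<in> \<V> \<Longrightarrow> P * M * Q \<in> \<W>" and "\<And>N. N \<in> \<W> \<Longrightarrow> \<exists>M\<in>\<V>. N = P * M * Q"
  shows "mat_space_equiv 3 3 \<V> \<W>"
  unfolding mat_space_equiv_def
  using assms(1,4) invertible_matI[OF assms(1-3)] invertible_matI[OF assms(4-6)] assms(7,8) by blast

text \<open>The diagonals of \<open>U3\<close> and \<open>V3\<close> vanish, so in an equivalence \<open>P M Q\<close> the \<open>i\<close>-th row of \<open>P\<close> must be orthogonal to
  the image of the \<open>i\<close>-th column of \<open>Q\<close> under the whole space. The matrices \<open>P\<close> and \<open>Q\<close> in this lemma and the
  next three consist of independent pairs of this kind, suitably ordered.\<close>

lemma twisted_rows_equiv_U3: "mat_space_equiv 3 3 (mat_of_rows_list 3 ` twisted_rows) U3"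
proof (rule equivI)
  let ?P = "mat33 0 1 0 0 1 1 1 0 0 :: bit mat" and ?Q = "mat33 0 0 1 1 1 0 0 1 0 :: bit mat"
  show "?P * mat33 0 0 1 1 0 0 1 1 0 = 1\<^sub>m 3" "?Q * mat33 0 1 1 0 0 1 1 0 0 = 1\<^sub>m 3"
    by (simp_all add: mat33_mult mat33_one)
  show "?P * M * ?Q \<in> U3" if mem: "M \<in> mat_of_rows_list 3 ` twisted_rows" for M
  proof -
    obtain f g h where M: "M = mat33 0 f g (f + g + h) 0 h g h 0"
      using mem by (auto simp: twisted_rows_def mat33_def)
    have "?P * M * ?Q = mat33 0 h (h + (f + g)) h 0 ((f + h)) (h + (f + h)) ((f + g)) 0"
      unfolding M mat33_mult by (simp add: ac_simps)
    then show ?thesis unfolding U3_mat33 by blast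
  qed
  show "\<exists>M\<in>mat_of_rows_list 3 ` twisted_rows. N = ?P * M * ?Q" if mem: "N \<in> U3" for N
  proof -
    obtain a b c where N: "N = mat33 0 a (a + c) a 0 b (a + b) c 0" using mem by (auto simp: U3_mat33)
    let ?M = "mat33 0 ((a + b)) ((a + b + c)) ((a + b) + (a + b + c) + a) 0 a ((a + b + c)) a 0"
    have "?M \<in> mat_of_rows_list 3 ` twisted_rows" by (auto simp: twisted_rows_def mat33_def)
    moreover have "N = ?P * ?M * ?Q" unfolding N mat33_mult by (simp add: ac_simps)
    ultimately show ?thesis by blast
  qed
qed simp_all

lemma constant_rows_equiv_U3: "mat_space_equiv 3 3 (mat_of_rows_list 3 ` constant_rows) U3"
proof (rule equivI)
  let ?P = "mat33 0 0 1 1 1 0 0 1 0 :: bit mat" and ?Q = "mat33 1 0 1 1 0 0 0 1 1 :: bit mat"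
  show "?P * mat33 0 1 1 0 0 1 1 0 0 = 1\<^sub>m 3" "?Q * mat33 0 1 0 1 1 1 1 1 0 = 1\<^sub>m 3"
    by (simp_all add: mat33_mult mat33_one)
  show "?P * M * ?Q \<in> U3" if mem: "M \<in> mat_of_rows_list 3 ` constant_rows" for M
  proof -
    obtain p q f where M: "M = mat33 p f f f q f f f (p + q)"
      using mem by (auto simp: constant_rows_def mat33_def)
    have "?P * M * ?Q = mat33 0 ((p + q)) ((p + q) + f) ((p + q)) 0 ((p + f)) ((p + q) + (p + f)) f 0"
      unfolding M mat33_mult by (simp add: ac_simps)
    then show ?thesis unfolding U3_mat33 by blast
  qed
  show "\<exists>M\<in>mat_of_rows_list 3 ` constant_rows. N = ?P * M * ?Q" if mem: "N \<in> U3" for N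
  proof -
    obtain a b c where N: "N = mat33 0 a (a + c) a 0 b (a + b) c 0" using mem by (auto simp: U3_mat33)
    let ?M = "mat33 ((b + c)) c c c ((a + b + c)) c c c ((b + c) + (a + b + c))"
    have "?M \<in> mat_of_rows_list 3 ` constant_rows" by (auto simp: constant_rows_def mat33_def)
    moreover have "N = ?P * ?M * ?Q" unfolding N mat33_mult by (simp add: ac_simps)
    ultimately show ?thesis by blast
  qed
qed simp_all

lemma cyclic_rows_equiv_V3: "mat_space_equiv 3 3 (mat_of_rows_list 3 ` cyclic_rows) V3"
proof (rule equivI)
  let ?P = "mat33 0 0 1 0 1 0 1 0 0 :: bit mat" and ?Q = "mat33 0 1 0 1 0 0 0 0 1 :: bit mat"
  show "?P * mat33 0 0 1 0 1 0 1 0 0 = 1\<^sub>m 3" "?Q * mat33 0 1 0 1 0 0 0 0 1 = 1\<^sub>m 3"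
    by (simp_all add: mat33_mult mat33_one)
  show "?P * M * ?Q \<in> V3" if mem: "M \<in> mat_of_rows_list 3 ` cyclic_rows" for M
  proof -
    obtain p q f g where M: "M = mat33 p f 0 0 q g (f + g) 0 (p + q)"
      using mem by (auto simp: cyclic_rows_def mat33_def)
    have "?P * M * ?Q = mat33 0 ((f + g)) (q + p) q 0 g ((f + g) + g) p 0"
      unfolding M mat33_mult by (simp add: ac_simps)
    then show ?thesis unfolding V3_mat33 by blast
  qed
  show "\<exists>M\<in>mat_of_rows_list 3 ` cyclic_rows. N = ?P * M * ?Q" if mem: "N \<in> V3" for N
  proof -
    obtain a b c d where N: "N = mat33 0 a (c + d) c 0 b (a + b) d 0" using mem by (auto simp: V3_mat33)
    let ?M = "mat33 d ((a + b)) 0 0 c b ((a + b) + b) 0 (d + c)"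
    have "?M \<in> mat_of_rows_list 3 ` cyclic_rows" by (auto simp: cyclic_rows_def mat33_def)
    moreover have "N = ?P * ?M * ?Q" unfolding N mat33_mult by (simp add: ac_simps)
    ultimately show ?thesis by blast
  qed
qed simp_all

lemma two_valued_rows_equiv_V3: "mat_space_equiv 3 3 (mat_of_rows_list 3 ` two_valued_rows) V3"
proof (rule equivI)
  let ?P = "mat33 0 0 1 0 1 1 1 0 0 :: bit mat" and ?Q = "mat33 1 1 0 1 0 1 0 0 1 :: bit mat"
  show "?P * mat33 0 0 1 1 1 0 1 0 0 = 1\<^sub>m 3" "?Q * mat33 0 1 1 1 1 1 0 0 1 = 1\<^sub>m 3"
    by (simp_all add: mat33_mult mat33_one)
  show "?P * M * ?Q \<in> V3" if mem: "M \<in> mat_of_rows_list 3 ` two_valued_rows" for M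
  proof -
    obtain p q f g where M: "M = mat33 p f f g q f g g (p + q)"
      using mem by (auto simp: two_valued_rows_def mat33_def)
    have "?P * M * ?Q = mat33 0 g ((g + q) + p) ((g + q)) 0 ((f + g + p)) (g + (f + g + p)) p 0"
      unfolding M mat33_mult by (simp add: ac_simps)
    then show ?thesis unfolding V3_mat33 by blast
  qed
  show "\<exists>M\<in>mat_of_rows_list 3 ` two_valued_rows. N = ?P * M * ?Q" if mem: "N \<in> V3" for N
  proof -
    obtain a b c d where N: "N = mat33 0 a (c + d) c 0 b (a + b) d 0" using mem by (auto simp: V3_mat33)
    let ?M = "mat33 d ((a + b + d)) ((a + b + d)) a ((a + c)) ((a + b + d)) a a (d + (a + c))"
    have "?M \<in> mat_of_rows_list 3 ` two_valued_rows" by (auto simp: two_valued_rows_def mat33_def)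
    moreover have "N = ?P * ?M * ?Q" unfolding N mat33_mult by (simp add: ac_simps)
    ultimately show ?thesis by blast
  qed
qed simp_all

lemma UNIV_bit: "(UNIV :: bit set) = {0, 1}"
proof -
  have "x \<in> {0, 1}" for x :: bit by (cases x) auto
  then show ?thesis by blast
qed

lemma card_bit: "card (UNIV :: bit set) = 2" "finite (UNIV :: bit set)"
  by (simp_all add: UNIV_bit)

lemma card_bit3: "card (UNIV :: (bit \<times> bit \<times> bit) set) = 8" "finite (UNIV :: (bit \<times> bit \<times> bit) set)"
proof -
  have u: "(UNIV :: (bit \<times> bit \<times> bit) set) = UNIV \<times> UNIV \<times> UNIV" by simp
  show "card (UNIV :: (bit \<times> bit \<times> bit) set) = 8" unfolding u card_cartesian_product card_bit by simp
  show "finite (UNIV :: (bit \<times> bit \<times> bit) set)" unfolding u by (intro finite_cartesian_product card_bit(2))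
qed

lemma bscale_apply: "(c \<cdot> x) j = c * x j"
  by (cases c) (auto simp: bscale_def)

text \<open>Count: the coordinates give a bijection from triples of bits to vectors of length \<open>p\<close>, so \<open>8 = 2\<^sup>p\<close>.\<close>

lemma coordinate_basis_length_3:
  fixes x1 x2 x3 :: "nat \<Rightarrow> bit"
  assumes span: "\<And>x. \<exists>c1 c2 c3. \<forall>j<p. x j = c1 * x1 j + c2 * x2 j + c3 * x3 j"
    and indep: "\<And>c1 c2 c3. \<forall>j<p. c1 * x1 j + c2 * x2 j + c3 * x3 j = 0 \<Longrightarrow> c1 = 0 \<and> c2 = 0 \<and> c3 = 0"
  shows "p = 3"
proof -
  let ?F = "\<lambda>(c1, c2, c3). \<lambda>j\<in>{..<p}. c1 * x1 j + c2 * x2 j + c3 * x3 j"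
  let ?E = "{..<p} \<rightarrow>\<^sub>E (UNIV :: bit set)"
  have "inj ?F"
  proof (rule injI)
    fix c d assume e: "?F c = ?F d"
    obtain c1 c2 c3 d1 d2 d3 where cd: "c = (c1, c2, c3)" "d = (d1, d2, d3)" by (cases c; cases d) auto
    have "(c1 + d1) * x1 j + (c2 + d2) * x2 j + (c3 + d3) * x3 j = 0" if "j < p" for j
    proof -
      have "c1 * x1 j + c2 * x2 j + c3 * x3 j = d1 * x1 j + d2 * x2 j + d3 * x3 j"
        using fun_cong[OF e, of j] that by (simp add: cd)
      moreover have "(c1 + d1) * x1 j + (c2 + d2) * x2 j + (c3 + d3) * x3 j =
        (c1 * x1 j + c2 * x2 j + c3 * x3 j) + (d1 * x1 j + d2 * x2 j + d3 * x3 j)"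
        by (simp add: algebra_simps del: bit_add_eq_0_iff)
      ultimately show ?thesis by simp
    qed
    then have "c1 + d1 = 0 \<and> c2 + d2 = 0 \<and> c3 + d3 = 0" by (intro indep) blast
    then show "c = d" by (simp add: cd)
  qed
  moreover have "range ?F = ?E"
  proof (intro equalityI subsetI)
    fix x assume x: "x \<in> ?E"
    obtain c1 c2 c3 where "\<forall>j<p. x j = c1 * x1 j + c2 * x2 j + c3 * x3 j" using span by blast
    then have "x = ?F (c1, c2, c3)" using x by (intro ext) (auto simp: PiE_def extensional_def)
    then show "x \<in> range ?F" by blast
  qed (auto split: if_splits)
  ultimately have "card ?E = card (UNIV :: (bit \<times> bit \<times> bit) set)" using card_image[of ?F UNIV] by simp
  then have "(2 :: nat) ^ p = 8" by (simp add: card_PiE card_bit card_bit3)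
  then have "(2 :: nat) ^ p = 2 ^ 3" by simp
  then show ?thesis by (subst (asm) power_inject_exp) simp_all
qed

text \<open>The inverse has as its columns the coordinates of the unit vectors.\<close>

lemma frame_matrix:
  fixes x1 x2 x3 :: "nat \<Rightarrow> bit"
  assumes span: "\<And>x. \<exists>c1 c2 c3. \<forall>j<3. x j = c1 * x1 j + c2 * x2 j + c3 * x3 j"
  shows "invertible_mat (mat33 (x1 0) (x2 0) (x3 0) (x1 (Suc 0)) (x2 (Suc 0)) (x3 (Suc 0)) (x1 2) (x2 2) (x3 2))"
proof -
  obtain a b c where 1: "\<forall>j<3. (if j = 0 then 1 else 0) = a * x1 j + b * x2 j + c * x3 j"
    using span[of "\<lambda>j. if j = 0 then 1 else 0"] by blast
  obtain d e f where 2: "\<forall>j<3. (if j = Suc 0 then 1 else 0) = d * x1 j + e * x2 j + f * x3 j"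
    using span[of "\<lambda>j. if j = Suc 0 then 1 else 0"] by blast
  obtain g h i where 3: "\<forall>j<3. (if j = 2 then 1 else 0) = g * x1 j + h * x2 j + i * x3 j"
    using span[of "\<lambda>j. if j = 2 then 1 else 0"] by blast
  show ?thesis
  proof (rule invertible_matI)
    show "mat33 (x1 0) (x2 0) (x3 0) (x1 (Suc 0)) (x2 (Suc 0)) (x3 (Suc 0)) (x1 2) (x2 2) (x3 2) * mat33 a d g b e h c f i = 1\<^sub>m 3"
      using 1 2 3 unfolding mat33_mult mat33_one mat33_eq_iff all_less_3 by (simp add: ac_simps)
  qed simp_all
qed

context primitive_space
begin

lemma basis_right_coordinates:
  assumes "basis_right x1 x2 x3"
  shows "\<exists>c1 c2 c3. \<forall>j<p. x j = c1 * x1 j + c2 * x2 j + c3 * x3 j"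
proof -
  obtain c1 c2 c3 where c: "\<forall>b\<in>forms. \<forall>y. b y x = c1 * b y x1 + c2 * b y x2 + c3 * b y x3"
    using assms unfolding basis_right_def by blast
  have "radical_right (x + c1 \<cdot> x1 + c2 \<cdot> x2 + c3 \<cdot> x3)"
    unfolding radical_right_def
  proof (intro ballI allI)
    fix b y assume b: "b \<in> forms"
    from c[rule_format, OF b, of y] show "b y (x + c1 \<cdot> x1 + c2 \<cdot> x2 + c3 \<cdot> x3) = 0"
      using b by (simp add: expand ac_simps)
  qed
  from radical_right_zero[OF this] have "x j = c1 * x1 j + c2 * x2 j + c3 * x3 j" if "j < p" for j
    using that by (simp add: bscale_apply add.assoc)
  then show ?thesis by blast
qed

lemma basis_left_coordinates:
  assumes "basis_left y1 y2 y3"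
  shows "\<exists>c1 c2 c3. \<forall>i<n. y i = c1 * y1 i + c2 * y2 i + c3 * y3 i"
proof -
  obtain c1 c2 c3 where c: "\<forall>b\<in>forms. \<forall>x. b y x = c1 * b y1 x + c2 * b y2 x + c3 * b y3 x"
    using assms unfolding basis_left_def by blast
  have "radical_left (y + c1 \<cdot> y1 + c2 \<cdot> y2 + c3 \<cdot> y3)"
    unfolding radical_left_def
  proof (intro ballI allI)
    fix b x assume b: "b \<in> forms"
    from c[rule_format, OF b, of x] show "b (y + c1 \<cdot> y1 + c2 \<cdot> y2 + c3 \<cdot> y3) x = 0"
      using b by (simp add: expand ac_simps)
  qed
  from radical_left_zero[OF this] have "y i = c1 * y1 i + c2 * y2 i + c3 * y3 i" if "i < n" for i
    using that by (simp add: bscale_apply add.assoc)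
  then show ?thesis by blast
qed

lemma bform_combination_right:
  "bform n p M y (c1 \<cdot> x1 + c2 \<cdot> x2 + c3 \<cdot> x3) = c1 * bform n p M y x1 + c2 * bform n p M y x2 + c3 * bform n p M y x3"
  by (simp add: bform_def bscale_apply sum.distrib sum_distrib_left algebra_simps)

lemma bform_combination_left:
  "bform n p M (c1 \<cdot> y1 + c2 \<cdot> y2 + c3 \<cdot> y3) x = c1 * bform n p M y1 x + c2 * bform n p M y2 x + c3 * bform n p M y3 x"
  by (simp add: bform_def bscale_apply sum.distrib sum_distrib_left algebra_simps)

lemma bform_zero: "bform n p M y (\<lambda>_. 0) = 0" "bform n p M (\<lambda>_. 0) x = 0"
  by (simp_all add: bform_def)

lemma basis_right_independent:
  assumes b: "basis_right x1 x2 x3" and z: "\<forall>j<p. c1 * x1 j + c2 * x2 j + c3 * x3 j = 0"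
  shows "c1 = 0 \<and> c2 = 0 \<and> c3 = 0"
proof -
  have "c1 * bform n p M y x1 + c2 * bform n p M y x2 + c3 * bform n p M y x3 = 0" for M y
  proof -
    have "bform n p M y (c1 \<cdot> x1 + c2 \<cdot> x2 + c3 \<cdot> x3) = bform n p M y (\<lambda>_. 0)"
      using z by (intro bform_cong) (simp_all add: bscale_apply)
    then show ?thesis by (simp only: bform_combination_right bform_zero)
  qed
  then have "\<forall>b\<in>forms. \<forall>y. c1 * b y x1 + c2 * b y x2 + c3 * b y x3 = 0" unfolding forms_def by blast
  then show ?thesis using b unfolding basis_right_def by blast
qed

lemma basis_left_independent:
  assumes b: "basis_left y1 y2 y3" and z: "\<forall>i<n. c1 * y1 i + c2 * y2 i + c3 * y3 i = 0"
  shows "c1 = 0 \<and> c2 = 0 \<and> c3 = 0"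
proof -
  have "c1 * bform n p M y1 x + c2 * bform n p M y2 x + c3 * bform n p M y3 x = 0" for M x
  proof -
    have "bform n p M (c1 \<cdot> y1 + c2 \<cdot> y2 + c3 \<cdot> y3) x = bform n p M (\<lambda>_. 0) x"
      using z by (intro bform_cong) (simp_all add: bscale_apply)
    then show ?thesis by (simp only: bform_combination_left bform_zero)
  qed
  then have "\<forall>b\<in>forms. \<forall>x. c1 * b y1 x + c2 * b y2 x + c3 * b y3 x = 0" unfolding forms_def by blast
  then show ?thesis using b unfolding basis_left_def by blast
qed

text \<open>Because the radicals are zero, the bases modulo the radicals are bases in the usual sense; their
  coordinate matrices provide the equivalence.\<close>

lemma presented_by_equiv:
  assumes "presented_by T"
  shows "n = 3 \<and> p = 3 \<and> mat_space_equiv 3 3 \<V> (mat_of_rows_list 3 ` T)"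
proof -
  obtain y1 y2 y3 x1 x2 x3 where y: "basis_left y1 y2 y3" and x: "basis_right x1 x2 x3"
    and T: "(\<lambda>b. gram b y1 y2 y3 x1 x2 x3) ` forms = T"
    using assms unfolding presented_by_def by blast
  have p: "p = 3"
    by (rule coordinate_basis_length_3[OF basis_right_coordinates[OF x] basis_right_independent[OF x]])
  have n: "n = 3"
    by (rule coordinate_basis_length_3[OF basis_left_coordinates[OF y] basis_left_independent[OF y]])
  define Q where "Q = mat33 (x1 0) (x2 0) (x3 0) (x1 (Suc 0)) (x2 (Suc 0)) (x3 (Suc 0)) (x1 2) (x2 2) (x3 2)"
  define P where "P = (mat33 (y1 0) (y2 0) (y3 0) (y1 (Suc 0)) (y2 (Suc 0)) (y3 (Suc 0)) (y1 2) (y2 2) (y3 2))\<^sup>T"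
  have Qi: "Q \<in> carrier_mat 3 3" "invertible_mat Q"
    unfolding Q_def using frame_matrix[OF basis_right_coordinates[OF x, unfolded p]] by simp_all
  have Pi: "P \<in> carrier_mat 3 3" "invertible_mat P"
    unfolding P_def using invertible_mat_transpose[OF mat33_carrier frame_matrix[OF basis_left_coordinates[OF y, unfolded n]]]
    by simp_all
  have "P * M * Q = mat_of_rows_list 3 (gram (bform n p M) y1 y2 y3 x1 x2 x3)" if M: "M \<in> \<V>" for M
  proof -
    have Mc: "M \<in> carrier_mat 3 3" using M carrier n p by blast
    have e: "(P * M * Q) $$ (i, j) = bform 3 3 M (\<lambda>k. P $$ (i, k)) (\<lambda>l. Q $$ (l, j))" if "i < 3" "j < 3" for i j
      by (rule triple_product_entry[OF Pi(1) Mc Qi(1) that])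
    have q: "bform 3 3 M y (\<lambda>l. Q $$ (l, 0)) = bform 3 3 M y x1"
      "bform 3 3 M y (\<lambda>l. Q $$ (l, Suc 0)) = bform 3 3 M y x2"
      "bform 3 3 M y (\<lambda>l. Q $$ (l, 2)) = bform 3 3 M y x3" for y
      unfolding bform_def sum_lessThan_3 Q_def by simp_all
    have r: "bform 3 3 M (\<lambda>k. P $$ (0, k)) x = bform 3 3 M y1 x"
      "bform 3 3 M (\<lambda>k. P $$ (Suc 0, k)) x = bform 3 3 M y2 x"
      "bform 3 3 M (\<lambda>k. P $$ (2, k)) x = bform 3 3 M y3 x" for x
      unfolding bform_def sum_lessThan_3 P_def mat33_transpose by simp_all
    have "P * M * Q = mat33 (bform 3 3 M y1 x1) (bform 3 3 M y1 x2) (bform 3 3 M y1 x3)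
       (bform 3 3 M y2 x1) (bform 3 3 M y2 x2) (bform 3 3 M y2 x3)
       (bform 3 3 M y3 x1) (bform 3 3 M y3 x2) (bform 3 3 M y3 x3)"
    proof (rule mat33_eqI)
      show "P * M * Q \<in> carrier_mat 3 3" using Pi(1) Mc Qi(1) by auto
      show "\<forall>i<3. \<forall>j<3. (P * M * Q) $$ (i, j) = mat33 (bform 3 3 M y1 x1) (bform 3 3 M y1 x2) (bform 3 3 M y1 x3)
       (bform 3 3 M y2 x1) (bform 3 3 M y2 x2) (bform 3 3 M y2 x3)
       (bform 3 3 M y3 x1) (bform 3 3 M y3 x2) (bform 3 3 M y3 x3) $$ (i, j)"
      proof (intro allI impI)
        fix i j :: nat assume ij: "i < 3" "j < 3"
        have "\<forall>i<3. \<forall>j<3. bform 3 3 M (\<lambda>k. P $$ (i, k)) (\<lambda>l. Q $$ (l, j)) =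
          mat33 (bform 3 3 M y1 x1) (bform 3 3 M y1 x2) (bform 3 3 M y1 x3)
            (bform 3 3 M y2 x1) (bform 3 3 M y2 x2) (bform 3 3 M y2 x3)
            (bform 3 3 M y3 x1) (bform 3 3 M y3 x2) (bform 3 3 M y3 x3) $$ (i, j)"
          unfolding all_less_3 q r mat33_index by simp
        then show "(P * M * Q) $$ (i, j) = mat33 (bform 3 3 M y1 x1) (bform 3 3 M y1 x2) (bform 3 3 M y1 x3)
            (bform 3 3 M y2 x1) (bform 3 3 M y2 x2) (bform 3 3 M y2 x3)
            (bform 3 3 M y3 x1) (bform 3 3 M y3 x2) (bform 3 3 M y3 x3) $$ (i, j)"
          unfolding e[OF ij] using ij by blast
      qed
    qed simp
    then show ?thesis by (simp add: n p gram_def mat33_def)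
  qed
  then have "(\<lambda>M. P * M * Q) ` \<V> = mat_of_rows_list 3 ` (\<lambda>b. gram b y1 y2 y3 x1 x2 x3) ` forms"
    unfolding forms_def image_image by (rule image_cong[OF refl])
  then show ?thesis
    using n p mat_space_equiv_image[OF Pi Qi, of \<V>] T by simp
qed

end

section \<open>The four types are mutually exclusive\<close>

text \<open>An invariant of equivalence: there is a nonzero vector whose image under the space is at most
  one-dimensional.\<close>

definition thin_vector :: "bit mat set \<Rightarrow> bool" where
  "thin_vector \<V> \<longleftrightarrow> (\<exists>x\<in>carrier_vec 3. x \<noteq> 0\<^sub>v 3 \<and> (\<exists>v. \<forall>M\<in>\<V>. M *\<^sub>v x = 0\<^sub>v 3 \<or> M *\<^sub>v x = v))"

lemma thin_vector_equiv:
  assumes c: "\<V> \<subseteq> carrier_mat 3 3" and e: "mat_space_equiv 3 3 \<V> \<W>" and t: "thin_vector \<V>"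
  shows "thin_vector \<W>"
proof -
  obtain P Q where P: "P \<in> carrier_mat 3 3" and Q: "Q \<in> carrier_mat 3 3" "invertible_mat Q"
    and W: "\<W> = (\<lambda>M. P * M * Q) ` \<V>" using e unfolding mat_space_equiv_def by blast
  obtain Q' where Q': "Q' \<in> carrier_mat 3 3" "Q * Q' = 1\<^sub>m 3" using invertible_matE[OF Q] by metis
  obtain x v where x: "x \<in> carrier_vec 3" "x \<noteq> 0\<^sub>v 3" and v: "\<And>M. M \<in> \<V> \<Longrightarrow> M *\<^sub>v x = 0\<^sub>v 3 \<or> M *\<^sub>v x = v"
    using t unfolding thin_vector_def by blast
  have Qx: "Q *\<^sub>v (Q' *\<^sub>v x) = x"
    using assoc_mult_mat_vec[OF Q(1) Q'(1) x(1)] Q'(2) x(1) by simp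
  have "(P * M * Q) *\<^sub>v (Q' *\<^sub>v x) = P *\<^sub>v (M *\<^sub>v x)" if M: "M \<in> \<V>" for M
  proof -
    have Mc: "M \<in> carrier_mat 3 3" using M c by blast
    have "(P * M * Q) *\<^sub>v (Q' *\<^sub>v x) = (P * M) *\<^sub>v (Q *\<^sub>v (Q' *\<^sub>v x))"
      using P Mc Q(1) Q'(1) x(1) by (intro assoc_mult_mat_vec[of _ 3 3]) auto
    also have "\<dots> = P *\<^sub>v (M *\<^sub>v x)" unfolding Qx by (rule assoc_mult_mat_vec[OF P Mc x(1)])
    finally show ?thesis .
  qed
  note eq = this
  have "N *\<^sub>v (Q' *\<^sub>v x) = 0\<^sub>v 3 \<or> N *\<^sub>v (Q' *\<^sub>v x) = P *\<^sub>v v" if N: "N \<in> \<W>" for N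
  proof -
    obtain M where M: "M \<in> \<V>" "N = P * M * Q" using N W by blast
    have "P *\<^sub>v 0\<^sub>v 3 = 0\<^sub>v 3" using P by (intro eq_vecI) auto
    then show ?thesis using v[OF M(1)] eq[OF M(1)] M(2) by auto
  qed
  then have "\<forall>N\<in>\<W>. N *\<^sub>v (Q' *\<^sub>v x) = 0\<^sub>v 3 \<or> N *\<^sub>v (Q' *\<^sub>v x) = P *\<^sub>v v" by blast
  moreover have "Q' *\<^sub>v x \<noteq> 0\<^sub>v 3"
  proof
    assume "Q' *\<^sub>v x = 0\<^sub>v 3"
    moreover have "Q *\<^sub>v 0\<^sub>v 3 = 0\<^sub>v 3" using Q(1) by (intro eq_vecI) auto
    ultimately show False using Qx x(2) by simp
  qed
  moreover have "Q' *\<^sub>v x \<in> carrier_vec 3" using Q'(1) x(1) by simp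
  ultimately show ?thesis unfolding thin_vector_def by blast
qed

definition vec3 :: "'a \<Rightarrow> 'a \<Rightarrow> 'a \<Rightarrow> 'a vec" where
  "vec3 a b c = vec 3 (\<lambda>i. if i = 0 then a else if i = 1 then b else c)"

lemma vec3_simps [simp]:
  "vec3 a b c \<in> carrier_vec 3" "dim_vec (vec3 a b c) = 3"
  "vec3 a b c $ 0 = a" "vec3 a b c $ Suc 0 = b" "vec3 a b c $ 2 = c"
  by (simp_all add: vec3_def)

lemma vec3_eqI:
  assumes "u \<in> carrier_vec 3" "v \<in> carrier_vec 3" "\<forall>i<3. u $ i = v $ i"
  shows "u = v"
  using assms by (intro eq_vecI) auto

lemma vec3_collapse: "x \<in> carrier_vec 3 \<Longrightarrow> x = vec3 (x $ 0) (x $ Suc 0) (x $ 2)"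
  by (rule vec3_eqI) (simp_all add: all_less_3)

lemma vec3_eq_iff: "vec3 a b c = vec3 a' b' c' \<longleftrightarrow> a = a' \<and> b = b' \<and> c = c'"
  by (auto dest: arg_cong[of _ _ "\<lambda>v. v $ 0"] arg_cong[of _ _ "\<lambda>v. v $ Suc 0"] arg_cong[of _ _ "\<lambda>v. v $ 2"])

lemma vec3_zero: "0\<^sub>v 3 = vec3 0 0 0"
  by (rule vec3_eqI) (simp_all add: all_less_3)

lemma mat33_mult_vec3:
  fixes a :: "'a::comm_semiring_0"
  shows "mat33 a b c d e f g h i *\<^sub>v vec3 s t w =
    vec3 (a * s + b * t + c * w) (d * s + e * t + f * w) (g * s + h * t + i * w)"
  by (intro vec3_eqI mult_mat_vec_carrier[of _ 3 3])
    (simp_all add: all_less_3 scalar_prod_def atLeast0LessThan sum_lessThan_3)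

lemma thin_vector_J3:
  assumes "\<W> \<subseteq> J3"
  shows "thin_vector \<W>"
proof -
  have "M *\<^sub>v vec3 1 0 0 = 0\<^sub>v 3 \<or> M *\<^sub>v vec3 1 0 0 = vec3 1 0 0" if mem: "M \<in> \<W>" for M
  proof -
    have "M \<in> J3" using mem assms by blast
    then obtain a b c d e where M: "M = mat33 a c d 0 (a + b) e 0 0 b" unfolding J3_mat33 by blast
    show ?thesis unfolding M mat33_mult_vec3 vec3_zero vec3_eq_iff by (cases a) simp_all
  qed
  moreover have "vec3 1 0 0 \<noteq> (0\<^sub>v 3 :: bit vec)" unfolding vec3_zero vec3_eq_iff by simp
  ultimately show ?thesis
    unfolding thin_vector_def by (intro bexI[of _ "vec3 1 0 0"] conjI exI[of _ "vec3 1 0 0"] ballI) simp_all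
qed

lemma thin_vector_coordinates:
  assumes "thin_vector \<V>" "\<V> \<subseteq> carrier_mat 3 3"
  shows "\<exists>s t w v1 v2 v3. (s, t, w) \<noteq> (0, 0, 0) \<and>
    (\<forall>M\<in>\<V>. M *\<^sub>v vec3 s t w = vec3 0 0 0 \<or> M *\<^sub>v vec3 s t w = vec3 v1 v2 v3)"
proof -
  obtain x v where x: "x \<in> carrier_vec 3" "x \<noteq> 0\<^sub>v 3" and v: "\<And>M. M \<in> \<V> \<Longrightarrow> M *\<^sub>v x = 0\<^sub>v 3 \<or> M *\<^sub>v x = v"
    using assms(1) unfolding thin_vector_def by blast
  obtain s t w where stw: "x = vec3 s t w" using vec3_collapse[OF x(1)] by blast
  have n: "(s, t, w) \<noteq> (0, 0, 0)" using x(2) unfolding stw vec3_zero vec3_eq_iff by simp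
  obtain v1 v2 v3 where v': "v \<in> carrier_vec 3 \<Longrightarrow> v = vec3 v1 v2 v3" using vec3_collapse[of v] by blast
  have "M *\<^sub>v vec3 s t w = vec3 0 0 0 \<or> M *\<^sub>v vec3 s t w = vec3 v1 v2 v3" if M: "M \<in> \<V>" for M
  proof -
    have "M \<in> carrier_mat 3 3" using M assms(2) by blast
    then have c: "M *\<^sub>v x \<in> carrier_vec 3" using x(1) by (rule mult_mat_vec_carrier)
    from v[OF M] show ?thesis
    proof
      assume "M *\<^sub>v x = 0\<^sub>v 3"
      then show ?thesis unfolding stw vec3_zero by simp
    next
      assume e: "M *\<^sub>v x = v"
      then have "v = vec3 v1 v2 v3" using c v' by simp
      then show ?thesis using e unfolding stw by simp
    qed
  qed
  then show ?thesis using n by blast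
qed

lemma not_thin_alternating: "\<not> thin_vector (alternating_mats 3)"
proof
  assume "thin_vector (alternating_mats 3)"
  then obtain s t w v1 v2 v3 :: bit where n: "(s, t, w) \<noteq> (0, 0, 0)" and
    v: "\<forall>M\<in>alternating_mats 3. M *\<^sub>v vec3 s t w = vec3 0 0 0 \<or> M *\<^sub>v vec3 s t w = vec3 v1 v2 v3"
    using thin_vector_coordinates[OF _ carrier_alternating] by blast
  have m: "mat33 0 f g f 0 h g h 0 \<in> alternating_mats 3" for f g h :: bit by (auto simp: alternating_mat33)
  show False
    using n v[rule_format, OF m[of 1 0 0]] v[rule_format, OF m[of 0 1 0]] v[rule_format, OF m[of 0 0 1]] unfolding mat33_mult_vec3 vec3_eq_iff
    by (cases s; cases t; cases w) auto
qed

lemma not_thin_U3: "\<not> thin_vector U3"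
proof
  assume "thin_vector U3"
  then obtain s t w v1 v2 v3 where n: "(s, t, w) \<noteq> (0, 0, 0)" and
    v: "\<forall>M\<in>U3. M *\<^sub>v vec3 s t w = vec3 0 0 0 \<or> M *\<^sub>v vec3 s t w = vec3 v1 v2 v3"
    using thin_vector_coordinates[OF _ carrier_U3] by blast
  have m: "mat33 0 a (a + c) a 0 b (a + b) c 0 \<in> U3" for a b c by (auto simp: U3_mat33)
  show False
    using n v[rule_format, OF m[of 1 0 0]] v[rule_format, OF m[of 0 1 0]] v[rule_format, OF m[of 0 0 1]] unfolding mat33_mult_vec3 vec3_eq_iff
    by (cases s; cases t; cases w) auto
qed

lemma not_thin_V3: "\<not> thin_vector V3"
proof
  assume "thin_vector V3"
  then obtain s t w v1 v2 v3 where n: "(s, t, w) \<noteq> (0, 0, 0)" and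
    v: "\<forall>M\<in>V3. M *\<^sub>v vec3 s t w = vec3 0 0 0 \<or> M *\<^sub>v vec3 s t w = vec3 v1 v2 v3"
    using thin_vector_coordinates[OF _ carrier_V3] by blast
  have m: "mat33 0 a (c + d) c 0 b (a + b) d 0 \<in> V3" for a b c d by (auto simp: V3_mat33)
  show False
    using n v[rule_format, OF m[of 1 0 0 0]] v[rule_format, OF m[of 0 1 0 0]] v[rule_format, OF m[of 0 0 1 0]] v[rule_format, OF m[of 0 0 0 1]]
    unfolding mat33_mult_vec3 vec3_eq_iff
    by (cases s; cases t; cases w) auto
qed

lemma setcompr3_eq_range: "{F a b c | a b c. True} = range (\<lambda>(a, b, c). F a b c)"
proof (intro equalityI subsetI)
  fix y assume "y \<in> {F a b c | a b c. True}"
  then obtain a b c where "y = F a b c" by blast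
  then show "y \<in> range (\<lambda>(a, b, c). F a b c)" by (intro range_eqI[of _ _ "(a, b, c)"]) simp
qed auto

lemma setcompr4_eq_range: "{F a b c d | a b c d. True} = range (\<lambda>(a, b, c, d). F a b c d)"
proof (intro equalityI subsetI)
  fix y assume "y \<in> {F a b c d | a b c d. True}"
  then obtain a b c d where "y = F a b c d" by blast
  then show "y \<in> range (\<lambda>(a, b, c, d). F a b c d)" by (intro range_eqI[of _ _ "(a, b, c, d)"]) simp
qed auto

lemma card_alternating: "card (alternating_mats 3 :: bit mat set) \<le> 8"
proof -
  have eq: "alternating_mats 3 = range (\<lambda>(f, g, h). mat33 0 f g f 0 h g h (0 :: bit))"
    unfolding alternating_mat33 by (rule setcompr3_eq_range)
  show ?thesis unfolding eq by (rule order_trans[OF card_image_le[OF card_bit3(2)]]) (simp add: card_bit3(1))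
qed

lemma card_U3: "card U3 \<le> 8"
proof -
  have eq: "U3 = range (\<lambda>(a, b, c). mat33 0 a (a + c) a 0 b (a + b) c 0)"
    unfolding U3_mat33 by (rule setcompr3_eq_range)
  show ?thesis unfolding eq by (rule order_trans[OF card_image_le[OF card_bit3(2)]]) (simp add: card_bit3(1))
qed

lemma card_V3: "card V3 = 16"
proof -
  have eq: "V3 = range (\<lambda>(a, b, c, d). mat33 0 a (c + d) c 0 b (a + b) d 0)"
    unfolding V3_mat33 by (rule setcompr4_eq_range)
  have inj: "inj (\<lambda>(a, b, c, d). mat33 0 a (c + d) c 0 b (a + b) d (0 :: bit))"
    by (auto simp: inj_on_def mat33_eq_iff)
  have u: "(UNIV :: (bit \<times> bit \<times> bit \<times> bit) set) = UNIV \<times> UNIV \<times> UNIV \<times> UNIV" by simp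
  have "card (UNIV :: (bit \<times> bit \<times> bit \<times> bit) set) = 16"
    unfolding u card_cartesian_product card_bit by simp
  then show ?thesis unfolding eq card_image[OF inj] .
qed

lemma finite_alternating: "finite (alternating_mats 3 :: bit mat set)"
proof -
  have eq: "alternating_mats 3 = range (\<lambda>(f, g, h). mat33 0 f g f 0 h g h (0 :: bit))"
    unfolding alternating_mat33 by (rule setcompr3_eq_range)
  show ?thesis unfolding eq by (rule finite_imageI[OF card_bit3(2)])
qed

lemma finite_U3: "finite U3"
proof -
  have eq: "U3 = range (\<lambda>(a, b, c). mat33 0 a (a + c) a 0 b (a + b) c 0)"
    unfolding U3_mat33 by (rule setcompr3_eq_range)
  show ?thesis unfolding eq by (rule finite_imageI[OF card_bit3(2)])
qed

lemma mat_space_equiv_card_le: "finite \<V> \<Longrightarrow> mat_space_equiv n p \<V> \<W> \<Longrightarrow> card \<W> \<le> card \<V>"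
  unfolding mat_space_equiv_def by (auto intro: card_image_le)

text \<open>If \<open>U3 = P A Q\<close> for the alternating space \<open>A\<close>, then \<open>R = Q\<^sup>T P\<^sup>-\<^sup>1\<close> satisfies \<open>R N = Q\<^sup>T M Q\<close> for
  \<open>N = P M Q\<close>, which is alternating. For the three generators of \<open>U3\<close> these are linear equations for \<open>R\<close>
  whose only solution is zero.\<close>

lemma alternating_not_equiv_U3: "\<not> mat_space_equiv 3 3 (alternating_mats 3) U3"
proof
  assume "mat_space_equiv 3 3 (alternating_mats 3) U3"
  then obtain P Q where P: "P \<in> carrier_mat 3 3" "invertible_mat P" and Q: "Q \<in> carrier_mat 3 3" "invertible_mat Q"
    and U: "U3 = (\<lambda>M. P * M * Q) ` alternating_mats 3" unfolding mat_space_equiv_def by blast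
  obtain P' where P': "P' \<in> carrier_mat 3 3" "P' * P = 1\<^sub>m 3" using invertible_matE[OF P] by metis
  obtain Q' where Q': "Q' \<in> carrier_mat 3 3" "Q * Q' = 1\<^sub>m 3" using invertible_matE[OF Q] by metis
  define R where "R = Q\<^sup>T * P'"
  have Rc: "R \<in> carrier_mat 3 3" using Q(1) P'(1) by (simp add: R_def)
  have alt: "R * N \<in> alternating_mats 3" if N: "N \<in> U3" for N
  proof -
    obtain M where M: "M \<in> alternating_mats 3" "N = P * M * Q" using N U by blast
    have Mc: "M \<in> carrier_mat 3 3" using M(1) carrier_alternating by blast
    have "R * N = Q\<^sup>T * (P' * P) * M * Q"
      unfolding R_def M(2) using P(1) P'(1) Q(1) Mc by (simp add: assoc_mult_mat[of _ 3 3 _ 3 _ 3])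
    then have RN: "R * N = Q\<^sup>T * M * Q" using Q(1) Mc P'(2) by simp
    obtain f g h where Mf: "M = mat33 0 f g f 0 h g h 0" using M(1) by (auto simp: alternating_mat33)
    obtain a b c d e k l m q where Qf: "Q = mat33 a b c d e k l m q" using mat33_collapse[OF Q(1)] by blast
    have "R * N = mat33 0 (a * (f * e + g * m) + d * (f * b + h * m) + l * (g * b + h * e))
        (a * (f * k + g * q) + d * (f * c + h * q) + l * (g * c + h * k))
        (a * (f * e + g * m) + d * (f * b + h * m) + l * (g * b + h * e)) 0
        (b * (f * k + g * q) + e * (f * c + h * q) + m * (g * c + h * k))
        (a * (f * k + g * q) + d * (f * c + h * q) + l * (g * c + h * k))
        (b * (f * k + g * q) + e * (f * c + h * q) + m * (g * c + h * k)) 0"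
      unfolding RN Mf Qf mat33_transpose mat33_mult by (simp add: mat33_eq_iff algebra_simps)
    then show ?thesis unfolding alternating_mat33 by blast
  qed
  obtain a b c d e k l m q where Rf: "R = mat33 a b c d e k l m q" using mat33_collapse[OF Rc] by blast
  have u: "mat33 0 a (a + c) a 0 b (a + b) c 0 \<in> U3" for a b c by (auto simp: U3_mat33)
  have "R = mat33 0 0 0 0 0 0 0 0 0"
    using alt[OF u[of 1 0 0]] alt[OF u[of 0 1 0]] alt[OF u[of 0 0 1]]
    unfolding Rf mat33_mult alternating_mat33 by (auto simp: mat33_eq_iff)
  moreover have "R * P = Q\<^sup>T"
    unfolding R_def using P(1) P'(1) Q(1) P'(2) by (simp add: assoc_mult_mat[of _ 3 3 _ 3 _ 3])
  moreover obtain a b c d e k l m q where "P = mat33 a b c d e k l m q" using mat33_collapse[OF P(1)] by blast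
  ultimately have "Q\<^sup>T = mat33 0 0 0 0 0 0 0 0 0" by (simp add: mat33_mult)
  then have "Q = (mat33 0 0 0 0 0 0 0 0 0)\<^sup>T" by (metis transpose_transpose)
  moreover obtain a b c d e k l m q where "Q' = mat33 a b c d e k l m q" using mat33_collapse[OF Q'(1)] by blast
  ultimately have "(1\<^sub>m 3 :: bit mat) = mat33 0 0 0 0 0 0 0 0 0" using Q'(2) by (simp add: mat33_transpose mat33_mult)
  then show False unfolding mat33_one mat33_eq_iff by simp
qed

section \<open>The classification\<close>

lemma exactly_one_of_four:
  assumes "P \<or> Q \<or> R \<or> S" "\<not> (P \<and> Q)" "\<not> (P \<and> R)" "\<not> (P \<and> S)" "\<not> (Q \<and> R)" "\<not> (Q \<and> S)" "\<not> (R \<and> S)"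
  shows "\<exists>!i::nat. i = 1 \<and> P \<or> i = 2 \<and> Q \<or> i = 3 \<and> R \<or> i = 4 \<and> S"
  using assms by (elim disjE) (auto intro!: ex1I)

theorem theorem1p5:
  fixes n p :: nat and \<V> :: "bit mat set"
  assumes "primitive n p \<V>"
    and "urk n \<V> = 2"
  shows "n = 3 \<and> p = 3 \<and>
    (\<exists>!i::nat.
        (i = 1 \<and> (\<exists>\<W>. mat_subspace 3 3 \<W> \<and> \<W> \<subseteq> J3 \<and> mat_space_equiv 3 3 \<V> \<W>)) \<or>
        (i = 2 \<and> mat_space_equiv 3 3 \<V> (alternating_mats 3)) \<or>
        (i = 3 \<and> mat_space_equiv 3 3 \<V> U3) \<or>
        (i = 4 \<and> mat_space_equiv 3 3 \<V> V3))"
proof -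
  interpret primitive_space n p \<V> by (rule primitive_space.intro[OF assms])
  let ?J = "\<exists>\<W>. mat_subspace 3 3 \<W> \<and> \<W> \<subseteq> J3 \<and> mat_space_equiv 3 3 \<V> \<W>"
  let ?A = "mat_space_equiv 3 3 \<V> (alternating_mats 3)"
  let ?U = "mat_space_equiv 3 3 \<V> U3" and ?V = "mat_space_equiv 3 3 \<V> V3"
  have np: "n = 3 \<and> p = 3" using form_space_classification presented_by_equiv by blast
  have c: "\<V> \<subseteq> carrier_mat 3 3" and s: "mat_subspace 3 3 \<V>" using carrier subspace np by auto
  have some: "?J \<or> ?A \<or> ?U \<or> ?V"
    using form_space_classification
  proof (elim disjE exE conjE)
    fix T assume T: "T \<subseteq> triangular_rows" "presented_by T"
    have "mat_of_rows_list 3 ` T \<subseteq> J3" using T(1) unfolding J3_def triangular_rows_def by blast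
    then have ?J using presented_by_equiv[OF T(2)] mat_space_equiv_subspace[OF s] by blast
    then show ?thesis by blast
  next
    assume "presented_by alternating_rows"
    moreover have "mat_of_rows_list 3 ` alternating_rows = alternating_mats 3"
      unfolding alternating_mat33 alternating_rows_def mat33_def by blast
    ultimately have ?A using presented_by_equiv by metis
    then show ?thesis by blast
  next
    assume "presented_by twisted_rows"
    then have ?U using presented_by_equiv mat_space_equiv_trans[OF c _ twisted_rows_equiv_U3] by blast
    then show ?thesis by blast
  next
    assume "presented_by constant_rows"
    then have ?U using presented_by_equiv mat_space_equiv_trans[OF c _ constant_rows_equiv_U3] by blast
    then show ?thesis by blast
  next
    assume "presented_by cyclic_rows"
    then have ?V using presented_by_equiv mat_space_equiv_trans[OF c _ cyclic_rows_equiv_V3] by blast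
    then show ?thesis by blast
  next
    assume "presented_by two_valued_rows"
    then have ?V using presented_by_equiv mat_space_equiv_trans[OF c _ two_valued_rows_equiv_V3] by blast
    then show ?thesis by blast
  qed
  have thin: "thin_vector \<V>" if ?J
  proof -
    from that obtain \<W> where W: "\<W> \<subseteq> J3" "mat_space_equiv 3 3 \<V> \<W>" "mat_subspace 3 3 \<W>" by (elim exE conjE)
    show ?thesis
      by (rule thin_vector_equiv[OF mat_subspaceD(1)[OF W(3)] mat_space_equiv_sym[OF c W(2)] thin_vector_J3[OF W(1)]])
  qed
  have "\<not> (?J \<and> ?A)"
    using thin thin_vector_equiv[OF c, of "alternating_mats 3"] not_thin_alternating by blast
  moreover have "\<not> (?J \<and> ?U)"
    using thin thin_vector_equiv[OF c, of U3] not_thin_U3 by blast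
  moreover have "\<not> (?J \<and> ?V)"
    using thin thin_vector_equiv[OF c, of V3] not_thin_V3 by blast
  moreover have "\<not> (?A \<and> ?U)"
    using mat_space_equiv_trans[OF carrier_alternating mat_space_equiv_sym[OF c], of U3] alternating_not_equiv_U3 by blast
  moreover have "\<not> (?A \<and> ?V)"
  proof
    assume "?A \<and> ?V"
    then have "mat_space_equiv 3 3 (alternating_mats 3 :: bit mat set) V3"
      using mat_space_equiv_trans[OF carrier_alternating mat_space_equiv_sym[OF c]] by blast
    from mat_space_equiv_card_le[OF finite_alternating this] show False using card_alternating card_V3 by linarith
  qed
  moreover have "\<not> (?U \<and> ?V)"
  proof
    assume "?U \<and> ?V"
    then have "mat_space_equiv 3 3 U3 V3"
      using mat_space_equiv_trans[OF carrier_U3 mat_space_equiv_sym[OF c]] by blast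
    from mat_space_equiv_card_le[OF finite_U3 this] show False using card_U3 card_V3 by linarith
  qed
  ultimately have "\<exists>!i::nat. i = 1 \<and> ?J \<or> i = 2 \<and> ?A \<or> i = 3 \<and> ?U \<or> i = 4 \<and> ?V"
    by (rule exactly_one_of_four[OF some])
  with np show ?thesis by blast
qed

end
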